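(* Let $f:(M,\omega)\to(N,\eta)$ be a holomorphic map between Kähler manifolds (both of complex dimension $n$) that is a biholomorphism onto its image. Then, on $f(M)$ (with all functions on $M$ transported to $f(M)$ by $f^{-1}$), $$ |\partial f|^2\,\Delta_\eta\log\big(|\partial f|^2\circ f^{-1}\big) = -(\omega^{\#}\otimes \mathrm{Ric}\,\eta)(\partial f,\bar\partial f) +\big((R_\omega)^{\#}\otimes \eta\otimes \eta^{\#}\big)(\partial f,\bar\partial f,\partial f^{-1},\bar\partial f^{-1}) +e(f), $$ where $$ e(f)=|\nabla^{1,0}\partial f|^2-|\partial f|^2\,\big|\nabla^{1,0}_\eta\log|\partial f|^2\big|^2 , $$ and $$ |\partial f|^2\,\Delta_\eta\log\big(|\partial f|^2\circ f^{-1}\big) \ge -(\omega^{\#}\otimes \mathrm{Ric}\,\eta)(\partial f,\bar\partial f) +\big((R_\omega)^{\#}\otimes \eta\otimes \eta^{\#}\big)(\partial f,\bar\partial f,\partial f^{-1},\bar\partial f^{-1}). $$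
   Context: Notation. Let $z=(z^1,\dots,z^n)$ be local holomorphic coordinates on $M$ and use $w=f(z)$ as the corresponding local holomorphic coordinates on the open set $f(M)\subset N$ (so that in these coordinates $f$ is the identity). Write $\omega=\sqrt{-1}\,g_{i\bar j}\,dz^i\wedge\overline{dz^j}$ and $\eta=\sqrt{-1}\,h_{i\bar j}\,dw^i\wedge\overline{dw^j}$, with inverse matrices $g^{i\bar j}$, $h^{i\bar j}$; repeated indices are summed. Curvature convention: $R^\omega_{i\bar jk\bar l}=-g_{i\bar j,k\bar l}+g^{s\bar t}g_{i\bar t,k}\,g_{s\bar j,\bar l}$, and $\mathrm{Ric}\,\eta$ has components $\mathrm{Ric}(\eta)_{i\bar j}=-\partial_i\partial_{\bar j}\log\det[h_{k\bar l}]$. The Laplacian of a function $u$ is $\Delta_\eta u=h^{p\bar q}\,\partial_p\partial_{\bar q}u$. The quantity $|\partial f|^2$ is the squared norm of $\partial f$ as a section of $T^{1,0\,\star}M\otimes f^\star T^{1,0}N$ with the metric induced by $\omega$ and $\eta$; that is $|\partial f|^2=\mathrm{tr}_\omega f^\star\eta=g^{i\bar l}h_{i\bar l}$ in the coordinates above. The two curvature terms are $$(\omega^{\#}\otimes \mathrm{Ric}\,\eta)(\partial f,\bar\partial f)=\mathrm{tr}_\omega f^\star\mathrm{Ric}\,\eta=g^{i\bar l}\,\mathrm{Ric}(\eta)_{i\bar l},$$ $$\big((R_\omega)^{\#}\otimes \eta\otimes \eta^{\#}\big)(\partial f,\bar\partial f,\partial f^{-1},\bar\partial f^{-1})=g^{i\bar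 t}g^{s\bar l}R^\omega_{s\bar tp\bar q}\,h_{i\bar l}\,h^{p\bar q},$$ where $\omega^{\#},\eta^{\#}$ are the dual metrics and $(R_\omega)^{\#}$ is the $(2,2)$-type version of the curvature tensor of $\omega$. $\nabla^{1,0}\partial f$ is the $(1,0)$-covariant derivative of $\partial f$, using the Levi-Civita (Chern) connections of $\omega$ on $T^{1,0\,\star}M$ and of $\eta$ on $T^{1,0}N$; its squared norm is taken using $\eta$ on the differentiation index, $\omega$ on the $T^{1,0\,\star}M$ index and $\eta$ on the $T^{1,0}N$ index. In coordinates $z$ that are normal for $\omega$ at a given point, and $w=f(z)$, at that point $$|\nabla^{1,0}\partial f|^2=g^{i\bar l}\,h^{p\bar q}\,h^{s\bar t}\,h_{i\bar t,p}\,h_{s\bar l,\bar q}.$$ Finally, for a function $u$, $|\nabla^{1,0}_\eta u|^2=h^{p\bar q}\,\partial_pu\,\partial_{\bar q}u$ (for real $u$). *)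

theory Defs
  imports "HOL-Analysis.Analysis" "HOL-Library.Complex_Order"
begin

section \<open>Differentiability on open subsets of complex coordinate space\<close>

text \<open>
  Complex differentiability: at every point the real Frechet derivative exists and is given by a
  complex matrix.
\<close>

definition holomorphic_map_on ::
    "(complex^'n \<Rightarrow> complex^'m) \<Rightarrow> (complex^'n) set \<Rightarrow> bool" where
  "holomorphic_map_on F S \<longleftrightarrow>
     open S \<and> (\<forall>z\<in>S. \<exists>A::complex^'n^'m. (F has_derivative (\<lambda>v. A *v v)) (at z))"

primrec Ck_on :: "nat \<Rightarrow> ('a::real_normed_vector \<Rightarrow> 'b::real_normed_vector) \<Rightarrow> 'a set \<Rightarrow> bool" where
  "Ck_on 0 u S \<longleftrightarrow> continuous_on S u"
| "Ck_on (Suc k) u S \<longleftrightarrow>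
     (\<forall>x\<in>S. u differentiable (at x)) \<and>
     (\<forall>v. Ck_on k (\<lambda>x. frechet_derivative u (at x) v) S)"

text \<open>Only used for open \<open>S\<close>.\<close>

definition Cinf_on :: "('a::real_normed_vector \<Rightarrow> 'b::real_normed_vector) \<Rightarrow> 'a set \<Rightarrow> bool" where
  "Cinf_on u S \<longleftrightarrow> (\<forall>k. Ck_on k u S)"

text \<open>
  The Wirtinger operators.  The coordinate vectors of \<open>x\<^sup>j\<close> and \<open>y\<^sup>j\<close>, where
  \<open>z\<^sup>j = x\<^sup>j + \<i> y\<^sup>j\<close>, are \<open>axis j 1\<close> and \<open>axis j \<i>\<close>.
\<close>

definition dz :: "'n \<Rightarrow> (complex^'n \<Rightarrow> complex) \<Rightarrow> complex^'n \<Rightarrow> complex" where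
  "dz j u z = (frechet_derivative u (at z) (axis j 1)
                 - \<i> * frechet_derivative u (at z) (axis j \<i>)) / 2"

definition dzbar :: "'n \<Rightarrow> (complex^'n \<Rightarrow> complex) \<Rightarrow> complex^'n \<Rightarrow> complex" where
  "dzbar j u z = (frechet_derivative u (at z) (axis j 1)
                 + \<i> * frechet_derivative u (at z) (axis j \<i>)) / 2"

text \<open>The entry \<open>cjac F z $ a $ i\<close> is the derivative of the component \<open>F\<^sup>a\<close> in the direction \<open>z\<^sup>i\<close>.\<close>

definition cjac :: "(complex^'n \<Rightarrow> complex^'m) \<Rightarrow> complex^'n \<Rightarrow> complex^'n^'m" where
  "cjac F z = (\<chi> a i. dz i (\<lambda>w. F w $ a) z)"


section \<open>Complex manifolds and holomorphic maps\<close>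

text \<open>A chart is a domain together with a coordinate map, which is only relevant on the domain.\<close>

type_synonym ('a, 'n) chart = "'a set \<times> ('a \<Rightarrow> complex^'n)"

definition chart_inv :: "('a, 'n::finite) chart \<Rightarrow> complex^'n \<Rightarrow> 'a" where
  "chart_inv c = inv_into (fst c) (snd c)"

definition is_chart :: "'a topology \<Rightarrow> ('a, 'n::finite) chart \<Rightarrow> bool" where
  "is_chart X c \<longleftrightarrow>
     openin X (fst c) \<and> open (snd c ` fst c) \<and>
     homeomorphic_map (subtopology X (fst c)) (top_of_set (snd c ` fst c)) (snd c)"

text \<open>An atlas need not be maximal, and manifolds need not be connected.\<close>

definition complex_manifold :: "'a topology \<Rightarrow> ('a, 'n::finite) chart set \<Rightarrow> bool" where
  "complex_manifold X A \<longleftrightarrow>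
     Hausdorff_space X \<and> second_countable X \<and>
     (\<forall>c\<in>A. is_chart X c) \<and> (\<Union>c\<in>A. fst c) = topspace X \<and>
     (\<forall>c\<in>A. \<forall>d\<in>A. holomorphic_map_on (snd d \<circ> chart_inv c) (snd c ` (fst c \<inter> fst d)))"

definition holomorphic_mfd_map ::
    "'a topology \<Rightarrow> ('a, 'm::finite) chart set \<Rightarrow> 'b topology \<Rightarrow> ('b, 'n::finite) chart set
      \<Rightarrow> ('a \<Rightarrow> 'b) \<Rightarrow> bool" where
  "holomorphic_mfd_map X A Y B f \<longleftrightarrow>
     continuous_map X Y f \<and>
     (\<forall>c\<in>A. \<forall>d\<in>B. holomorphic_map_on (snd d \<circ> f \<circ> chart_inv c)
                                       (snd c ` {x \<in> fst c. f x \<in> fst d}))"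

definition restrict_atlas :: "('a, 'n::finite) chart set \<Rightarrow> 'a set \<Rightarrow> ('a, 'n) chart set" where
  "restrict_atlas A W = (\<lambda>c. (fst c \<inter> W, snd c)) ` A"

definition biholomorphic_onto_image ::
    "'a topology \<Rightarrow> ('a, 'n::finite) chart set \<Rightarrow> 'b topology \<Rightarrow> ('b, 'n) chart set
      \<Rightarrow> ('a \<Rightarrow> 'b) \<Rightarrow> bool" where
  "biholomorphic_onto_image X A Y B f \<longleftrightarrow>
     holomorphic_mfd_map X A Y B f \<and> inj_on f (topspace X) \<and>
     openin Y (f ` topspace X) \<and>
     holomorphic_mfd_map (subtopology Y (f ` topspace X)) (restrict_atlas B (f ` topspace X))
       X A (inv_into (topspace X) f)"


section \<open>Kaehler manifolds\<close>

text \<open>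
  Pull-back of a sesquilinear form \<open>H\<close> with components \<open>H $ a $ b\<close> (second index conjugated) by
  the matrix \<open>J\<close>, and the push-forward of a dual form \<open>P\<close> by \<open>K\<close>.
\<close>

definition pull_form :: "complex^'n^'m \<Rightarrow> complex^'m^'m \<Rightarrow> complex^'n^'n" where
  "pull_form J H = (\<chi> i l. \<Sum>a\<in>UNIV. \<Sum>b\<in>UNIV. J $ a $ i * cnj (J $ b $ l) * H $ a $ b)"

definition push_dual :: "complex^'m^'n \<Rightarrow> complex^'m^'m \<Rightarrow> complex^'n^'n" where
  "push_dual K P = (\<chi> p q. \<Sum>a\<in>UNIV. \<Sum>b\<in>UNIV. K $ p $ a * cnj (K $ q $ b) * P $ a $ b)"

text \<open>
  A Hermitian metric is given by its component matrices \<open>metric c z $ i $ j\<close>, which stand for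
  \<open>g\<^sub>i\<^sub>j\<close> with barred second index, in the coordinates of each chart \<open>c\<close> of the atlas, as functions
  of the coordinate point \<open>z\<close>.
\<close>

record ('a, 'n::finite) kaehler_data =
  mfd_top :: "'a topology"
  atlas :: "('a, 'n) chart set"
  metric :: "('a, 'n) chart \<Rightarrow> complex^'n \<Rightarrow> complex^'n^'n"

text \<open>
  The value on a pair of real tangent vectors of the 2-form
  \<open>\<i> \<Sum>\<^sub>i\<^sub>j G\<^sub>i\<^sub>j dz\<^sup>i \<and> cnj dz\<^sup>j\<close>.
\<close>

definition fundamental_form :: "complex^'n^'n \<Rightarrow> complex^'n \<Rightarrow> complex^'n \<Rightarrow> complex" where
  "fundamental_form G u v =
     \<i> * (\<Sum>i\<in>UNIV. \<Sum>j\<in>UNIV. G $ i $ j * (u $ i * cnj (v $ j) - v $ i * cnj (u $ j)))"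

text \<open>
  Closedness is the vanishing of the exterior derivative, evaluated on constant vector fields.
\<close>

definition closed_form_on :: "(complex^'n \<Rightarrow> complex^'n^'n) \<Rightarrow> (complex^'n) set \<Rightarrow> bool" where
  "closed_form_on g S \<longleftrightarrow>
     (\<forall>z\<in>S. \<forall>u v w.
        frechet_derivative (\<lambda>x. fundamental_form (g x) v w) (at z) u
      + frechet_derivative (\<lambda>x. fundamental_form (g x) w u) (at z) v
      + frechet_derivative (\<lambda>x. fundamental_form (g x) u v) (at z) w = 0)"

definition hermitian_pos_def :: "complex^'n^'n \<Rightarrow> bool" where
  "hermitian_pos_def G \<longleftrightarrow>
     (\<forall>i j. G $ j $ i = cnj (G $ i $ j)) \<and>
     (\<forall>v. v \<noteq> 0 \<longrightarrow> 0 < (\<Sum>i\<in>UNIV. \<Sum>j\<in>UNIV. G $ i $ j * v $ i * cnj (v $ j)))"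

definition kaehler_manifold :: "('a, 'n::finite) kaehler_data \<Rightarrow> bool" where
  "kaehler_manifold M \<longleftrightarrow>
     complex_manifold (mfd_top M) (atlas M) \<and>
     (\<forall>c\<in>atlas M.
        (\<forall>i j. Cinf_on (\<lambda>z. metric M c z $ i $ j) (snd c ` fst c)) \<and>
        (\<forall>z\<in>snd c ` fst c. hermitian_pos_def (metric M c z)) \<and>
        closed_form_on (metric M c) (snd c ` fst c)) \<and>
     (\<forall>c\<in>atlas M. \<forall>d\<in>atlas M. \<forall>x\<in>fst c \<inter> fst d.
        metric M c (snd c x) = pull_form (cjac (snd d \<circ> chart_inv c) (snd c x)) (metric M d (snd d x)))"


section \<open>Metric quantities on one manifold\<close>

text \<open>
  In what follows tensor components are taken in the coordinates of a chart \<open>c\<close> and scalars are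
  the corresponding contractions at a point \<open>x\<close> of the domain of \<open>c\<close>.

  The transpose gives the index convention
  \<open>\<Sum>\<^sub>j dual_metric G $ i $ j * G $ k $ j = (if i = k then 1 else 0)\<close> for the inverse with upper
  indices \<open>i\<close> and barred \<open>j\<close>.
\<close>

definition dual_metric :: "complex^'n^'n \<Rightarrow> complex^'n^'n" where
  "dual_metric G = transpose (matrix_inv G)"

abbreviation dmetric ::
    "('a, 'n::finite) kaehler_data \<Rightarrow> ('a, 'n) chart \<Rightarrow> complex^'n \<Rightarrow> complex^'n^'n" where
  "dmetric M c z \<equiv> dual_metric (metric M c z)"

text \<open>
  Chern connection: \<open>\<nabla>\<^sub>p \<partial>\<^sub>i = \<Sum>\<^sub>k christoffel M c z k p i \<partial>\<^sub>k\<close>.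
\<close>

definition christoffel ::
    "('a, 'n::finite) kaehler_data \<Rightarrow> ('a, 'n) chart \<Rightarrow> complex^'n \<Rightarrow> 'n \<Rightarrow> 'n \<Rightarrow> 'n \<Rightarrow> complex" where
  "christoffel M c z k p i =
     (\<Sum>t\<in>UNIV. dmetric M c z $ k $ t * dz p (\<lambda>w. metric M c w $ i $ t) z)"

text \<open>In \<open>curvature M c z i j k l\<close> the indices \<open>j\<close> and \<open>l\<close> are the barred ones.\<close>

definition curvature ::
    "('a, 'n::finite) kaehler_data \<Rightarrow> ('a, 'n) chart \<Rightarrow> complex^'n
      \<Rightarrow> 'n \<Rightarrow> 'n \<Rightarrow> 'n \<Rightarrow> 'n \<Rightarrow> complex" where
  "curvature M c z i j k l =
     - dzbar l (dz k (\<lambda>w. metric M c w $ i $ j)) z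
     + (\<Sum>s\<in>UNIV. \<Sum>t\<in>UNIV. dmetric M c z $ s $ t
          * dz k (\<lambda>w. metric M c w $ i $ t) z * dzbar l (\<lambda>w. metric M c w $ s $ j) z)"

definition ricci ::
    "('a, 'n::finite) kaehler_data \<Rightarrow> ('a, 'n) chart \<Rightarrow> complex^'n \<Rightarrow> complex^'n^'n" where
  "ricci M c z = (\<chi> i j. - dz i (dzbar j (\<lambda>w. Ln (det (metric M c w)))) z)"

definition laplacian ::
    "('a, 'n::finite) kaehler_data \<Rightarrow> ('a, 'n) chart \<Rightarrow> ('a \<Rightarrow> real) \<Rightarrow> 'a \<Rightarrow> complex" where
  "laplacian M c u x =
     (\<Sum>p\<in>UNIV. \<Sum>q\<in>UNIV. dmetric M c (snd c x) $ p $ q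
        * dz p (dzbar q (\<lambda>w. complex_of_real (u (chart_inv c w)))) (snd c x))"

definition grad_norm_sq ::
    "('a, 'n::finite) kaehler_data \<Rightarrow> ('a, 'n) chart \<Rightarrow> ('a \<Rightarrow> real) \<Rightarrow> 'a \<Rightarrow> complex" where
  "grad_norm_sq M c u x =
     (\<Sum>p\<in>UNIV. \<Sum>q\<in>UNIV. dmetric M c (snd c x) $ p $ q
        * dz p (\<lambda>w. complex_of_real (u (chart_inv c w))) (snd c x)
        * dzbar q (\<lambda>w. complex_of_real (u (chart_inv c w))) (snd c x))"


section \<open>Quantities attached to a biholomorphism onto its image\<close>

text \<open>
  Here \<open>c\<close> is a chart of \<open>M\<close> around \<open>x\<close> and \<open>d\<close> is a chart of \<open>N\<close> around \<open>f x\<close>, not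
  necessarily adapted to each other by \<open>f\<close>; the components of \<open>\<partial>f\<close> and \<open>\<partial>f\<^sup>-\<^sup>1\<close> are then the Jacobian
  matrices below.  When \<open>d\<close> is the chart \<open>c \<circ> f\<^sup>-\<^sup>1\<close> both are the identity matrix.
\<close>

definition fwd_inv :: "('a, 'n::finite) kaehler_data \<Rightarrow> ('a \<Rightarrow> 'b) \<Rightarrow> 'b \<Rightarrow> 'a" where
  "fwd_inv M f = inv_into (topspace (mfd_top M)) f"

definition del_f ::
    "('a, 'n::finite) chart \<Rightarrow> ('b, 'n) chart \<Rightarrow> ('a \<Rightarrow> 'b) \<Rightarrow> complex^'n \<Rightarrow> complex^'n^'n" where
  "del_f c d f = cjac (snd d \<circ> f \<circ> chart_inv c)"

definition del_f_inv ::
    "('a, 'n::finite) kaehler_data \<Rightarrow> ('a, 'n) chart \<Rightarrow> ('b, 'n) chart \<Rightarrow> ('a \<Rightarrow> 'b)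
      \<Rightarrow> complex^'n \<Rightarrow> complex^'n^'n" where
  "del_f_inv M c d f = cjac (snd c \<circ> fwd_inv M f \<circ> chart_inv d)"

text \<open>The trace of \<open>f\<^sup>\<star>H\<close> with respect to the metric of \<open>M\<close>, for a form \<open>H\<close> at \<open>f x\<close>.\<close>

definition trace_pull ::
    "('a, 'n::finite) kaehler_data \<Rightarrow> ('a, 'n) chart \<Rightarrow> ('b, 'n) chart \<Rightarrow> ('a \<Rightarrow> 'b)
      \<Rightarrow> complex^'n^'n \<Rightarrow> 'a \<Rightarrow> complex" where
  "trace_pull M c d f H x =
     (\<Sum>i\<in>UNIV. \<Sum>l\<in>UNIV. dmetric M c (snd c x) $ i $ l
        * pull_form (del_f c d f (snd c x)) H $ i $ l)"

definition chart_at :: "('a, 'n::finite) kaehler_data \<Rightarrow> 'a \<Rightarrow> ('a, 'n) chart" where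
  "chart_at M x = (SOME c. c \<in> atlas M \<and> x \<in> fst c)"

text \<open>
  \<open>energy M N f\<close> is the function \<open>|\<partial>f|\<^sup>2\<close> on \<open>M\<close>.  The trace is real because the metrics are
  Hermitian, and it does not depend on the charts because the metrics transform as tensors.
\<close>

definition energy ::
    "('a, 'n::finite) kaehler_data \<Rightarrow> ('b, 'n) kaehler_data \<Rightarrow> ('a \<Rightarrow> 'b) \<Rightarrow> 'a \<Rightarrow> real" where
  "energy M N f x =
     (let c = chart_at M x; d = chart_at N (f x)
      in Re (trace_pull M c d f (metric N d (snd d (f x))) x))"

definition log_energy ::
    "('a, 'n::finite) kaehler_data \<Rightarrow> ('b, 'n) kaehler_data \<Rightarrow> ('a \<Rightarrow> 'b) \<Rightarrow> 'b \<Rightarrow> real" where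
  "log_energy M N f y = ln (energy M N f (fwd_inv M f y))"

definition ricci_term ::
    "('a, 'n::finite) kaehler_data \<Rightarrow> ('b, 'n) kaehler_data \<Rightarrow> ('a, 'n) chart \<Rightarrow> ('b, 'n) chart
      \<Rightarrow> ('a \<Rightarrow> 'b) \<Rightarrow> 'a \<Rightarrow> complex" where
  "ricci_term M N c d f x = trace_pull M c d f (ricci N d (snd d (f x))) x"

text \<open>The dual metric of \<open>N\<close>, carried to \<open>M\<close> by \<open>\<partial>f\<^sup>-\<^sup>1\<close>.\<close>

definition dmetric_on_M ::
    "('a, 'n::finite) kaehler_data \<Rightarrow> ('b, 'n) kaehler_data \<Rightarrow> ('a, 'n) chart \<Rightarrow> ('b, 'n) chart
      \<Rightarrow> ('a \<Rightarrow> 'b) \<Rightarrow> 'a \<Rightarrow> complex^'n^'n" where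
  "dmetric_on_M M N c d f x =
     push_dual (del_f_inv M c d f (snd d (f x))) (dmetric N d (snd d (f x)))"

definition curvature_term ::
    "('a, 'n::finite) kaehler_data \<Rightarrow> ('b, 'n) kaehler_data \<Rightarrow> ('a, 'n) chart \<Rightarrow> ('b, 'n) chart
      \<Rightarrow> ('a \<Rightarrow> 'b) \<Rightarrow> 'a \<Rightarrow> complex" where
  "curvature_term M N c d f x =
     (\<Sum>i\<in>UNIV. \<Sum>t\<in>UNIV. \<Sum>s\<in>UNIV. \<Sum>l\<in>UNIV. \<Sum>p\<in>UNIV. \<Sum>q\<in>UNIV.
        dmetric M c (snd c x) $ i $ t * dmetric M c (snd c x) $ s $ l
        * curvature M c (snd c x) s t p q
        * pull_form (del_f c d f (snd c x)) (metric N d (snd d (f x))) $ i $ l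
        * dmetric_on_M M N c d f x $ p $ q)"

text \<open>
  \<open>nabla_del_f M N c d f x a p i\<close> is the \<open>N\<close>-component \<open>a\<close> of \<open>(\<nabla>\<^sub>p \<partial>f) (\<partial>\<^sub>i)\<close>, for the connection on
  the tensor product of the dual of the Chern connection of \<open>M\<close> and the pull-back by \<open>f\<close> of the
  Chern connection of \<open>N\<close>.
\<close>

definition nabla_del_f ::
    "('a, 'n::finite) kaehler_data \<Rightarrow> ('b, 'n) kaehler_data \<Rightarrow> ('a, 'n) chart \<Rightarrow> ('b, 'n) chart
      \<Rightarrow> ('a \<Rightarrow> 'b) \<Rightarrow> 'a \<Rightarrow> 'n \<Rightarrow> 'n \<Rightarrow> 'n \<Rightarrow> complex" where
  "nabla_del_f M N c d f x a p i =
     (let J = del_f c d f (snd c x) in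
        dz p (\<lambda>z. del_f c d f z $ a $ i) (snd c x)
        - (\<Sum>k\<in>UNIV. christoffel M c (snd c x) k p i * J $ a $ k)
        + (\<Sum>b\<in>UNIV. \<Sum>e\<in>UNIV. christoffel N d (snd d (f x)) a b e * J $ b $ p * J $ e $ i))"

text \<open>The differentiation indices \<open>p\<close> and \<open>q\<close> are contracted with the metric of \<open>N\<close>.\<close>

definition nabla_del_f_norm_sq ::
    "('a, 'n::finite) kaehler_data \<Rightarrow> ('b, 'n) kaehler_data \<Rightarrow> ('a, 'n) chart \<Rightarrow> ('b, 'n) chart
      \<Rightarrow> ('a \<Rightarrow> 'b) \<Rightarrow> 'a \<Rightarrow> complex" where
  "nabla_del_f_norm_sq M N c d f x =
     (\<Sum>p\<in>UNIV. \<Sum>q\<in>UNIV. \<Sum>i\<in>UNIV. \<Sum>l\<in>UNIV. \<Sum>a\<in>UNIV. \<Sum>b\<in>UNIV.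
        dmetric_on_M M N c d f x $ p $ q * dmetric M c (snd c x) $ i $ l
        * metric N d (snd d (f x)) $ a $ b
        * nabla_del_f M N c d f x a p i * cnj (nabla_del_f M N c d f x b q l))"

definition e_term ::
    "('a, 'n::finite) kaehler_data \<Rightarrow> ('b, 'n) kaehler_data \<Rightarrow> ('a, 'n) chart \<Rightarrow> ('b, 'n) chart
      \<Rightarrow> ('a \<Rightarrow> 'b) \<Rightarrow> 'a \<Rightarrow> complex" where
  "e_term M N c d f x =
     nabla_del_f_norm_sq M N c d f x
     - complex_of_real (energy M N f x) * grad_norm_sq N d (log_energy M N f) (f x)"

end

theory Submission
  imports Defs "HOL-Complex_Analysis.Cauchy_Integral_Formula"
begin

text \<open>
  Work near one point in the coordinates \<open>w\<close> of a chart of \<open>N\<close>. Let \<open>\<phi>\<close> be the local expression of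
  \<open>f\<^sup>-\<^sup>1\<close>, \<open>G = g \<circ> \<phi>\<close> the metric of \<open>M\<close>, \<open>h\<close> the metric of \<open>N\<close>, and \<open>L\<close> the transposed Jacobian of \<open>f\<close>
  along \<open>\<phi>\<close>, which is a holomorphic matrix function. Writing \<open>L\<^sup>*\<close> for the conjugate transpose,
  the energy \<open>|\<partial>f|\<^sup>2\<close> is \<open>E = tr (G\<^sup>-\<^sup>1 H)\<close> with \<open>H = L h L\<^sup>*\<close>. Keeping everything in matrices makes
  normal coordinates unnecessary, and two arbitrary charts can be used.

  For a metric \<open>H\<close> let \<open>R\<^sup>H = \<partial>\<^sub>pH H\<^sup>-\<^sup>1 \<partial>\<^sub>qH - \<partial>\<^sub>p\<partial>\<^sub>qH\<close> (the index \<open>q\<close> barred) be its curvature. The product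
  rule and the cyclicity of the trace give (\<open>wirt_wirt_trace_inv_mult\<close>)

    \<open>\<partial>\<^sub>p\<partial>\<^sub>q E = - tr (G\<^sup>-\<^sup>1 R\<^sup>H) + tr (G\<^sup>-\<^sup>1 R\<^sup>G G\<^sup>-\<^sup>1 H) + tr (G\<^sup>-\<^sup>1 A\<^sub>p H\<^sup>-\<^sup>1 A\<^sub>q\<^sup>*)\<close>, where \<open>A\<^sub>p = \<partial>\<^sub>pH - \<partial>\<^sub>pG G\<^sup>-\<^sup>1 H\<close>:

  all terms that are quadratic in first derivatives and not part of a curvature complete to one
  square. Contract with the inverse of \<open>h\<close>. Curvature is tensorial under holomorphic changes of
  frame and of coordinates (\<open>chern_curv_holomorphic_congruence\<close>, \<open>chern_curv_compose\<close>), so the second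
  term becomes the curvature term of \<open>M\<close>; by the Kaehler symmetry and Jacobi's formula for the
  derivative of \<open>log det h\<close>, the first becomes the Ricci term (\<open>ricci_contraction\<close>); and \<open>A\<^sub>p = B\<^sub>p h L\<^sup>*\<close>
  with \<open>B\<close> the matrix of \<open>\<nabla>\<partial>f\<close>, so the third is \<open>|\<nabla>\<partial>f|\<^sup>2\<close>. The identity then follows from
  \<open>E \<partial>\<^sub>p\<partial>\<^sub>q log E = \<partial>\<^sub>p\<partial>\<^sub>qE - E \<partial>\<^sub>p(log E) \<partial>\<^sub>q(log E)\<close>.

  For the inequality, \<open>\<partial>\<^sub>pE = tr (B\<^sub>p h L\<^sup>* G\<^sup>-\<^sup>1)\<close> is the scalar product of \<open>B\<^sub>p\<close> with \<open>L\<close>, while \<open>E\<close> is the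
  squared norm of \<open>L\<close>. The error term is therefore the squared norm of the part of \<open>B\<close> orthogonal
  to \<open>L\<close>, which is nonnegative because each of the three metrics involved is a sum of squares
  (\<open>contraction_nonneg\<close>, from the Cholesky factorisation).

  Regularity has to be supplied separately. A holomorphic map is only assumed to be complex
  differentiable, so Cauchy's integral formula is used to show that its partial derivatives are
  again holomorphic (\<open>hol_on_partial\<close>); and curvature and Laplacian take the two Wirtinger
  derivatives in opposite orders, which are compared by the symmetry of second derivatives.
\<close>

section \<open>Wirtinger derivatives\<close>

text \<open>
  The case \<open>s = -1\<close> is \<open>\<partial>/\<partial>z\<^sup>j\<close> and \<open>s = 1\<close> is \<open>\<partial>/\<partial>(cnj z\<^sup>j)\<close>. Most rules have the same proof for both,
  which the parameter \<open>s\<close> makes visible; complex conjugation changes its sign.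
\<close>

definition wirt :: "real \<Rightarrow> 'n::finite \<Rightarrow> (complex^'n \<Rightarrow> complex) \<Rightarrow> complex^'n \<Rightarrow> complex" where
  "wirt s j u z = (frechet_derivative u (at z) (axis j 1)
                 + of_real s * \<i> * frechet_derivative u (at z) (axis j \<i>)) / 2"

lemma dz_eq_wirt: "dz = wirt (-1)" and dzbar_eq_wirt: "dzbar = wirt 1"
  by (intro ext; simp add: dz_def dzbar_def wirt_def)+

lemma frechet_derivative_cong:
  assumes "open S" "z \<in> S" "\<And>x. x \<in> S \<Longrightarrow> u x = v x"
  shows "frechet_derivative u (at z) = frechet_derivative v (at z)"
proof -
  have "(u has_derivative D) (at z) \<longleftrightarrow> (v has_derivative D) (at z)" for D
    using has_derivative_transform_within_open[of u D z UNIV S v]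
      has_derivative_transform_within_open[of v D z UNIV S u] assms by auto
  then show ?thesis by (simp add: frechet_derivative_def)
qed

lemma differentiable_cong_open:
  assumes "open S" "z \<in> S" "\<And>x. x \<in> S \<Longrightarrow> u x = v x" "u differentiable (at z)"
  shows "v differentiable (at z)"
  using has_derivative_transform_within_open[of u _ z UNIV S v] assms
  unfolding differentiable_def by metis

lemma wirt_cong:
  assumes "open S" "z \<in> S" "\<And>x. x \<in> S \<Longrightarrow> u x = v x"
  shows "wirt s j u z = wirt s j v z"
  by (simp add: wirt_def frechet_derivative_cong[OF assms])

lemma wirt_const [simp]: "wirt s j (\<lambda>z. k) z = 0"
  by (simp add: wirt_def frechet_derivative_const)

lemma wirt_add:
  assumes "u differentiable (at z)" "v differentiable (at z)"
  shows "wirt s j (\<lambda>z. u z + v z) z = wirt s j u z + wirt s j v z"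
proof -
  have "frechet_derivative (\<lambda>z. u z + v z) (at z) =
    (\<lambda>h. frechet_derivative u (at z) h + frechet_derivative v (at z) h)"
    by (rule frechet_derivative_at[symmetric], intro has_derivative_add)
      (use assms frechet_derivative_works in blast)+
  then show ?thesis by (simp add: wirt_def field_simps)
qed

lemma wirt_mult:
  assumes "u differentiable (at z)" "v differentiable (at z)"
  shows "wirt s j (\<lambda>z. u z * v z) z = wirt s j u z * v z + u z * wirt s j v z"
proof -
  have "frechet_derivative (\<lambda>z. u z * v z) (at z) =
    (\<lambda>h. u z * frechet_derivative v (at z) h + frechet_derivative u (at z) h * v z)"
    by (rule frechet_derivative_at[symmetric], intro has_derivative_mult)
      (use assms frechet_derivative_works in blast)+
  then show ?thesis by (simp add: wirt_def field_simps)
qed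

lemma wirt_cmult:
  assumes "u differentiable (at z)"
  shows "wirt s j (\<lambda>z. k * u z) z = k * wirt s j u z"
  using wirt_mult[of "\<lambda>_. k" z u] assms by simp

lemma wirt_minus:
  assumes "u differentiable (at z)"
  shows "wirt s j (\<lambda>z. - u z) z = - wirt s j u z"
  using wirt_cmult[of u z s j "-1"] assms by simp

lemma wirt_diff:
  assumes "u differentiable (at z)" "v differentiable (at z)"
  shows "wirt s j (\<lambda>z. u z - v z) z = wirt s j u z - wirt s j v z"
  using wirt_add[of u z "\<lambda>z. - v z"] assms by (simp add: wirt_minus)

lemma wirt_sum:
  assumes "finite I" "\<And>i. i \<in> I \<Longrightarrow> u i differentiable (at z)"
  shows "wirt s j (\<lambda>z. \<Sum>i\<in>I. u i z) z = (\<Sum>i\<in>I. wirt s j (u i) z)"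
  using assms by (induction I rule: finite_induct) (simp_all add: wirt_add)

lemma differentiable_cnj:
  assumes "u differentiable (at z)"
  shows "(\<lambda>z. cnj (u z)) differentiable (at z)"
  using assms has_derivative_cnj unfolding differentiable_def by blast

lemma wirt_cnj:
  assumes "u differentiable (at z)"
  shows "wirt s j (\<lambda>z. cnj (u z)) z = cnj (wirt (-s) j u z)"
proof -
  have "frechet_derivative (\<lambda>z. cnj (u z)) (at z) = (\<lambda>h. cnj (frechet_derivative u (at z) h))"
    by (rule frechet_derivative_at[symmetric], intro has_derivative_cnj)
      (use assms frechet_derivative_works in blast)+
  then show ?thesis by (simp add: wirt_def field_simps)
qed

lemma vec_eq_sum_axis:
  fixes v :: "complex^'n"
  shows "v = (\<Sum>k\<in>UNIV. Re (v$k) *\<^sub>R axis k 1 + Im (v$k) *\<^sub>R axis k \<i>)"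
proof (rule vec_eq_iff[THEN iffD2, rule_format])
  fix i
  have "(\<Sum>k\<in>UNIV. Re (v$k) *\<^sub>R axis k 1 + Im (v$k) *\<^sub>R axis k \<i>) $ i
     = (\<Sum>k\<in>UNIV. if k = i then v $ i else 0)"
    unfolding sum_component
    by (intro sum.cong refl) (auto simp: axis_def complex_eq_iff)
  then show "v $ i = (\<Sum>k\<in>UNIV. Re (v$k) *\<^sub>R axis k 1 + Im (v$k) *\<^sub>R axis k \<i>) $ i" by simp
qed

text \<open>
  The decomposition \<open>du = \<partial>u + \<partial>bar u\<close>: expand the direction in the real basis \<open>axis k 1\<close>, \<open>axis k \<i>\<close> and
  regroup.
\<close>

lemma frechet_derivative_wirt:
  assumes "u differentiable (at z)"
  shows "frechet_derivative u (at z) v = (\<Sum>k\<in>UNIV. wirt (-1) k u z * v$k + wirt 1 k u z * cnj (v$k))"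
proof -
  let ?D = "frechet_derivative u (at z)"
  interpret D: linear ?D by (rule linear_frechet_derivative[OF assms])
  have "?D v = ?D (\<Sum>k\<in>UNIV. Re (v$k) *\<^sub>R axis k 1 + Im (v$k) *\<^sub>R axis k \<i>)"
    using vec_eq_sum_axis[of v] by simp
  also have "\<dots> = (\<Sum>k\<in>UNIV. Re (v$k) *\<^sub>R ?D (axis k 1) + Im (v$k) *\<^sub>R ?D (axis k \<i>))"
    by (simp add: D.sum D.add D.scaleR)
  also have "\<dots> = (\<Sum>k\<in>UNIV. wirt (-1) k u z * v$k + wirt 1 k u z * cnj (v$k))"
    by (intro sum.cong refl) (simp add: wirt_def complex_eq_iff field_simps)
  finally show ?thesis .
qed

lemma wirt_of_has_derivative:
  assumes "(u has_derivative (\<lambda>v. \<Sum>k\<in>UNIV. a k * v$k + b k * cnj (v$k))) (at z)"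
  shows "wirt (-1) j u z = a j" "wirt 1 j u z = b j"
proof -
  have fd: "frechet_derivative u (at z) = (\<lambda>v. \<Sum>k\<in>UNIV. a k * v$k + b k * cnj (v$k))"
    using frechet_derivative_at[OF assms] by simp
  have 1: "frechet_derivative u (at z) (axis j 1) = a j + b j"
    unfolding fd by (subst sum.mono_neutral_right[of UNIV "{j}"]) (auto simp: axis_def)
  have 2: "frechet_derivative u (at z) (axis j \<i>) = \<i> * (a j - b j)"
    unfolding fd by (subst sum.mono_neutral_right[of UNIV "{j}"]) (auto simp: axis_def algebra_simps)
  show "wirt (-1) j u z = a j" "wirt 1 j u z = b j" unfolding wirt_def 1 2
    by (simp_all add: field_simps flip: mult.assoc)
qed

text \<open>
  Holomorphy in the form of the Cauchy-Riemann equations, which is how it enters the product rules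
  below: one of the two Wirtinger derivatives drops out.
\<close>

definition hol_on :: "(complex^'n::finite \<Rightarrow> complex) \<Rightarrow> (complex^'n) set \<Rightarrow> bool" where
  "hol_on u S \<longleftrightarrow> (\<forall>z\<in>S. u differentiable (at z) \<and> (\<forall>j. wirt 1 j u z = 0))"

lemma hol_onD: "hol_on u S \<Longrightarrow> z \<in> S \<Longrightarrow> u differentiable (at z)"
   "hol_on u S \<Longrightarrow> z \<in> S \<Longrightarrow> wirt 1 j u z = 0"
  by (auto simp: hol_on_def)

lemma hol_on_has_derivative:
  assumes "hol_on u S" "z \<in> S"
  shows "(u has_derivative (\<lambda>v. \<Sum>k\<in>UNIV. wirt (-1) k u z * v$k)) (at z)"
proof -
  have "frechet_derivative u (at z) = (\<lambda>v. \<Sum>k\<in>UNIV. wirt (-1) k u z * v$k)"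
    using frechet_derivative_wirt[OF hol_onD(1)[OF assms]] hol_onD(2)[OF assms] by
        (simp add: fun_eq_iff)
  then show ?thesis using frechet_derivative_works[of u "at z"] hol_onD(1)[OF assms] by simp
qed

lemma hol_on_of_has_derivative:
  assumes "\<And>z. z \<in> S \<Longrightarrow> (u has_derivative (\<lambda>v. \<Sum>k\<in>UNIV. a z k * v$k)) (at z)"
  shows "hol_on u S" and "z \<in> S \<Longrightarrow> wirt (-1) j u z = a z j"
proof -
  have *: "z \<in> S \<Longrightarrow> (u has_derivative (\<lambda>v. \<Sum>k\<in>UNIV. a z k * v$k + 0 * cnj (v$k))) (at z)" for z
    using assms by simp
  show "hol_on u S" unfolding hol_on_def
    using assms differentiable_def wirt_of_has_derivative(2)[OF *] by blast
  show "z \<in> S \<Longrightarrow> wirt (-1) j u z = a z j"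
    using wirt_of_has_derivative(1)[OF *] by blast
qed

lemma matrix_component_sum: "(A *v v) $ a = (\<Sum>k\<in>UNIV. A $ a $ k * v $ k)"
  by (simp add: matrix_vector_mult_def)

lemma holomorphic_map_on_component:
  assumes "holomorphic_map_on F S"
  shows "open S" "hol_on (\<lambda>z. F z $ a) S" "z \<in> S \<Longrightarrow> (F has_derivative (\<lambda>v. cjac F z *v v)) (at z)"
proof -
  show "open S" using assms by (simp add: holomorphic_map_on_def)
  from assms obtain A where A: "\<And>z. z \<in> S \<Longrightarrow> (F has_derivative (\<lambda>v. A z *v v)) (at z)"
    unfolding holomorphic_map_on_def by metis
  have "((\<lambda>z. F z $ a) has_derivative (\<lambda>v. (A z *v v) $ a)) (at z)" if "z \<in> S" for z a
    using A[OF that] by (rule bounded_linear.has_derivative[OF bounded_linear_vec_nth])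
  then have *: "((\<lambda>z. F z $ a) has_derivative (\<lambda>v. \<Sum>k\<in>UNIV. A z $ a $ k * v $ k)) (at z)" if "z \<in> S"
      for z a
    using that by (simp add: matrix_component_sum)
  show "hol_on (\<lambda>z. F z $ a) S" by (rule hol_on_of_has_derivative(1)[OF *])
  assume z: "z \<in> S"
  have "cjac F z = A z" unfolding cjac_def vec_eq_iff dz_eq_wirt
    using hol_on_of_has_derivative(2)[OF * z] by simp
  then show "(F has_derivative (\<lambda>v. cjac F z *v v)) (at z)" using A[OF z] by simp
qed

text \<open>
  The differential of \<open>F\<close> is complex linear, so it respects the splitting of \<open>du\<close> into its linear
  and its antilinear part.
\<close>

lemma wirt_compose:
  fixes F :: "complex^'m::finite \<Rightarrow> complex^'n::finite"
  assumes F: "(F has_derivative (\<lambda>v. K *v v)) (at z)" and u: "u differentiable (at (F z))"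
  shows "(\<lambda>x. u (F x)) differentiable (at z)"
    "wirt (-1) j (\<lambda>x. u (F x)) z = (\<Sum>k\<in>UNIV. wirt (-1) k u (F z) * K$k$j)"
    "wirt 1 j (\<lambda>x. u (F x)) z = (\<Sum>k\<in>UNIV. wirt 1 k u (F z) * cnj (K$k$j))"
proof -
  have D: "((\<lambda>x. u (F x)) has_derivative (\<lambda>v. frechet_derivative u (at (F z)) (K *v v))) (at z)"
    using has_derivative_compose[OF F] u frechet_derivative_works by blast
  then show "(\<lambda>x. u (F x)) differentiable (at z)" unfolding differentiable_def by blast
  have "frechet_derivative u (at (F z)) (K *v v) =
     (\<Sum>j\<in>UNIV. (\<Sum>k\<in>UNIV. wirt (-1) k u (F z) * K$k$j) * v$j +
         (\<Sum>k\<in>UNIV. wirt 1 k u (F z) * cnj (K$k$j)) * cnj (v $ j))" for v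
    unfolding frechet_derivative_wirt[OF u] matrix_component_sum sum_distrib_left sum_distrib_right
        sum.distrib cnj_sum complex_cnj_mult mult.assoc
    by (intro arg_cong2[where f="(+)"] sum.swap)
  note D' = D[unfolded this]
  show "wirt (-1) j (\<lambda>x. u (F x)) z = (\<Sum>k\<in>UNIV. wirt (-1) k u (F z) * K$k$j)"
    "wirt 1 j (\<lambda>x. u (F x)) z = (\<Sum>k\<in>UNIV. wirt 1 k u (F z) * cnj (K$k$j))"
    using wirt_of_has_derivative[OF D'] by auto
qed

lemma hol_on_compose:
  fixes F :: "complex^'m::finite \<Rightarrow> complex^'n::finite"
  assumes "hol_on u T" "\<And>z. z \<in> S \<Longrightarrow> F z \<in> T" "holomorphic_map_on F S"
  shows "hol_on (\<lambda>z. u (F z)) S"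
  unfolding hol_on_def
proof (intro ballI conjI allI)
  fix z j assume z: "z \<in> S"
  note F = holomorphic_map_on_component(3)[OF assms(3) z]
  have u: "u differentiable (at (F z))" using assms z hol_onD by blast
  show "(\<lambda>z. u (F z)) differentiable at z" using wirt_compose(1)[OF F u] .
  show "wirt 1 j (\<lambda>z. u (F z)) z = 0" using wirt_compose(3)[OF F u] hol_onD(2)[OF assms(1)] assms(2) z
      by simp
qed

section \<open>Symmetry of second derivatives\<close>

lemma has_vector_derivative_along_line:
  assumes "g differentiable (at (y + t *\<^sub>R w))"
  shows "((\<lambda>t. g (y + t *\<^sub>R w)) has_vector_derivative frechet_derivative g (at (y + t *\<^sub>R w)) w)
      (at t within U)"
proof -
  let ?D = "frechet_derivative g (at (y + t *\<^sub>R w))"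
  interpret D: linear ?D by (rule linear_frechet_derivative[OF assms])
  have 1: "((\<lambda>t. y + t *\<^sub>R w) has_derivative (\<lambda>h. h *\<^sub>R w)) (at t within U)"
    by (auto intro!: derivative_eq_intros)
  have 2: "(g has_derivative ?D) (at (y + t *\<^sub>R w))" using assms frechet_derivative_works by blast
  have "((\<lambda>t. g (y + t *\<^sub>R w)) has_derivative (\<lambda>h. ?D (h *\<^sub>R w))) (at t within U)"
    using has_derivative_compose[OF 1 2] .
  then show ?thesis by (simp add: has_vector_derivative_def D.scaleR)
qed

text \<open>
  By the fundamental theorem of calculus and differentiation under the integral sign,
  \<open>D\<^sub>w u (x + s v) - D\<^sub>w u x\<close> is the integral of \<open>D\<^sub>w D\<^sub>v u (x + \<sigma> v)\<close> over \<open>0 \<le> \<sigma> \<le> s\<close>. Differentiating at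
  \<open>s = 0\<close> gives \<open>D\<^sub>v D\<^sub>w u x = D\<^sub>w D\<^sub>v u x\<close>. One-sided derivatives on a small interval \<open>[0, e]\<close> suffice.
\<close>

lemma second_derivative_symmetric:
  fixes u :: "'a::real_normed_vector \<Rightarrow> complex"
  assumes S: "open S" and C2: "Ck_on (Suc (Suc 0)) u S" and x: "x \<in> S"
  shows "frechet_derivative (\<lambda>y. frechet_derivative u (at y) v) (at x) w =
         frechet_derivative (\<lambda>y. frechet_derivative u (at y) w) (at x) v"
proof -
  define D where "D v y = frechet_derivative u (at y) v" for v y
  define D2 where "D2 v w y = frechet_derivative (D v) (at y) w" for v w y
  have d1: "u differentiable (at y)" if "y \<in> S" for y using C2 that by simp
  have d2: "D v differentiable (at y)" if "y \<in> S" for y v using C2 that by (simp add: D_def[abs_def])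
  have c2: "continuous_on S (D2 v w)" for v w using C2 by (simp add: D_def[abs_def] D2_def[abs_def])
  have c1: "continuous_on S (D v)" for v
    using d2 differentiable_imp_continuous_within continuous_at_imp_continuous_on by blast
  obtain r where r: "r > 0" "ball x r \<subseteq> S" using S x openE by blast
  \<comment> \<open>small enough for the parallelogram with edges \<open>e v\<close>, \<open>e w\<close> at \<open>x\<close> to stay in the ball\<close>
  define e where "e = r / (norm v + norm w + 1)"
  have pos: "0 < norm v + norm w + 1" by (intro add_nonneg_pos) auto
  have e: "e > 0" using r pos by (simp add: e_def)
  have inS: "x + t *\<^sub>R w + s *\<^sub>R v \<in> S" if "t \<in> {0..e}" "s \<in> {0..e}" for s t
  proof -
    have "norm (t *\<^sub>R w + s *\<^sub>R v) \<le> e * norm w + e * norm v"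
      using that by (intro norm_triangle_le add_mono) (auto intro!: mult_right_mono)
    also have "\<dots> < e * (norm v + norm w + 1)" using e by (simp add: algebra_simps)
    also have "\<dots> = r" unfolding e_def using pos by simp
    finally have "norm (t *\<^sub>R w + s *\<^sub>R v) < r" .
    moreover have "dist x (x + t *\<^sub>R w + s *\<^sub>R v) = norm (t *\<^sub>R w + s *\<^sub>R v)"
      unfolding dist_norm by (metis add.assoc add_diff_cancel_left' norm_minus_commute)
    ultimately have "x + t *\<^sub>R w + s *\<^sub>R v \<in> ball x r" by simp
    then show ?thesis using r by blast
  qed
  have inS0: "x + s *\<^sub>R v \<in> S" if "s \<in> {0..e}" for s using inS[of 0 s] that e by simp
  have FTC: "((\<lambda>\<sigma>. D v (x + t *\<^sub>R w + \<sigma> *\<^sub>R v)) has_integral (u (x + t *\<^sub>R w + s *\<^sub>R v) -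
      u (x + t *\<^sub>R w))) {0..s}"
    if t: "t \<in> {0..e}" and s: "s \<in> {0..e}" for s t
  proof -
    have "((\<lambda>\<sigma>. u (x + t *\<^sub>R w + \<sigma> *\<^sub>R v)) has_vector_derivative D v (x + t *\<^sub>R w + \<sigma> *\<^sub>R v))
        (at \<sigma> within {0..s})"
      if "\<sigma> \<in> {0..s}" for \<sigma>
      unfolding D_def using that s t by (intro has_vector_derivative_along_line d1 inS) auto
    from fundamental_theorem_of_calculus[OF _ this] show ?thesis using s by simp
  qed
  have key: "D w (x + s *\<^sub>R v) - D w x = integral {0..s} (\<lambda>\<sigma>. D2 v w (x + \<sigma> *\<^sub>R v))" if s: "s \<in> {0..e}"
      for s
  proof -
    have "((\<lambda>t. integral (cbox 0 s) (\<lambda>\<sigma>. D v (x + t *\<^sub>R w + \<sigma> *\<^sub>R v))) has_vector_derivative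
            integral (cbox 0 s) (\<lambda>\<sigma>. D2 v w (x + 0 *\<^sub>R w + \<sigma> *\<^sub>R v))) (at 0 within {0..e})"
    proof (rule leibniz_rule_vector_derivative)
      fix t \<sigma> assume "t \<in> {0..e}" "\<sigma> \<in> cbox 0 s"
      then have "x + \<sigma> *\<^sub>R v + t *\<^sub>R w \<in> S" using inS[of t \<sigma>] s by (simp add: algebra_simps)
      from has_vector_derivative_along_line[OF d2[OF this]]
      show "((\<lambda>t. D v (x + t *\<^sub>R w + \<sigma> *\<^sub>R v)) has_vector_derivative D2 v w (x + t *\<^sub>R w + \<sigma> *\<^sub>R v))
          (at t within {0..e})"
        by (simp add: D2_def algebra_simps)
    next
      fix t assume "t \<in> {0..e}" then show "(\<lambda>\<sigma>. D v (x + t *\<^sub>R w + \<sigma> *\<^sub>R v)) integrable_on cbox 0 s"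
        using FTC[of t s] s by auto
    next
      show "continuous_on ({0..e} \<times> cbox 0 s) (\<lambda>(t, \<sigma>). D2 v w (x + t *\<^sub>R w + \<sigma> *\<^sub>R v))"
        unfolding split_beta
        by (rule continuous_on_compose2[OF c2]) (use s inS in \<open>auto intro!: continuous_intros\<close>)
    qed (use e in auto)
    then have 1: "((\<lambda>t. integral (cbox 0 s) (\<lambda>\<sigma>. D v (x + t *\<^sub>R w + \<sigma> *\<^sub>R v))) has_vector_derivative
            integral {0..s} (\<lambda>\<sigma>. D2 v w (x + \<sigma> *\<^sub>R v))) (at 0 within {0..e})" by simp
    have 2: "((\<lambda>t. u (x + t *\<^sub>R w + s *\<^sub>R v) - u (x + t *\<^sub>R w)) has_vector_derivative
            D w (x + s *\<^sub>R v) - D w x) (at 0 within {0..e})"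
      using has_vector_derivative_along_line[of u "x + s *\<^sub>R v" 0 w "{0..e}"]
        has_vector_derivative_along_line[of u "x" 0 w "{0..e}"] d1[OF inS0[OF s]] d1[OF x] s
      by (intro has_vector_derivative_diff) (simp_all add: D_def add.commute add.left_commute)
    have "((\<lambda>t. u (x + t *\<^sub>R w + s *\<^sub>R v) - u (x + t *\<^sub>R w)) has_vector_derivative
            integral {0..s} (\<lambda>\<sigma>. D2 v w (x + \<sigma> *\<^sub>R v))) (at 0 within {0..e})"
      by (rule has_vector_derivative_transform[OF _ _ 1])
          (use e integral_unique[OF FTC[OF _ s]] in auto)
    with 2 show ?thesis using e vector_derivative_unique_within_closed_interval[of 0 e 0] by auto
  qed
  have "((\<lambda>s. integral {0..s} (\<lambda>\<sigma>. D2 v w (x + \<sigma> *\<^sub>R v))) has_vector_derivative D2 v w (x + 0 *\<^sub>R v))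
      (at 0 within {0..e})"
    using e inS0
    by (intro integral_has_vector_derivative continuous_on_compose2[OF c2])
        (auto intro!: continuous_intros)
  then have 1: "((\<lambda>s. D w (x + s *\<^sub>R v) - D w x) has_vector_derivative D2 v w x) (at 0 within {0..e})"
    using e key has_vector_derivative_transform[of 0 "{0..e}" "\<lambda>s. D w (x + s *\<^sub>R v) -
        D w x" "\<lambda>s. integral {0..s} (\<lambda>\<sigma>. D2 v w (x + \<sigma> *\<^sub>R v))" "D2 v w x"] by simp
  have 2: "((\<lambda>s. D w (x + s *\<^sub>R v) - D w x) has_vector_derivative D2 w v x) (at 0 within {0..e})"
    using has_vector_derivative_diff[OF has_vector_derivative_along_line[of "D w" x 0 v "{0..e}"]
        has_vector_derivative_const[of "D w x"]] d2[OF x]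
    by (simp add: D2_def)
  from 1 2 have "D2 v w x = D2 w v x"
    using e vector_derivative_unique_within_closed_interval[of 0 e 0] by auto
  then show ?thesis by (simp add: D2_def D_def[abs_def])
qed

text \<open>
  What the smoothness of the metrics is used for: two Wirtinger derivatives, taken in either order.
\<close>

definition wirt2 :: "(complex^'n::finite \<Rightarrow> complex) \<Rightarrow> (complex^'n) set \<Rightarrow> bool" where
  "wirt2 u S \<longleftrightarrow> (\<forall>z\<in>S. u differentiable (at z) \<and> (\<forall>s q. wirt s q u differentiable (at z)) \<and>
      (\<forall>s t p q. wirt s p (wirt t q u) z = wirt t q (wirt s p u) z))"

lemma wirt2_of_Cinf_on:
  assumes "open S" "Cinf_on u S"
  shows "wirt2 u S"
proof -
  have C2: "Ck_on (Suc (Suc 0)) u S" using assms unfolding Cinf_on_def by blast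
  let ?D = "\<lambda>v y. frechet_derivative u (at y) v"
  have d: "u differentiable (at z)" "?D v differentiable (at z)" if "z \<in> S" for z v
    using C2 that by auto
  have w: "wirt s q u = (\<lambda>y. (?D (axis q 1) y + of_real s * \<i> * ?D (axis q \<i>) y) * (1/2))" for s q
    by (simp add: wirt_def fun_eq_iff)
  have fd: "frechet_derivative (wirt t q u) (at z) v =
      (frechet_derivative (?D (axis q 1)) (at z) v +
          of_real t * \<i> * frechet_derivative (?D (axis q \<i>)) (at z) v) * (1/2)"
    if z: "z \<in> S" for z t q v
  proof -
    note * = frechet_derivative_works[THEN iffD1, OF d(2)[OF z]]
    have "(wirt t q u has_derivative (\<lambda>v. (frechet_derivative (?D (axis q 1)) (at z) v
       + of_real t * \<i> * frechet_derivative (?D (axis q \<i>)) (at z) v) * (1/2))) (at z)"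
      unfolding w by (intro has_derivative_mult_left has_derivative_add has_derivative_mult_right * )
    from fun_cong[OF frechet_derivative_at[OF this], of v] show ?thesis by simp
  qed
  show ?thesis unfolding wirt2_def
  proof (intro ballI conjI allI)
    fix z s t p q assume z: "z \<in> S"
    show "u differentiable (at z)" using d z by auto
    show "wirt s q u differentiable (at z)" for s q unfolding w using d(2) z
      by (intro derivative_intros) auto
    note sym = second_derivative_symmetric[OF assms(1) C2 z]
    show "wirt s p (wirt t q u) z = wirt t q (wirt s p u) z"
      unfolding wirt_def[of s p "wirt t q u"] wirt_def[of t q "wirt s p u"] fd[OF z]
      using sym[of "axis p 1" "axis q 1"] sym[of "axis p 1" "axis q \<i>"] sym[of "axis p \<i>" "axis q 1"]
          sym[of "axis p \<i>" "axis q \<i>"]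
      by (simp add: algebra_simps)
  qed
qed

section \<open>Partial derivatives of holomorphic functions are holomorphic\<close>

lemma norm_axis: "norm (axis i x :: complex^'n) = norm x"
proof -
  have "(\<Sum>k\<in>UNIV. (norm ((axis i x :: complex^'n) $ k))\<^sup>2) = (norm x)\<^sup>2"
    by (subst sum.mono_neutral_right[of UNIV "{i}"]) (auto simp: axis_def)
  then show ?thesis by (simp add: norm_vec_def L2_set_def)
qed

lemma bounded_linear_axis: "bounded_linear (\<lambda>x. axis i x :: complex^'n)"
  by (rule linear_conv_bounded_linear[THEN iffD1]) (auto intro!: linearI simp: vec_eq_iff axis_def)

lemma add_axis_in_cball:
  fixes z :: "complex^'n"
  assumes "z \<in> ball z0 r" "norm \<zeta> \<le> r"
  shows "z + axis i \<zeta> \<in> cball z0 (2 * r)"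
proof -
  have "dist z0 (z + axis i \<zeta>) \<le> dist z0 z + dist z (z + axis i \<zeta>)" by (rule dist_triangle)
  also have "\<dots> \<le> r + r" using assms by (intro add_mono) (auto simp: dist_norm norm_axis)
  finally show ?thesis by simp
qed

text \<open>
  Cauchy's formula for the derivative in the single variable \<open>z\<^sup>i\<close>, on a circle around \<open>z\<close> whose radius
  is the same for all \<open>z\<close> near \<open>z\<^sub>0\<close>. The kernel \<open>\<kappa>\<close> then does not depend on \<open>z\<close>, so regularity of the
  integrand in \<open>z\<close> passes to the partial derivative.
\<close>

lemma hol_on_Cauchy:
  fixes u :: "complex^'n::finite \<Rightarrow> complex"
  assumes u: "hol_on u S" and r: "r > 0" "cball z0 (2 * r) \<subseteq> S"
  obtains \<gamma> \<kappa> where "continuous_on {0..1::real} \<gamma>" "continuous_on {0..1} \<kappa>"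
    "\<And>t. t \<in> {0..1} \<Longrightarrow> norm (\<gamma> t) = r"
    "\<And>z. z \<in> ball z0 r \<Longrightarrow> ((\<lambda>t. u (z + axis i (\<gamma> t)) * \<kappa> t) has_integral (wirt (-1) i u z)) {0..1}"
proof -
  define \<gamma> where "\<gamma> = circlepath 0 r"
  define \<kappa> where "\<kappa> t = 1 / (\<gamma> t)^2 * (2 * pi * \<i> * r * exp(2 * of_real pi * \<i> * t)) / (2 * pi * \<i>)"
      for t
  have n\<gamma>: "norm (\<gamma> t) = r" for t using r by (simp add: \<gamma>_def circlepath norm_mult)
  have c\<gamma>: "continuous_on {0..1} \<gamma>" unfolding \<gamma>_def circlepath by (intro continuous_intros)
  have "\<gamma> t \<noteq> 0" for t using n\<gamma>[of t] r by auto
  then have c\<kappa>: "continuous_on {0..1} \<kappa>" unfolding \<kappa>_def by (intro continuous_intros c\<gamma>) auto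
  have "((\<lambda>t. u (z + axis i (\<gamma> t)) * \<kappa> t) has_integral (wirt (-1) i u z)) {0..1}" if z: "z \<in> ball z0 r"
      for z
  proof -
    have inS: "z + axis i \<zeta> \<in> S" if "norm \<zeta> \<le> r" for \<zeta>
      using add_axis_in_cball[OF z that] r(2) by blast
    have D: "((\<lambda>\<zeta>. u (z + axis i \<zeta>)) has_field_derivative wirt (-1) i u (z + axis i \<zeta>)) (at \<zeta>)"
      if "norm \<zeta> \<le> r" for \<zeta>
    proof -
      have 1: "((\<lambda>\<zeta>. z + axis i \<zeta>) has_derivative (\<lambda>h. axis i h)) (at \<zeta>)"
        using has_derivative_add[OF
            has_derivative_const bounded_linear_imp_has_derivative[OF bounded_linear_axis]] by simp
      have "((\<lambda>\<zeta>. u (z + axis i \<zeta>))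
          has_derivative (\<lambda>h. \<Sum>k\<in>UNIV. wirt (-1) k u (z + axis i \<zeta>) * axis i h $ k)) (at \<zeta>)"
        using has_derivative_compose[OF 1 hol_on_has_derivative[OF u inS[OF that]]] .
      moreover have "(\<lambda>h. \<Sum>k\<in>UNIV. wirt (-1) k u (z + axis i \<zeta>) * axis i h $ k) =
          (*) (wirt (-1) i u (z + axis i \<zeta>))"
        by (intro ext, subst sum.mono_neutral_right[of UNIV "{i}"]) (auto simp: axis_def)
      ultimately show ?thesis by (simp add: has_field_derivative_def)
    qed
    have cont: "continuous_on (cball 0 r) (\<lambda>\<zeta>. u (z + axis i \<zeta>))"
      using DERIV_isCont[OF D] by (intro continuous_at_imp_continuous_on) auto
    have hol: "(\<lambda>\<zeta>. u (z + axis i \<zeta>)) holomorphic_on ball 0 r"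
      unfolding holomorphic_on_def field_differentiable_def
      using D by (metis mem_ball_0 less_imp_le has_field_derivative_at_within)
    have "((\<lambda>\<zeta>. u (z + axis i \<zeta>) / (\<zeta> - 0) ^ Suc 1) has_contour_integral 2 * pi * \<i> / fact
        1 * (deriv ^^ 1) (\<lambda>\<zeta>. u (z + axis i \<zeta>)) 0) (circlepath 0 r)"
      by (rule Cauchy_has_contour_integral_higher_derivative_circlepath[OF cont hol]) (use r in auto)
    then have "((\<lambda>\<zeta>. u (z + axis i \<zeta>) / \<zeta>^2) has_contour_integral 2 * pi * \<i> * deriv (\<lambda>\<zeta>. u (z +
        axis i \<zeta>)) 0) (circlepath 0 r)"
      by (simp add: power2_eq_square)
    also have "deriv (\<lambda>\<zeta>. u (z + axis i \<zeta>)) 0 = wirt (-1) i u z"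
      using DERIV_imp_deriv[OF D[of 0]] r by (simp add: axis_def flip: zero_vec_def)
    finally have "((\<lambda>t. u (z + axis i (\<gamma> t)) / (\<gamma> t)^2 * (2 * pi * \<i> * r * exp(2 * of_real pi * \<i> * t)))
        has_integral 2 * pi * \<i> * wirt (-1) i u z) {0..1}"
      unfolding has_contour_integral vector_derivative_circlepath \<gamma>_def by simp
    from has_integral_mult_right[OF this, of "1 / (2 * pi * \<i>)"] show ?thesis by
        (simp add: \<kappa>_def field_simps)
  qed
  with that[of \<gamma> \<kappa>] n\<gamma> c\<gamma> c\<kappa> show ?thesis by blast
qed

text \<open>
  The formula \<open>hol_on_Cauchy\<close> expresses the partial derivative by the values of \<open>u\<close>, which are
  continuous; continuity of the derivatives of \<open>u\<close> is not known at this point.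
\<close>

lemma hol_on_partial_continuous:
  fixes u :: "complex^'n::finite \<Rightarrow> complex"
  assumes S: "open S" and u: "hol_on u S"
  shows "continuous_on S (wirt (-1) i u)"
proof (rule continuous_at_imp_continuous_on, rule ballI)
  fix z0 assume "z0 \<in> S"
  then obtain r0 where "r0 > 0" "cball z0 r0 \<subseteq> S" using S open_contains_cball by blast
  then obtain r where r: "r > 0" "cball z0 (2 * r) \<subseteq> S" using that[of "r0 / 2"] by auto
  obtain \<gamma> \<kappa> where c: "continuous_on {0..1::real} \<gamma>" "continuous_on {0..1} \<kappa>"
    and n: "\<And>t. t \<in> {0..1} \<Longrightarrow> norm (\<gamma> t) = r"
    and I: "\<And>z. z \<in> ball z0 r \<Longrightarrow> ((\<lambda>t. u (z + axis i (\<gamma> t)) * \<kappa> t)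
        has_integral (wirt (-1) i u z)) {0..1}"
    by (rule hol_on_Cauchy[OF u r, of i]) blast
  have cu: "continuous_on S u"
      using hol_onD(1)[OF u] differentiable_imp_continuous_within continuous_at_imp_continuous_on
      by blast
  have "continuous_on (ball z0 r) (\<lambda>z. integral (cbox 0 1) (\<lambda>t. u (z + axis i (\<gamma> t)) * \<kappa> t))"
  proof (rule integral_continuous_on_param)
    have "continuous_on (ball z0 r \<times> cbox 0 1) (\<lambda>x. fst x + axis i (\<gamma> (snd x)))"
      by (intro continuous_intros bounded_linear.continuous_on[OF bounded_linear_axis]
          continuous_on_compose2[OF c(1)]) auto
    moreover have "z + axis i (\<gamma> t) \<in> S" if "z \<in> ball z0 r" "t \<in> {0..1}" for z t
      using add_axis_in_cball[OF that(1) eq_refl[OF n[OF that(2)]]] r(2) by blast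
    ultimately have "continuous_on (ball z0 r \<times> cbox 0 1) (\<lambda>x. u (fst x + axis i (\<gamma> (snd x))))"
      by (intro continuous_on_compose2[OF cu]) auto
    moreover have "continuous_on (ball z0 r \<times> cbox 0 (1::real)) (\<lambda>x. \<kappa> (snd x))"
      by (rule continuous_on_compose2[OF c(2)]) (auto intro!: continuous_intros)
    ultimately show "continuous_on (ball z0 r \<times> cbox 0 1) (\<lambda>(z, t). u (z + axis i (\<gamma> t)) * \<kappa> t)"
      unfolding split_beta by (rule continuous_on_mult)
  qed
  then have "continuous_on (ball z0 r) (wirt (-1) i u)"
    by (rule continuous_on_eq) (rule integral_unique, use I in simp)
  then show "isCont (wirt (-1) i u) z0" using r by (simp add: continuous_on_eq_continuous_at)
qed

text \<open>
  With continuous partial derivatives of \<open>u\<close> at hand, the formula \<open>hol_on_Cauchy\<close> can be differentiated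
  under the integral sign. The derivative of the integrand is complex linear in the direction, hence so
  is its integral.
\<close>

lemma hol_on_partial:
  fixes u :: "complex^'n::finite \<Rightarrow> complex"
  assumes S: "open S" and u: "hol_on u S"
  shows "hol_on (wirt (-1) i u) S"
proof -
  have "hol_on (wirt (-1) i u) {z0}" if z0: "z0 \<in> S" for z0
  proof -
    obtain r0 where "r0 > 0" "cball z0 r0 \<subseteq> S" using S open_contains_cball z0 by blast
    then obtain r where r: "r > 0" "cball z0 (2 * r) \<subseteq> S" using that[of "r0 / 2"] by auto
    obtain \<gamma> \<kappa> where c: "continuous_on {0..1::real} \<gamma>" "continuous_on {0..1} \<kappa>"
      and n: "\<And>t. t \<in> {0..1} \<Longrightarrow> norm (\<gamma> t) = r"
      and I: "\<And>z. z \<in> ball z0 r \<Longrightarrow> ((\<lambda>t. u (z + axis i (\<gamma> t)) * \<kappa> t)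
          has_integral (wirt (-1) i u z)) {0..1}"
      by (rule hol_on_Cauchy[OF u r, of i]) blast
    define comp :: "'n \<Rightarrow> (complex^'n) \<Rightarrow>\<^sub>L complex" where "comp k = Blinfun (\<lambda>v. v $ k)" for k
    have comp: "blinfun_apply (comp k) v = v $ k" for k v
      unfolding comp_def by (simp add: bounded_linear_Blinfun_apply bounded_linear_vec_nth)
    define fx where "fx z t =
        (\<Sum>k\<in>UNIV. blinfun_mult_right (wirt (-1) k u (z + axis i (\<gamma> t)) * \<kappa> t) o\<^sub>L comp k)" for z t
    have fx: "blinfun_apply (fx z t) v = (\<Sum>k\<in>UNIV. wirt (-1) k u (z + axis i (\<gamma> t)) * v $ k) * \<kappa> t"
        for z t v
      by (simp add: fx_def blinfun.sum_left comp sum_distrib_left sum_distrib_right algebra_simps)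
    have inS: "z + axis i (\<gamma> t) \<in> S" if "z \<in> ball z0 r" "t \<in> {0..1}" for z t
      using add_axis_in_cball[OF that(1) eq_refl[OF n[OF that(2)]]] r(2) by blast
    have cfx: "continuous_on (ball z0 r \<times> cbox 0 1) (\<lambda>(z, t). fx z t)"
    proof -
      have "continuous_on (ball z0 r \<times> cbox 0 1) (\<lambda>x. fst x + axis i (\<gamma> (snd x)))"
        by (intro continuous_intros bounded_linear.continuous_on[OF bounded_linear_axis]
            continuous_on_compose2[OF c(1)]) auto
      then have "continuous_on (ball z0 r \<times> cbox 0 1) (\<lambda>x. wirt (-1) k u (fst x + axis i (\<gamma> (snd x))))"
          for k
        by (rule continuous_on_compose2[OF hol_on_partial_continuous[OF S u]]) (use inS in auto)
      moreover have "continuous_on (ball z0 r \<times> cbox 0 (1::real)) (\<lambda>x. \<kappa> (snd x))"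
        by (rule continuous_on_compose2[OF c(2)]) (auto intro!: continuous_intros)
      ultimately show ?thesis unfolding split_beta fx_def
        by (intro continuous_on_sum bounded_bilinear.continuous_on[OF bounded_bilinear_blinfun_compose]
          bounded_linear.continuous_on[OF bounded_linear_blinfun_mult_right] continuous_on_mult
              continuous_on_const)
    qed
    have D: "((\<lambda>z. integral (cbox 0 1) (\<lambda>t. u (z + axis i (\<gamma> t)) * \<kappa> t)) has_derivative
          integral (cbox 0 1) (fx z0)) (at z0 within ball z0 r)"
    proof (rule leibniz_rule)
      fix z t assume *: "z \<in> ball z0 r" "t \<in> cbox 0 (1::real)"
      have "((\<lambda>z. z + axis i (\<gamma> t)) has_derivative (\<lambda>v. v)) (at z)"
        by (auto intro!: derivative_eq_intros)
      from has_derivative_compose[OF this hol_on_has_derivative[OF u]] inS[of z t] *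
      have "((\<lambda>z. u (z + axis i (\<gamma> t)))
          has_derivative (\<lambda>v. \<Sum>k\<in>UNIV. wirt (-1) k u (z + axis i (\<gamma> t)) * v$k)) (at z)"
        by simp
      from has_derivative_mult_left[OF this, of "\<kappa> t"]
      show "((\<lambda>z. u (z + axis i (\<gamma> t)) * \<kappa> t) has_derivative blinfun_apply (fx z t))
          (at z within ball z0 r)"
        unfolding fx[abs_def] using has_derivative_at_withinI by (auto simp: fun_eq_iff fx)
    next
      fix z assume "z \<in> ball z0 r" then show "(\<lambda>t. u (z + axis i (\<gamma> t)) * \<kappa> t) integrable_on cbox 0 1"
          using I by auto
    qed (use r cfx in auto)
    have "(wirt (-1) i u has_derivative integral (cbox 0 1) (fx z0)) (at z0 within ball z0 r)"
      by (rule has_derivative_transform[OF _ _ D]) (use r integral_unique[OF I] in auto)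
    then have D': "(wirt (-1) i u has_derivative integral (cbox 0 1) (fx z0)) (at z0)"
      using r at_within_open[of z0 "ball z0 r"] by simp
    have "continuous_on (cbox 0 1) (\<lambda>t. (\<lambda>(z, t). fx z t) (z0, t))"
      by (rule continuous_on_compose2[OF cfx continuous_on_Pair[OF continuous_on_const
          continuous_on_id]]) (use r in auto)
    then have "continuous_on (cbox 0 1) (fx z0)" by simp
    then have int: "fx z0 integrable_on cbox 0 1" by (rule integrable_continuous)
    define a where "a k = integral (cbox 0 1) (fx z0) (axis k 1)" for k
    have cl: "integral (cbox 0 1) (fx z0) v = (\<Sum>k\<in>UNIV. a k * v $ k)" for v
    proof -
      have "integral (cbox 0 1) (fx z0) v = integral (cbox 0 1) (\<lambda>t. fx z0 t v)"
        by (rule blinfun_apply_integral[OF int])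
      also have "\<dots> = integral (cbox 0 1) (\<lambda>t. \<Sum>k\<in>UNIV. fx z0 t (axis k 1) * v $ k)"
      proof -
        have "fx z0 t v = (\<Sum>k\<in>UNIV. fx z0 t (axis k 1) * v $ k)" for t
        proof -
          have "fx z0 t (axis k 1) = wirt (-1) k u (z0 + axis i (\<gamma> t)) * \<kappa> t" for k
            unfolding fx by (subst sum.mono_neutral_right[of UNIV "{k}"]) (auto simp: axis_def)
          then show ?thesis unfolding fx[of z0 t v] by
              (simp add: sum_distrib_left sum_distrib_right algebra_simps)
        qed
        then show ?thesis by simp
      qed
      also have "\<dots> = (\<Sum>k\<in>UNIV. integral (cbox 0 1) (\<lambda>t. fx z0 t (axis k 1) * v $ k))"
      proof (rule integral_sum)
        fix k :: 'n
        have "bounded_linear (\<lambda>L. blinfun_apply L (axis k 1 :: complex^'n) * v $ k)"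
          by (rule bounded_linear_compose[OF bounded_linear_mult_left blinfun.bounded_linear_left])
        from integrable_linear[OF int this]
        show "(\<lambda>t. fx z0 t (axis k 1) * v $ k) integrable_on cbox 0 1" by (simp add: o_def)
      qed simp
      also have "\<dots> = (\<Sum>k\<in>UNIV. a k * v $ k)"
        unfolding a_def blinfun_apply_integral[OF int] by simp
      finally show ?thesis .
    qed
    have "blinfun_apply (integral (cbox 0 1) (fx z0)) = (\<lambda>v. \<Sum>k\<in>UNIV. a k * v $ k)"
      using cl by (rule ext)
    then have "(wirt (-1) i u has_derivative (\<lambda>v. \<Sum>k\<in>UNIV. a k * v$k)) (at z0)" using D' by simp
    then show ?thesis by (intro hol_on_of_has_derivative(1)[of "{z0}" _ "\<lambda>_. a"]) simp
  qed
  then show ?thesis by (simp add: hol_on_def)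
qed

section \<open>Matrix algebra and positive definite Hermitian matrices\<close>

definition hadj :: "complex^'n^'m \<Rightarrow> complex^'m^'n" where
  "hadj A = (\<chi> i j. cnj (A $ j $ i))"

lemma hadj_nth [simp]: "hadj A $ i $ j = cnj (A $ j $ i)" by (simp add: hadj_def)

lemma hadj_hadj [simp]: "hadj (hadj A) = A" by (simp add: vec_eq_iff)
lemma hadj_diff: "hadj (A - B) = hadj A - hadj B" by (simp add: vec_eq_iff)
lemma hadj_mult: "hadj (A ** B) = hadj B ** hadj A"
  by (simp add: vec_eq_iff matrix_matrix_mult_def mult.commute)
lemma hadj_mat_1 [simp]: "hadj (mat 1) = mat 1" by (simp add: vec_eq_iff mat_def)
lemma trace_hadj: "trace (hadj A) = cnj (trace A)" by (simp add: trace_def)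

lemma matrix_add_rdistrib: "(A + B) ** (C::complex^'n^'m) = A ** C + B ** C"
  by (simp add: vec_eq_iff matrix_matrix_mult_def distrib_right sum.distrib)
lemma matrix_diff_ldistrib: "(A::complex^'n^'m) ** (B - C) = A ** B - A ** C"
  by (simp add: vec_eq_iff matrix_matrix_mult_def right_diff_distrib sum_subtractf)
lemma matrix_diff_rdistrib: "(A - B) ** (C::complex^'n^'m) = A ** C - B ** C"
  by (simp add: vec_eq_iff matrix_matrix_mult_def left_diff_distrib sum_subtractf)
lemma matrix_minus_left: "(- A) ** (C::complex^'n^'m) = - (A ** C)"
  by (simp add: vec_eq_iff matrix_matrix_mult_def sum_negf)
lemma matrix_minus_right: "(A::complex^'n^'m) ** (- C) = - (A ** C)"
  by (simp add: vec_eq_iff matrix_matrix_mult_def sum_negf)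
lemma matrix_sum_left: "(\<Sum>i\<in>I. f i) ** (C::complex^'n^'m) = (\<Sum>i\<in>I. f i ** C)"
  by (induction I rule: infinite_finite_induct)
      (simp_all add: vec_eq_iff matrix_matrix_mult_def sum.distrib distrib_right)
lemma matrix_sum_right: "(A::complex^'n^'m) ** (\<Sum>i\<in>I. f i) = (\<Sum>i\<in>I. A ** f i)"
  by (induction I rule: infinite_finite_induct)
      (simp_all add: vec_eq_iff matrix_matrix_mult_def sum.distrib distrib_left)
lemma trace_minus: "trace (- A :: complex^'n^'n) = - trace A" by (simp add: trace_def sum_negf)
lemma trace_sum: "trace (\<Sum>i\<in>I. f i :: complex^'n^'n) = (\<Sum>i\<in>I. trace (f i))"
  by (induction I rule: infinite_finite_induct) (simp_all add: trace_def sum.distrib)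

lemmas matrix_algebra =
    matrix_add_ldistrib matrix_add_rdistrib matrix_diff_ldistrib matrix_diff_rdistrib
  matrix_minus_left matrix_minus_right matrix_mul_assoc

lemma matrix_inv_mult:
  fixes A :: "complex^'n^'n" and B :: "complex^'n^'m"
  assumes "invertible A"
  shows "A ** matrix_inv A = mat 1" "matrix_inv A ** A = mat 1"
    "B ** A ** matrix_inv A = B" "B ** matrix_inv A ** A = B"
proof -
  have "A ** matrix_inv A = mat 1 \<and> matrix_inv A ** A = mat 1"
    using assms unfolding invertible_def matrix_inv_def by (rule someI_ex)
  then show 1: "A ** matrix_inv A = mat 1" "matrix_inv A ** A = mat 1" by auto
  then show "B ** A ** matrix_inv A = B" "B ** matrix_inv A ** A = B"
    by (simp_all add: matrix_mul_assoc[symmetric])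
qed

lemma matrix_inv_unique_right:
  fixes A :: "complex^'n^'n"
  assumes "A ** B = mat 1" shows "matrix_inv A = B" "invertible A"
proof -
  have "B ** A = mat 1" using assms matrix_left_right_inverse by blast
  then show i: "invertible A" using assms invertible_def by blast
  have "matrix_inv A = matrix_inv A ** (A ** B)" using assms by simp
  then show "matrix_inv A = B" using matrix_inv_mult(2)[OF i] by (simp add: matrix_mul_assoc)
qed

lemma matrix_inv_hadj:
  assumes "invertible (A::complex^'n^'n)" shows "matrix_inv (hadj A) =
      hadj (matrix_inv A)" "invertible (hadj A)"
proof -
  have "hadj A ** hadj (matrix_inv A) = mat 1"
    by (simp add: matrix_inv_mult assms flip: hadj_mult)
  from matrix_inv_unique_right[OF this] show "matrix_inv (hadj A) =
      hadj (matrix_inv A)" "invertible (hadj A)" .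
qed

lemma matrix_inv_product:
  assumes "invertible (A::complex^'n^'n)" "invertible (B::complex^'n^'n)"
  shows "matrix_inv (A ** B) = matrix_inv B ** matrix_inv A" "invertible (A ** B)"
proof -
  have "(A ** B) ** (matrix_inv B ** matrix_inv A) = mat 1"
    by (simp add: matrix_mul_assoc matrix_inv_mult assms)
  from matrix_inv_unique_right[OF this] show "matrix_inv (A ** B) = matrix_inv B
      ** matrix_inv A" "invertible (A ** B)" .
qed

lemma invertible_matrix_inv: "invertible (A::complex^'n^'n) \<Longrightarrow> invertible (matrix_inv A)"
  using matrix_inv_mult(1,2) invertible_def by blast

lemma det_cnj: "det (\<chi> i j. cnj (A $ i $ j)) = cnj (det (A::complex^'n^'n))"
  by (simp add: det_def)

lemma det_hadj: "det (hadj A) = cnj (det (A::complex^'n^'n))"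
proof -
  have "hadj A = transpose (\<chi> i j. cnj (A $ i $ j))" by (simp add: vec_eq_iff transpose_def)
  then show ?thesis by (simp add: det_transpose det_cnj)
qed

text \<open>
  Remove one index \<open>k\<close>: the Schur complement \<open>H\<^sub>i\<^sub>j - H\<^sub>i\<^sub>k cnj H\<^sub>j\<^sub>k / H\<^sub>k\<^sub>k\<close> is again positive definite, since it is
  the form \<open>H\<close> minimised over the \<open>k\<close>-th component. The statement is about functions on a finite set
  because the index set shrinks in the induction.
\<close>

lemma Cholesky_aux:
  fixes H :: "'i \<Rightarrow> 'i \<Rightarrow> complex"
  assumes "finite I" "\<And>i j. i \<in> I \<Longrightarrow> j \<in> I \<Longrightarrow> H j i = cnj (H i j)"
    "\<And>v. \<exists>i\<in>I. v i \<noteq> 0 \<Longrightarrow> 0 < (\<Sum>i\<in>I. \<Sum>j\<in>I. H i j * v i * cnj (v j))"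
  shows "\<exists>X. \<forall>i\<in>I. \<forall>j\<in>I. H i j = (\<Sum>k\<in>I. X i k * cnj (X j k))"
  using assms
proof (induction I arbitrary: H rule: finite_induct)
  case empty then show ?case by simp
next
  case (insert k I)
  note herm = insert.prems(1) and pos = insert.prems(2)
  define h where "h = Re (H k k)"
  define e where "e i = (if i = k then 1 else 0 :: complex)" for i
  have "0 < (\<Sum>i\<in>insert k I. \<Sum>j\<in>insert k I. H i j * e i * cnj (e j))"
    by (intro pos) (auto simp: e_def)
  also have "\<dots> = (\<Sum>i\<in>insert k I. \<Sum>j\<in>insert k I. if j = k then (if i = k then H k k else 0) else 0)"
    by (intro sum.cong refl) (auto simp: e_def)
  also have "\<dots> = H k k" using insert.hyps by (simp add: sum.delta)
  finally have "0 < H k k" .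
  then have h: "h > 0" "H k k = of_real h" by (auto simp: h_def less_complex_def complex_eq_iff)
  define S where "S i j = H i j - H i k * cnj (H j k) / h" for i j
  have "\<exists>X. \<forall>i\<in>I. \<forall>j\<in>I. S i j = (\<Sum>k\<in>I. X i k * cnj (X j k))"
  proof (rule insert.IH)
    show "S j i = cnj (S i j)" if "i \<in> I" "j \<in> I" for i j using herm[of i j] that by (simp add: S_def)
  next
    fix v :: "'i \<Rightarrow> complex" assume v: "\<exists>i\<in>I. v i \<noteq> 0"
    define b where "b = (\<Sum>i\<in>I. H i k * v i)"
    \<comment> \<open>the minimiser over the \<open>k\<close>-th component\<close>
    define u where "u = v(k := - b / h)"
    have u: "u i = v i" if "i \<in> I" for i using that insert.hyps by (auto simp: u_def)
    have uk: "u k = - b / h" by (simp add: u_def)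
    have cb: "(\<Sum>j\<in>I. H k j * cnj (v j)) = cnj b"
      unfolding b_def cnj_sum using herm[of k] herm[of _ k] by (intro sum.cong) auto
    have "0 < (\<Sum>i\<in>insert k I. \<Sum>j\<in>insert k I. H i j * u i * cnj (u j))"
      using v u insert.hyps by (intro pos) auto
    also have "\<dots> = H k k * u k * cnj (u k) + u k * (\<Sum>j\<in>I. H k j * cnj (v j)) + cnj (u k) * b
       + (\<Sum>i\<in>I. \<Sum>j\<in>I. H i j * v i * cnj (v j))"
      using insert.hyps by (simp add: u sum.distrib sum_distrib_left b_def algebra_simps)
    also have "\<dots> = (\<Sum>i\<in>I. \<Sum>j\<in>I. H i j * v i * cnj (v j)) - b * cnj b / h"
      unfolding cb uk h using h(1) by (simp add: field_simps)
    also have "b * cnj b / h = (\<Sum>i\<in>I. \<Sum>j\<in>I. H i k * cnj (H j k) / h * v i * cnj (v j))"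
      unfolding b_def cnj_sum sum_product sum_divide_distrib by (intro sum.cong refl) simp
    finally show "0 < (\<Sum>i\<in>I. \<Sum>j\<in>I. S i j * v i * cnj (v j))"
      by (simp add: S_def left_diff_distrib sum_subtractf)
  qed
  then obtain X where X: "\<And>i j. i \<in> I \<Longrightarrow> j \<in> I \<Longrightarrow> S i j = (\<Sum>k\<in>I. X i k * cnj (X j k))" by blast
  define Y where "Y i j = (if j = k then H i k / sqrt h else if i = k then 0 else X i j)" for i j
  have sq: "complex_of_real (sqrt h) * complex_of_real (sqrt h) = of_real h"
    using h by (simp flip: of_real_mult)
  have "H i j = (\<Sum>l\<in>insert k I. Y i l * cnj (Y j l))" if ij: "i \<in> insert k I" "j \<in> insert k I" for i j
  proof -
    have "(\<Sum>l\<in>insert k I. Y i l * cnj (Y j l)) = H i k * cnj (H j k) / h + (\<Sum>l\<in>I. Y i l * cnj (Y j l))"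
      using insert.hyps h by (simp add: Y_def sq)
    also have "(\<Sum>l\<in>I. Y i l * cnj (Y j l)) = (if i = k \<or> j = k then 0 else S i j)"
    proof (cases "i = k \<or> j = k")
      case True
      then have "(\<Sum>l\<in>I. Y i l * cnj (Y j l)) = (\<Sum>l\<in>I. 0)"
        using insert.hyps by (intro sum.cong refl) (auto simp: Y_def)
      then show ?thesis using True by simp
    next
      case False
      then have "(\<Sum>l\<in>I. Y i l * cnj (Y j l)) = (\<Sum>l\<in>I. X i l * cnj (X j l))"
        using insert.hyps by (intro sum.cong refl) (auto simp: Y_def)
      then show ?thesis using False X ij by auto
    qed
    finally show ?thesis using h herm[OF ij(1), of k] herm[OF ij(2), of k] by (auto simp: S_def)
  qed
  then show ?case by blast
qed

lemma hermitian_pos_def_invertible: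
  assumes "hermitian_pos_def (G::complex^'n^'n)" shows "invertible G"
proof -
  have "x = 0" if "G *v x = 0" for x
  proof (rule ccontr)
    assume "x \<noteq> 0"
    define v :: "complex^'n" where "v = (\<chi> i. cnj (x $ i))"
    have "v \<noteq> 0" using \<open>x \<noteq> 0\<close> by (auto simp: vec_eq_iff v_def)
    then have "0 < (\<Sum>i\<in>UNIV. \<Sum>j\<in>UNIV. G $ i $ j * v $ i * cnj (v $ j))"
      using assms unfolding hermitian_pos_def_def by blast
    also have "\<dots> = (\<Sum>i\<in>UNIV. \<Sum>j\<in>UNIV. G $ i $ j * cnj (x $ i) * x $ j)" by (simp add: v_def)
    also have "\<dots> = (\<Sum>i\<in>UNIV. cnj (x $ i) * (G *v x) $ i)"
      by (simp add: matrix_vector_mult_def sum_distrib_left algebra_simps)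
    also have "\<dots> = 0" using that by simp
    finally show False by simp
  qed
  then show ?thesis by (simp add: invertible_left_inverse matrix_left_invertible_ker)
qed

lemma hermitian_pos_def_hadj:
  assumes "hermitian_pos_def G" shows "hadj G = G"
proof -
  have "cnj (G $ j $ i) = G $ i $ j" for i j using assms unfolding hermitian_pos_def_def by metis
  then show ?thesis by (simp add: vec_eq_iff)
qed

lemma Cholesky:
  assumes "hermitian_pos_def (G::complex^'n^'n)"
  obtains X :: "complex^'n^'n" where "G = X ** hadj X" "invertible X"
proof -
  have "\<exists>X::'n \<Rightarrow> 'n \<Rightarrow> complex. \<forall>i\<in>UNIV. \<forall>j\<in>UNIV. G $ i $ j = (\<Sum>k\<in>UNIV. X i k * cnj (X j k))"
  proof (rule Cholesky_aux)
    show "G $ j $ i = cnj (G $ i $ j)" for i j using assms unfolding hermitian_pos_def_def by blast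
    show "0 < (\<Sum>i\<in>UNIV. \<Sum>j\<in>UNIV. G $ i $ j * v i * cnj (v j))" if "\<exists>i\<in>UNIV. v i \<noteq> 0" for v
    proof -
      have "(\<chi> i. v i) \<noteq> 0" using that by (auto simp: vec_eq_iff)
      then have "0 < (\<Sum>i\<in>UNIV. \<Sum>j\<in>UNIV. G $ i $ j * (\<chi> i. v i) $ i * cnj ((\<chi> i. v i) $ j))"
        using assms unfolding hermitian_pos_def_def by blast
      then show ?thesis by simp
    qed
  qed simp
  then obtain X :: "'n \<Rightarrow> 'n \<Rightarrow> complex" where "\<And>i j. G $ i $ j = (\<Sum>k\<in>UNIV. X i k * cnj (X j k))" by blast
  then have G: "G = (\<chi> i k. X i k) ** hadj (\<chi> i k. X i k)"
    by (simp add: vec_eq_iff matrix_matrix_mult_def)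
  have "det G \<noteq> 0" using hermitian_pos_def_invertible[OF assms] invertible_det_nz by blast
  then have "invertible (\<chi> i k. X i k)" using G by (metis det_mul invertible_det_nz mult_zero_left)
  with that G show ?thesis by blast
qed

lemma hermitian_pos_def_inv_factor:
  assumes "hermitian_pos_def (G::complex^'n^'n)"
  obtains Y :: "complex^'n^'n" where "matrix_inv G = hadj Y ** Y" "invertible Y"
proof -
  obtain X :: "complex^'n^'n" where X: "G = X ** hadj X" "invertible X" using Cholesky[OF assms] .
  have "matrix_inv G = hadj (matrix_inv X) ** matrix_inv X"
    unfolding X(1) using X(2) by (simp add: matrix_inv_product matrix_inv_hadj)
  with that invertible_matrix_inv[OF X(2)] show ?thesis by blast
qed

lemma hermitian_pos_def_det:
  assumes "hermitian_pos_def (G::complex^'n^'n)"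
  shows "0 < det G"
proof -
  obtain X :: "complex^'n^'n" where X: "G = X ** hadj X" "invertible X" using Cholesky[OF assms] .
  have "det G = of_real ((norm (det X))\<^sup>2)" by (simp only: X(1) det_mul det_hadj complex_norm_square)
  moreover have "det X \<noteq> 0" using X invertible_det_nz by blast
  ultimately show ?thesis by (simp add: less_complex_def)
qed

lemma trace_mult_hadj: "trace (A ** hadj A) = of_real (\<Sum>i\<in>UNIV. \<Sum>j\<in>UNIV. (norm (A $ i $ j))\<^sup>2)"
  by (simp add: trace_def matrix_matrix_mult_def complex_norm_square del: of_real_power)

lemma trace_mult_hadj_nonneg: "0 \<le> trace (A ** hadj A)"
  unfolding trace_mult_hadj by (simp add: sum_nonneg less_eq_complex_def)

lemma trace_mult_hadj_pos: "invertible (A::complex^'n^'n) \<Longrightarrow> 0 < trace (A ** hadj A)"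
proof -
  assume i: "invertible A"
  have "trace (A ** hadj A) \<noteq> 0"
  proof
    assume "trace (A ** hadj A) = 0"
    then have "(\<Sum>i\<in>UNIV. \<Sum>j\<in>UNIV. (norm (A $ i $ j))\<^sup>2) = 0" unfolding trace_mult_hadj by
        (simp only: of_real_eq_0_iff)
    then have "A = 0" by (simp add: sum_nonneg_eq_0_iff sum_nonneg vec_eq_iff)
    then have "matrix_inv A ** A = 0" by (simp add: vec_eq_iff matrix_matrix_mult_def)
    then have "(mat 1 :: complex^'n^'n) = 0" using matrix_inv_mult(2)[OF i] by simp
    then have "(mat 1 :: complex^'n^'n) $ i $ i = 0" for i by simp
    then show False by (simp add: mat_def)
  qed
  then show ?thesis using trace_mult_hadj_nonneg[of A] by (simp add: less_le)
qed

section \<open>Wirtinger derivatives of matrix functions\<close>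

definition mdiff :: "(complex^'k::finite \<Rightarrow> complex^'n^'m) \<Rightarrow> complex^'k \<Rightarrow> bool" where
  "mdiff F z \<longleftrightarrow> (\<forall>i j. (\<lambda>w. F w $ i $ j) differentiable (at z))"

definition mwirt :: "real \<Rightarrow> 'k::finite \<Rightarrow> (complex^'k \<Rightarrow> complex^'n^'m) \<Rightarrow> complex^'k \<Rightarrow> complex^'n^'m"
    where
  "mwirt s p F z = (\<chi> i j. wirt s p (\<lambda>w. F w $ i $ j) z)"

lemma mwirt_nth [simp]: "mwirt s p F z $ i $ j = wirt s p (\<lambda>w. F w $ i $ j) z" by (simp add: mwirt_def)

lemma mdiffD: "mdiff F z \<Longrightarrow> (\<lambda>w. F w $ i $ j) differentiable (at z)" by (simp add: mdiff_def)

lemma mwirt_cong: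
  assumes "open S" "z \<in> S" "\<And>x. x \<in> S \<Longrightarrow> F x = G x"
  shows "mwirt s p F z = mwirt s p G z"
  unfolding mwirt_def by (intro arg_cong[where f=vec_lambda] ext wirt_cong[OF assms(1,2)])
      (simp add: assms(3))

lemma mdiff_cong:
  assumes "open S" "z \<in> S" "\<And>x. x \<in> S \<Longrightarrow> F x = G x" "mdiff F z"
  shows "mdiff G z"
  unfolding mdiff_def
proof (intro allI)
  fix i j show "(\<lambda>w. G w $ i $ j) differentiable (at z)"
    by (rule differentiable_cong_open[OF assms(1,2) _ mdiffD[OF assms(4), of i j]]) (simp add: assms(3))
qed

lemma differentiable_sum_fun:
  assumes "finite I" "\<And>i. i \<in> I \<Longrightarrow> (u i :: _ \<Rightarrow> complex) differentiable (at z)"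
  shows "(\<lambda>w. \<Sum>i\<in>I. u i w) differentiable (at z)"
  using assms by (induction I rule: finite_induct) auto

lemma mdiff_mult:
  assumes "mdiff F z" "mdiff G z" shows "mdiff (\<lambda>w. F w ** G w) z"
  unfolding mdiff_def matrix_matrix_mult_def
  using assms by (auto intro!: differentiable_sum_fun differentiable_mult simp: mdiff_def)

lemma mwirt_mult:
  assumes "mdiff F z" "mdiff G z" shows "mwirt s p (\<lambda>w. F w ** G w) z = mwirt s p F z ** G z + F z
      ** mwirt s p G z"
  using assms unfolding vec_eq_iff matrix_matrix_mult_def
  by (simp add: wirt_sum wirt_mult mdiff_def sum.distrib)

lemma mdiff_add: "mdiff F z \<Longrightarrow> mdiff G z \<Longrightarrow> mdiff (\<lambda>w. F w + G w) z"
  and mdiff_diff: "mdiff F z \<Longrightarrow> mdiff G z \<Longrightarrow> mdiff (\<lambda>w. F w - G w) z"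
  and mdiff_hadj: "mdiff F z \<Longrightarrow> mdiff (\<lambda>w. hadj (F w)) z"
  by (auto simp: mdiff_def intro: differentiable_cnj)

lemma mwirt_add: "mdiff F z \<Longrightarrow> mdiff G z \<Longrightarrow> mwirt s p (\<lambda>w. F w + G w) z = mwirt s p F z + mwirt s p G z"
  and mwirt_diff: "mdiff F z \<Longrightarrow> mdiff G z \<Longrightarrow> mwirt s p (\<lambda>w. F w - G w) z = mwirt s p F z - mwirt s p G z"
  and mwirt_const: "mwirt s p (\<lambda>w. A) z = 0"
  and mwirt_hadj: "mdiff F z \<Longrightarrow> mwirt s p (\<lambda>w. hadj (F w)) z = hadj (mwirt (-s) p F z)"
  by (auto simp: mdiff_def vec_eq_iff wirt_add wirt_diff wirt_cnj)

lemma differentiable_trace: "mdiff F z \<Longrightarrow> (\<lambda>w. trace (F w)) differentiable (at z)"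
  unfolding trace_def by (intro differentiable_sum_fun) (auto simp: mdiff_def)

lemma wirt_trace: "mdiff F z \<Longrightarrow> wirt s p (\<lambda>w. trace (F w)) z = trace (mwirt s p F z)"
  unfolding trace_def by (subst wirt_sum) (auto simp: mdiff_def)

lemma differentiable_prod_fun:
  assumes "finite I" "\<And>i. i \<in> I \<Longrightarrow> (u i :: _ \<Rightarrow> complex) differentiable (at z)"
  shows "(\<lambda>w. \<Prod>i\<in>I. u i w) differentiable (at z)"
  using assms by (induction I rule: finite_induct) (auto intro: differentiable_mult)

lemma wirt_prod:
  assumes "finite I" "\<And>i. i \<in> I \<Longrightarrow> u i differentiable (at z)"
  shows "wirt s p (\<lambda>w. \<Prod>i\<in>I. u i w) z = (\<Sum>i\<in>I. \<Prod>j\<in>I. if j = i then wirt s p (u j) z else u j z)"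
  using assms
proof (induction I rule: finite_induct)
  case (insert k I)
  have "wirt s p (\<lambda>w. \<Prod>i\<in>insert k I. u i w) z = wirt s p (\<lambda>w. u k w * (\<Prod>i\<in>I. u i w)) z"
    using insert.hyps by simp
  also have "\<dots> = wirt s p (u k) z * (\<Prod>i\<in>I. u i z) + u k z * wirt s p (\<lambda>w. \<Prod>i\<in>I. u i w) z"
    using insert by (intro wirt_mult differentiable_prod_fun) auto
  also have "(\<Prod>i\<in>I. u i z) = (\<Prod>j\<in>I. if j = k then wirt s p (u j) z else u j z)"
    using insert.hyps by (intro prod.cong) auto
  also have "u k z * wirt s p (\<lambda>w. \<Prod>i\<in>I. u i w) z
     = (\<Sum>i\<in>I. \<Prod>j\<in>insert k I. if j = i then wirt s p (u j) z else u j z)"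
    using insert by (simp add: sum_distrib_left) (intro sum.cong refl; auto)
  finally show ?case using insert.hyps by simp
qed simp

lemma differentiable_det:
  fixes F :: "complex^'k::finite \<Rightarrow> complex^'n^'n"
  assumes "mdiff F z" shows "(\<lambda>w. det (F w)) differentiable (at z)"
  unfolding det_def using assms
  by (intro differentiable_sum_fun differentiable_mult differentiable_prod_fun) (auto simp: mdiff_def)

lemma row_mult: "row i (A ** B) = (\<Sum>l\<in>UNIV. row i A $ l *s row l (B::complex^'n^'m))"
  by (simp add: vec_eq_iff row_def matrix_matrix_mult_def sum_component)

text \<open>
  Jacobi's formula. The determinant is differentiated row by row; row \<open>i\<close> of the derivative is a linear
  combination of the rows of \<open>F\<close> with coefficients from row \<open>i\<close> of \<open>\<partial>F F\<^sup>-\<^sup>1\<close>, and only its \<open>i\<close>-th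
  coefficient survives in the determinant.
\<close>

lemma wirt_det:
  fixes F :: "complex^'k::finite \<Rightarrow> complex^'n^'n"
  assumes F: "mdiff F z" and i: "invertible (F z)"
  shows "wirt s p (\<lambda>w. det (F w)) z = det (F z) * trace (matrix_inv (F z) ** mwirt s p F z)"
proof -
  let ?D = "mwirt s p F z"
  let ?P = "{\<pi>. \<pi> permutes (UNIV::'n set)}"
  have 1: "det (\<chi> k. if k = i then row i ?D else row k (F z)) =
      (?D ** matrix_inv (F z)) $ i $ i * det (F z)" for i
  proof -
    define x where "x = row i (?D ** matrix_inv (F z))"
    have "row i ?D = row i ((?D ** matrix_inv (F z)) ** F z)" by (simp add: matrix_inv_mult i)
    also have "\<dots> = (\<Sum>l\<in>UNIV. x $ l *s row l (F z))" unfolding x_def by (rule row_mult)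
    finally have r: "row i ?D = (\<Sum>l\<in>UNIV. x $ l *s row l (F z))" .
    have "x $ i = (?D ** matrix_inv (F z)) $ i $ i" by (simp add: x_def row_def)
    then show ?thesis using cramer_lemma_transpose[of i x "F z"] unfolding r by simp
  qed
  have "wirt s p (\<lambda>w. det (F w)) z = (\<Sum>\<pi>\<in>?P. of_int (sign \<pi>) * wirt s p (\<lambda>w. \<Prod>i\<in>UNIV. F w $ i $ \<pi> i) z)"
    unfolding det_def using F
    by (subst wirt_sum) (auto intro!: differentiable_mult differentiable_prod_fun sum.cong wirt_cmult
        simp: mdiff_def)
  also have "\<dots> = (\<Sum>\<pi>\<in>?P. \<Sum>i\<in>UNIV. of_int (sign \<pi>) * (\<Prod>j\<in>UNIV. if j =
      i then ?D $ j $ \<pi> j else F z $ j $ \<pi> j))"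
    unfolding mwirt_nth using F by (subst wirt_prod) (auto simp: mdiff_def sum_distrib_left)
  also have "\<dots> = (\<Sum>i\<in>UNIV. \<Sum>\<pi>\<in>?P. of_int (sign \<pi>) * (\<Prod>j\<in>UNIV. if j =
      i then ?D $ j $ \<pi> j else F z $ j $ \<pi> j))"
    by (rule sum.swap)
  also have "\<dots> = (\<Sum>i\<in>UNIV. det (\<chi> k. if k = i then row i ?D else row k (F z)))"
    unfolding det_def by (intro sum.cong prod.cong arg_cong2[where f="(*)"] refl) (simp add: row_def)
  also have "\<dots> = det (F z) * trace (?D ** matrix_inv (F z))"
    unfolding 1 trace_def by (simp add: sum_distrib_left mult.commute)
  also have "trace (?D ** matrix_inv (F z)) = trace (matrix_inv (F z) ** ?D)" by (rule trace_mul_sym)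
  finally show ?thesis .
qed

text \<open>
  Cramer's rule writes the entries of the inverse as quotients of determinants, which shows that they
  are differentiable. Their derivative is then more easily found from \<open>F\<^sup>-\<^sup>1 F = 1\<close>.
\<close>

lemma matrix_inv_cramer:
  fixes A :: "complex^'n^'n"
  assumes "invertible A"
  shows "matrix_inv A $ k $ l = det (\<chi> i j. if j = k then axis l 1 $ i else A $ i $ j) / det A"
proof -
  let ?x = "column l (matrix_inv A)"
  have "A *v ?x = axis l 1"
  proof -
    have "(A *v ?x) $ i = (A ** matrix_inv A) $ i $ l" for i
      by (simp add: matrix_vector_mult_def matrix_matrix_mult_def column_def)
    then show ?thesis by (simp add: vec_eq_iff matrix_inv_mult assms mat_def axis_def)
  qed
  moreover have "det A \<noteq> 0" using assms invertible_det_nz by blast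
  ultimately have "?x = (\<chi> k. det (\<chi> i j. if j = k then axis l 1 $ i else A $ i $ j) / det A)"
    using cramer by blast
  then have "?x $ k = det (\<chi> i j. if j = k then axis l 1 $ i else A $ i $ j) / det A" by simp
  then show ?thesis by (simp add: column_def)
qed

lemma mdiff_inv:
  fixes F :: "complex^'k::finite \<Rightarrow> complex^'n^'n"
  assumes S: "open S" "z \<in> S" and F: "mdiff F z" and i: "\<And>w. w \<in> S \<Longrightarrow> invertible (F w)"
  shows "mdiff (\<lambda>w. matrix_inv (F w)) z"
  unfolding mdiff_def
proof (intro allI)
  fix k l
  have "(\<lambda>w. if j = k then axis l 1 $ i else F w $ i $ j) differentiable (at z)" for i j
    using mdiffD[OF F] by (cases "j = k") auto
  then have "mdiff (\<lambda>w. \<chi> i j. if j = k then axis l 1 $ i else F w $ i $ j) z" by (simp add: mdiff_def)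
  then have "(\<lambda>w. det (\<chi> i j. if j = k then axis l 1 $ i else F w $ i $ j) / det (F w)) differentiable
      (at z)"
    using F i[OF S(2)] by (intro differentiable_divide differentiable_det)
        (auto simp: invertible_det_nz)
  then show "(\<lambda>w. matrix_inv (F w) $ k $ l) differentiable (at z)"
    by (rule differentiable_cong_open[OF S, rotated]) (simp add: matrix_inv_cramer i)
qed

lemma mwirt_inv:
  fixes F :: "complex^'k::finite \<Rightarrow> complex^'n^'n"
  assumes S: "open S" "z \<in> S" and F: "mdiff F z" and i: "\<And>w. w \<in> S \<Longrightarrow> invertible (F w)"
  shows "mwirt s p (\<lambda>w. matrix_inv (F w)) z = - (matrix_inv (F z) ** mwirt s p F z ** matrix_inv (F z))"
proof -
  note m = mdiff_inv[OF assms]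
  have "mwirt s p (\<lambda>w. matrix_inv (F w) ** F w) z = mwirt s p (\<lambda>w. mat 1) z"
    by (rule mwirt_cong[OF S]) (simp add: matrix_inv_mult i)
  then have "mwirt s p (\<lambda>w. matrix_inv (F w)) z ** F z + matrix_inv (F z) ** mwirt s p F z = 0"
    by (simp add: mwirt_mult m F mwirt_const)
  then have "(mwirt s p (\<lambda>w. matrix_inv (F w)) z ** F z + matrix_inv (F z) ** mwirt s p F z)
      ** matrix_inv (F z) = 0"
    by (simp add: vec_eq_iff matrix_matrix_mult_def)
  then show ?thesis using i[OF S(2)] by (simp add: matrix_algebra matrix_inv_mult eq_neg_iff_add_eq_0)
qed

section \<open>Curvature matrices and the Laplacian of a trace\<close>

text \<open>
  The entry \<open>(i, j)\<close> is \<open>R\<^sub>i\<^sub>j\<^sub>p\<^sub>q\<close> with \<open>j\<close> and \<open>q\<close> barred. The second derivative is taken in the order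
  that the Laplacian produces; it is the opposite of the one in \<open>curvature\<close>.
\<close>

definition chern_curv :: "(complex^'n \<Rightarrow> complex^'m^'m) \<Rightarrow> 'n::finite \<Rightarrow> 'n \<Rightarrow> complex^'n \<Rightarrow> complex^'m^'m"
    where
  "chern_curv H p q z = mwirt (-1) p H z ** matrix_inv (H z) ** mwirt 1 q H z -
      mwirt (-1) p (mwirt 1 q H) z"

lemma wirt_trace_inv_mult:
  fixes G F :: "complex^'k::finite \<Rightarrow> complex^'n^'n"
  assumes S: "open S" "z \<in> S" and G: "mdiff G z" and F: "mdiff F z"
      and i: "\<And>w. w \<in> S \<Longrightarrow> invertible (G w)"
  shows "wirt s p (\<lambda>w. trace (matrix_inv (G w) ** F w)) z
    = trace (matrix_inv (G z) ** (mwirt s p F z - mwirt s p G z ** matrix_inv (G z) ** F z))"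
  by (simp add: wirt_trace mdiff_mult mdiff_inv[OF S G i] F mwirt_mult mwirt_inv[OF S G i]
      matrix_algebra trace_add trace_sub trace_minus)

text \<open>
  The heart of the computation. In the second derivative of \<open>tr (G\<^sup>-\<^sup>1 F)\<close>, the terms with second
  derivatives of \<open>F\<close> and \<open>G\<close> become curvatures at the cost of one quadratic term each. All quadratic terms
  together factor as a square in \<open>\<partial>F - \<partial>G G\<^sup>-\<^sup>1 F\<close>, the difference of the two Chern connections applied to
  \<open>F\<close>.
\<close>

lemma wirt_wirt_trace_inv_mult:
  fixes G F :: "complex^'k::finite \<Rightarrow> complex^'n^'n"
  assumes S: "open S" "z \<in> S"
    and G: "\<And>w. w \<in> S \<Longrightarrow> mdiff G w" and F: "\<And>w. w \<in> S \<Longrightarrow> mdiff F w"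
    and i: "\<And>w. w \<in> S \<Longrightarrow> invertible (G w)" and iF: "invertible (F z)"
    and G2: "mdiff (mwirt 1 q G) z" and F2: "mdiff (mwirt 1 q F) z"
  shows "wirt (-1) p (wirt 1 q (\<lambda>w. trace (matrix_inv (G w) ** F w))) z
    = - trace (matrix_inv (G z) ** chern_curv F p q z) + trace (matrix_inv (G z) ** chern_curv G p q z
        ** matrix_inv (G z) ** F z)
      + trace (matrix_inv (G z) ** (mwirt (-1) p F z - mwirt (-1) p G z ** matrix_inv (G z) ** F z)
          ** matrix_inv (F z)
               ** (mwirt 1 q F z - F z ** matrix_inv (G z) ** mwirt 1 q G z))"
proof -
  note iG = i[OF S(2)]
  note Gi = mdiff_inv[OF S G[OF S(2)] i] note dGi = mwirt_inv[OF S G[OF S(2)] i]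
  have "wirt (-1) p (wirt 1 q (\<lambda>w. trace (matrix_inv (G w) ** F w))) z =
     wirt (-1) p (\<lambda>w. trace (matrix_inv (G w) ** (mwirt 1 q F w - mwirt 1 q G w ** matrix_inv (G w)
         ** F w))) z"
    by (rule wirt_cong[OF S]) (rule wirt_trace_inv_mult[OF S(1) _ G F i])
  also have "\<dots> = trace (mwirt (-1) p (\<lambda>w. matrix_inv (G w) ** (mwirt 1 q F w - mwirt 1 q G w
      ** matrix_inv (G w) ** F w)) z)"
    by (intro wirt_trace mdiff_mult mdiff_diff Gi G2 F2 F[OF S(2)])
  also have "\<dots> = trace (- (matrix_inv (G z) ** mwirt (-1) p G z ** matrix_inv (G z))
      ** (mwirt 1 q F z - mwirt 1 q G z ** matrix_inv (G z) ** F z)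
     + matrix_inv (G z) ** (mwirt (-1) p (mwirt 1 q F) z -
         ((mwirt (-1) p (mwirt 1 q G) z ** matrix_inv (G z) + mwirt 1 q G z ** -
             (matrix_inv (G z) ** mwirt (-1) p G z ** matrix_inv (G z))) ** F z
           + mwirt 1 q G z ** matrix_inv (G z) ** mwirt (-1) p F z)))"
    by (simp add: mwirt_mult mwirt_diff mdiff_mult mdiff_diff Gi G2 F2 F[OF S(2)] dGi)
  also have "\<dots> = - trace (matrix_inv (G z) ** chern_curv F p q z) +
      trace (matrix_inv (G z) ** chern_curv G p q z ** matrix_inv (G z) ** F z)
      + trace (matrix_inv (G z) ** (mwirt (-1) p F z - mwirt (-1) p G z ** matrix_inv (G z) ** F z)
          ** matrix_inv (F z)
               ** (mwirt 1 q F z - F z ** matrix_inv (G z) ** mwirt 1 q G z))"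
  proof -
    have c1: "trace (matrix_inv (G z) ** mwirt (-1) p F z ** matrix_inv (G z) ** mwirt 1 q G z) =
      trace (matrix_inv (G z) ** mwirt 1 q G z ** matrix_inv (G z) ** mwirt (-1) p F z)"
      using trace_mul_sym[of "matrix_inv (G z) ** mwirt (-1) p F z" "matrix_inv (G z) ** mwirt 1 q G z"]
          by (simp add: matrix_mul_assoc)
    have c2: "trace (matrix_inv (G z) ** mwirt (-1) p G z ** matrix_inv (G z) ** F z ** matrix_inv (G z)
        ** mwirt 1 q G z) =
      trace (matrix_inv (G z) ** mwirt 1 q G z ** matrix_inv (G z) ** mwirt (-1) p G z
          ** matrix_inv (G z) ** F z)"
      using trace_mul_sym[of "matrix_inv (G z) ** mwirt (-1) p G z ** matrix_inv (G z)
          ** F z" "matrix_inv (G z) ** mwirt 1 q G z"] by (simp add: matrix_mul_assoc)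
    show ?thesis
      by (simp add: chern_curv_def matrix_algebra trace_add trace_sub trace_minus matrix_inv_mult[OF iF]
          matrix_inv_mult[OF iG] c1 c2)
  qed
  finally show ?thesis .
qed

definition mhol :: "(complex^'k::finite \<Rightarrow> complex^'n^'m) \<Rightarrow> (complex^'k) set \<Rightarrow> bool" where
  "mhol L S \<longleftrightarrow> (\<forall>i j. hol_on (\<lambda>w. L w $ i $ j) S)"

lemma mholD:
  assumes "mhol L S" "z \<in> S"
  shows "mdiff L z" "mwirt 1 q L z = 0"
proof -
  have h: "hol_on (\<lambda>w. L w $ i $ j) S" for i j using assms(1) by (simp add: mhol_def)
  show "mdiff L z" "mwirt 1 q L z = 0" using hol_onD[OF h assms(2)] by
      (simp_all add: mdiff_def vec_eq_iff)
qed

lemma mhol_mwirt: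
  assumes "open S" "mhol L S" shows "mhol (mwirt (-1) q L) S"
  using assms by (auto simp: mhol_def intro!: hol_on_partial)

lemma hadj_0 [simp]: "hadj 0 = 0" by (simp add: vec_eq_iff)
lemma mult_0_matrix [simp]: "(0::complex^'n^'m) ** (A::complex^'k^'n) = 0" "(B::complex^'n^'m)
    ** (0::complex^'k^'n) = 0"
  by (simp_all add: vec_eq_iff matrix_matrix_mult_def)

lemma mwirt_holomorphic_congruence:
  fixes H :: "complex^'k::finite \<Rightarrow> complex^'n^'n" and L :: "complex^'k \<Rightarrow> complex^'n^'m"
  assumes "mhol L S" "z \<in> S" "mdiff H z"
  shows "mdiff (\<lambda>w. L w ** H w ** hadj (L w)) z"
    "mwirt (-1) p (\<lambda>w. L w ** H w ** hadj (L w)) z = mwirt (-1) p L z ** H z ** hadj (L z) + L z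
        ** mwirt (-1) p H z ** hadj (L z)"
    "mwirt 1 p (\<lambda>w. L w ** H w ** hadj (L w)) z = L z ** mwirt 1 p H z ** hadj (L z) + L z ** H z
        ** hadj (mwirt (-1) p L z)"
  by (simp_all add: mwirt_mult mdiff_mult mdiff_hadj mwirt_hadj mholD[OF assms(1,2)] assms
      matrix_algebra)

text \<open>
  The curvature of a Hermitian form is tensorial under a holomorphic change of frame \<open>L\<close>: since the
  antiholomorphic derivatives of \<open>L\<close> and of \<open>\<partial>L\<close> vanish, the derivatives of \<open>L\<close> enter the quadratic term and
  the second derivative in the same way and cancel.
\<close>

lemma chern_curv_holomorphic_congruence:
  fixes H L :: "complex^'k::finite \<Rightarrow> complex^'n^'n"
  assumes S: "open S" "z \<in> S" and L: "mhol L S" and H: "\<And>w. w \<in> S \<Longrightarrow> mdiff H w"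
    and H2: "mdiff (mwirt 1 q H) z" and i: "invertible (H z)" "invertible (L z)"
  shows "mdiff (mwirt 1 q (\<lambda>w. L w ** H w ** hadj (L w))) z"
    "chern_curv (\<lambda>w. L w ** H w ** hadj (L w)) p q z = L z ** chern_curv H p q z ** hadj (L z)"
proof -
  note L' = mhol_mwirt[OF S(1) L]
  note mL = mholD(1)[OF L S(2)] mholD(1)[OF L' S(2)] note H1 = H[OF S(2)]
  have md: "mdiff (\<lambda>w. L w ** mwirt 1 q H w ** hadj (L w) + L w ** H w ** hadj (mwirt (-1) q L w)) z"
    by (intro mdiff_add mdiff_mult mdiff_hadj mL H1 H2)
  have eq: "mwirt 1 q (\<lambda>w. L w ** H w ** hadj (L w)) w = L w ** mwirt 1 q H w ** hadj (L w) + L w ** H w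
      ** hadj (mwirt (-1) q L w)"
    if "w \<in> S" for w using mwirt_holomorphic_congruence(3)[OF L that H[OF that]] .
  show "mdiff (mwirt 1 q (\<lambda>w. L w ** H w ** hadj (L w))) z"
    by (rule mdiff_cong[OF S _ md]) (simp add: eq)
  have "mwirt (-1) p (mwirt 1 q (\<lambda>w. L w ** H w ** hadj (L w))) z =
     mwirt (-1) p (\<lambda>w. L w ** mwirt 1 q H w ** hadj (L w) + L w ** H w ** hadj (mwirt (-1) q L w)) z"
    by (rule mwirt_cong[OF S]) (rule eq)
  also have "\<dots> = mwirt (-1) p L z ** mwirt 1 q H z ** hadj (L z)
     + L z ** mwirt (-1) p (mwirt 1 q H) z ** hadj (L z) + mwirt (-1) p L z ** H z
         ** hadj (mwirt (-1) q L z) + L z ** mwirt (-1) p H z ** hadj (mwirt (-1) q L z)"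
    by (simp add: mwirt_add mdiff_add mwirt_mult mdiff_mult mdiff_hadj mwirt_hadj mL mholD(2)[OF L S(2)]
        mholD(2)[OF L' S(2)] H1 H2 matrix_algebra)
  finally have 2: "mwirt (-1) p (mwirt 1 q (\<lambda>w. L w ** H w ** hadj (L w))) z = mwirt (-1) p L z
      ** mwirt 1 q H z ** hadj (L z)
     + L z ** mwirt (-1) p (mwirt 1 q H) z ** hadj (L z) + mwirt (-1) p L z ** H z
         ** hadj (mwirt (-1) q L z) + L z ** mwirt (-1) p H z ** hadj (mwirt (-1) q L z)" .
  have inv: "matrix_inv (L z ** H z ** hadj (L z)) = hadj (matrix_inv (L z)) ** matrix_inv (H z)
      ** matrix_inv (L z)"
    using i by (simp add: matrix_inv_product matrix_inv_hadj matrix_mul_assoc)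
  have cancel: "A ** hadj (L z) ** hadj (matrix_inv (L z)) = A" for A :: "complex^'n^'n"
    using matrix_inv_mult(3)[OF matrix_inv_hadj(2)[OF i(2)]] matrix_inv_hadj(1)[OF i(2)] by metis
  show "chern_curv (\<lambda>w. L w ** H w ** hadj (L w)) p q z = L z ** chern_curv H p q z ** hadj (L z)"
    unfolding chern_curv_def 2 inv
    by (simp add: mwirt_holomorphic_congruence[OF L S(2) H1] matrix_algebra cancel
        matrix_inv_mult[OF i(1)] matrix_inv_mult[OF i(2)])
qed

definition mscale :: "complex \<Rightarrow> complex^'n^'m \<Rightarrow> complex^'n^'m" where
  "mscale k A = (\<chi> i j. k * A $ i $ j)"

lemma mscale_nth [simp]: "mscale k A $ i $ j = k * A $ i $ j" by (simp add: mscale_def)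

lemma mscale_algebra: "mscale k A ** (B::complex^'n^'l) = mscale k (A ** B)" "(C::complex^'l^'m)
    ** mscale k D = mscale k (C ** D)"
  "mscale k (mscale l A) = mscale (k * l) A" "mscale k (A - A') = mscale k A -
      mscale k A'" "mscale k (A + A') = mscale k A + mscale k A'"
  "mscale k (sum f I) = (\<Sum>i\<in>I. mscale k (f i))"
  by (simp_all add: vec_eq_iff matrix_matrix_mult_def sum_distrib_left sum_component algebra_simps)

lemma trace_mscale: "trace (mscale k A) = k * trace A" by (simp add: trace_def sum_distrib_left)

definition mdiff2 :: "(complex^'k::finite \<Rightarrow> complex^'n^'m) \<Rightarrow> (complex^'k) set \<Rightarrow> bool" where
  "mdiff2 F S \<longleftrightarrow> (\<forall>i j. wirt2 (\<lambda>w. F w $ i $ j) S)"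

lemma mdiff2D:
  assumes "mdiff2 F S" "z \<in> S" shows "mdiff F z" "mdiff (mwirt s q F) z"
  using assms by (auto simp: mdiff2_def mdiff_def wirt2_def)

lemma mwirt_compose:
  fixes g :: "complex^'k::finite \<Rightarrow> complex^'n^'m" and \<phi> :: "complex^'l::finite \<Rightarrow> complex^'k"
  assumes "holomorphic_map_on \<phi> W" "w \<in> W" "mdiff g (\<phi> w)"
  shows "mdiff (\<lambda>w. g (\<phi> w)) w"
    "mwirt (-1) p (\<lambda>w. g (\<phi> w)) w = (\<Sum>a\<in>UNIV. mscale (cjac \<phi> w $ a $ p) (mwirt (-1) a g (\<phi> w)))"
    "mwirt 1 p (\<lambda>w. g (\<phi> w)) w = (\<Sum>a\<in>UNIV. mscale (cnj (cjac \<phi> w $ a $ p)) (mwirt 1 a g (\<phi> w)))"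
  using wirt_compose[OF holomorphic_map_on_component(3)[OF assms(1,2)] mdiffD[OF assms(3)]]
  by (simp_all add: mdiff_def vec_eq_iff sum_component mult.commute)

lemma hol_on_cjac:
  assumes "holomorphic_map_on \<phi> W" shows "hol_on (\<lambda>w. cjac \<phi> w $ a $ p) W"
proof -
  have "(\<lambda>w. cjac \<phi> w $ a $ p) = wirt (-1) p (\<lambda>w. \<phi> w $ a)" by
      (simp add: cjac_def dz_eq_wirt fun_eq_iff)
  then show ?thesis using hol_on_partial[OF holomorphic_map_on_component(1,2)[OF assms]] by simp
qed

text \<open>
  The Jacobian entries of a holomorphic \<open>\<phi>\<close> produced by the first derivative are antiholomorphic, so the
  second one does not see them.
\<close>

lemma chern_curv_compose:
  fixes g :: "complex^'k::finite \<Rightarrow> complex^'n^'n" and \<phi> :: "complex^'l::finite \<Rightarrow> complex^'k"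
  assumes \<phi>: "holomorphic_map_on \<phi> W" and w: "w \<in> W" and sub: "\<And>w. w \<in> W \<Longrightarrow> \<phi> w \<in> Z" and g: "mdiff2 g Z"
  shows "mdiff (mwirt 1 q (\<lambda>w. g (\<phi> w))) w"
    "chern_curv (\<lambda>w. g (\<phi> w)) p q w =
        (\<Sum>a\<in>UNIV. \<Sum>b\<in>UNIV. mscale (cjac \<phi> w $ a $ p * cnj (cjac \<phi> w $ b $ q)) (chern_curv g a b (\<phi> w)))"
proof -
  let ?K = "cjac \<phi>"
  have W: "open W" using \<phi> by (simp add: holomorphic_map_on_def)
  note Z = sub[OF w]
  note K = hol_onD[OF hol_on_cjac[OF \<phi>] w]
  note D\<phi> = holomorphic_map_on_component(3)[OF \<phi> w]
  have eq: "wirt 1 q (\<lambda>w. g (\<phi> w) $ i $ j) w' =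
      (\<Sum>b\<in>UNIV. wirt 1 b (\<lambda>w. g w $ i $ j) (\<phi> w') * cnj (?K w' $ b $ q))"
    if "w' \<in> W" for w' i j
    using wirt_compose(3)[OF holomorphic_map_on_component(3)[OF \<phi> that], of "\<lambda>w. g w $ i $ j"] g
        sub[OF that] by (simp add: mdiff2_def wirt2_def)
  have d: "(\<lambda>w. wirt 1 b (\<lambda>w. g w $ i $ j) (\<phi> w)) differentiable (at w)" for b i j
    using wirt_compose(1)[OF D\<phi>, of "wirt 1 b (\<lambda>w. g w $ i $ j)"] g Z by
        (simp add: mdiff2_def wirt2_def)
  have d2: "(\<lambda>w'. \<Sum>b\<in>UNIV. wirt 1 b (\<lambda>w. g w $ i $ j) (\<phi> w') * cnj (?K w' $ b $ q)) differentiable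
      (at w)" for i j
    by (intro differentiable_sum_fun differentiable_mult d differentiable_cnj K) simp
  have "wirt 1 q (\<lambda>w. g (\<phi> w) $ i $ j) differentiable (at w)" for i j
    by (rule differentiable_cong_open[OF W w _ d2]) (simp add: eq)
  then show "mdiff (mwirt 1 q (\<lambda>w. g (\<phi> w))) w" by (simp add: mdiff_def)
  have "wirt (-1) p (wirt 1 q (\<lambda>w. g (\<phi> w) $ i $ j)) w =
    (\<Sum>b\<in>UNIV. \<Sum>a\<in>UNIV. ?K w $ a $ p * cnj (?K w $ b $ q) * wirt (-1) a (wirt 1 b (\<lambda>w. g w $ i $ j))
        (\<phi> w))" for i j
  proof -
    have "wirt (-1) p (wirt 1 q (\<lambda>w. g (\<phi> w) $ i $ j)) w =
        wirt (-1) p (\<lambda>w'. \<Sum>b\<in>UNIV. wirt 1 b (\<lambda>w. g w $ i $ j) (\<phi> w') * cnj (?K w' $ b $ q)) w"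
      by (rule wirt_cong[OF W w]) (rule eq)
    also have "\<dots> = (\<Sum>b\<in>UNIV. wirt (-1) p (\<lambda>w'. wirt 1 b (\<lambda>w. g w $ i $ j) (\<phi> w')) w * cnj
        (?K w $ b $ q))"
      by (simp add: wirt_sum differentiable_mult d differentiable_cnj K wirt_mult wirt_cnj)
    also have "\<dots> = (\<Sum>b\<in>UNIV. (\<Sum>a\<in>UNIV. wirt (-1) a (wirt 1 b (\<lambda>w. g w $ i $ j)) (\<phi> w) * ?K w $ a $ p) *
        cnj (?K w $ b $ q))"
      using wirt_compose(2)[OF D\<phi>, of "wirt 1 b (\<lambda>w. g w $ i $ j)" for b] g Z by
          (simp add: mdiff2_def wirt2_def)
    finally show ?thesis by (simp add: sum_distrib_left sum_distrib_right mult_ac)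
  qed
  then have 2: "mwirt (-1) p (mwirt 1 q (\<lambda>w. g (\<phi> w))) w =
      (\<Sum>b\<in>UNIV. \<Sum>a\<in>UNIV. mscale (?K w $ a $ p * cnj (?K w $ b $ q)) (mwirt (-1) a (mwirt 1 b g) (\<phi> w)))"
    by (simp add: vec_eq_iff sum_component)
  show "chern_curv (\<lambda>w. g (\<phi> w)) p q w =
      (\<Sum>a\<in>UNIV. \<Sum>b\<in>UNIV. mscale (cjac \<phi> w $ a $ p * cnj (cjac \<phi> w $ b $ q)) (chern_curv g a b (\<phi> w)))"
    unfolding chern_curv_def 2 mwirt_compose[OF \<phi> w mdiff2D(1)[OF g Z]]
    by (subst (2) sum.swap)
        (simp add: matrix_sum_left matrix_sum_right mscale_algebra sum_subtractf mult.commute)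
qed

section \<open>Logarithms and the Ricci form\<close>

lemma wirt_Ln:
  assumes u: "u differentiable (at z)" and nz: "u z \<notin> \<real>\<^sub>\<le>\<^sub>0"
  shows "(\<lambda>w. Ln (u w)) differentiable (at z)" "wirt s p (\<lambda>w. Ln (u w)) z = wirt s p u z / u z"
proof -
  have "(Ln has_derivative (*) (inverse (u z))) (at (u z))"
    using has_field_derivative_Ln[OF nz] by (simp add: has_field_derivative_def)
  from has_derivative_compose[OF frechet_derivative_works[THEN iffD1, OF u] this]
  have D: "((\<lambda>w. Ln (u w)) has_derivative (\<lambda>v. inverse (u z) * frechet_derivative u (at z) v)) (at z)" .
  then show "(\<lambda>w. Ln (u w)) differentiable (at z)" unfolding differentiable_def by blast
  show "wirt s p (\<lambda>w. Ln (u w)) z = wirt s p u z / u z"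
    unfolding wirt_def frechet_derivative_at[OF D, symmetric] using nz by (cases "u z = 0")
        (simp_all add: field_simps)
qed

lemma wirt_wirt_Ln:
  assumes S: "open S" "z \<in> S" and u: "\<And>w. w \<in> S \<Longrightarrow> u differentiable (at w)" "\<And>w. w \<in> S \<Longrightarrow> u w \<notin> \<real>\<^sub>\<le>\<^sub>0"
    and u2: "wirt t q u differentiable (at z)"
  shows "wirt s p (wirt t q (\<lambda>w. Ln (u w))) z = wirt s p (wirt t q u) z / u z -
      wirt s p u z * wirt t q u z / (u z)\<^sup>2"
proof -
  have nz: "u w \<noteq> 0" if "w \<in> S" for w using u(2)[OF that] by auto
  define v where "v w = wirt t q u w / u w" for w
  have dv: "v differentiable (at z)" unfolding v_def by (intro differentiable_divide u2 u S nz)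
  have "wirt s p (\<lambda>w. v w * u w) z = wirt s p (wirt t q u) z"
    by (rule wirt_cong[OF S]) (simp add: v_def nz)
  then have "wirt s p v z * u z + v z * wirt s p u z = wirt s p (wirt t q u) z"
    using wirt_mult[OF dv u(1)[OF S(2)]] by simp
  then have "wirt s p v z = wirt s p (wirt t q u) z / u z - wirt s p u z * wirt t q u z / (u z)\<^sup>2"
    using nz[OF S(2)] by (simp add: v_def field_simps power2_eq_square)
  moreover have "wirt s p (wirt t q (\<lambda>w. Ln (u w))) z = wirt s p v z"
    by (rule wirt_cong[OF S]) (simp add: v_def wirt_Ln u)
  ultimately show ?thesis by simp
qed

lemma pos_not_nonpos_Reals: "0 < (x::complex) \<Longrightarrow> x \<notin> \<real>\<^sub>\<le>\<^sub>0"
  by (auto simp: less_complex_def complex_nonpos_Reals_iff)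

text \<open>
  Minus the Ricci form is \<open>\<partial>\<partial>bar log det H\<close>: Jacobi's formula turns the first derivative into
  \<open>tr (H\<^sup>-\<^sup>1 \<partial>bar H)\<close>. Positive definiteness keeps the determinant off the branch cut of \<open>Ln\<close>.
\<close>

lemma wirt_wirt_Ln_det:
  fixes H :: "complex^'k::finite \<Rightarrow> complex^'n^'n"
  assumes S: "open S" "z \<in> S" and H: "\<And>w. w \<in> S \<Longrightarrow> mdiff H w"
      and pos: "\<And>w. w \<in> S \<Longrightarrow> hermitian_pos_def (H w)"
    and H2: "mdiff (mwirt 1 q H) z"
  shows "wirt (-1) p (wirt 1 q (\<lambda>w. Ln (det (H w)))) z =
      - trace (matrix_inv (H z) ** chern_curv H p q z)"
proof -
  have i: "invertible (H w)" if "w \<in> S" for w using hermitian_pos_def_invertible[OF pos[OF that]] .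
  have "wirt 1 q (\<lambda>w. Ln (det (H w))) w = trace (matrix_inv (H w) ** mwirt 1 q H w)" if w: "w \<in> S" for w
  proof -
    have "det (H w) \<noteq> 0" using i[OF w] invertible_det_nz by blast
    then show ?thesis
      using wirt_Ln(2)[OF differentiable_det[OF H[OF w]]
          pos_not_nonpos_Reals[OF hermitian_pos_def_det[OF pos[OF w]]]]
      by (simp add: wirt_det[OF H[OF w] i[OF w]])
  qed
  then have "wirt (-1) p (wirt 1 q (\<lambda>w. Ln (det (H w)))) z =
      wirt (-1) p (\<lambda>w. trace (matrix_inv (H w) ** mwirt 1 q H w)) z"
    by (rule wirt_cong[OF S])
  also have "\<dots> = - trace (matrix_inv (H z) ** chern_curv H p q z)"
    by (simp add: wirt_trace_inv_mult[OF S H[OF S(2)] H2 i] chern_curv_def matrix_algebra trace_sub)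
  finally show ?thesis .
qed

lemma fundamental_form_axis:
  "fundamental_form G (axis a \<alpha>) (axis b \<beta>) = \<i> * (\<alpha> * cnj \<beta> * G $ a $ b - \<beta> * cnj \<alpha> * G $ b $ a)"
proof -
  have "(\<Sum>i\<in>UNIV. \<Sum>j\<in>UNIV. G $ i $ j * (axis a x $ i * cnj (axis b y $ j))) = x * cnj y * G $ a $ b"
      for a b x y
  proof -
    have "(\<Sum>i\<in>UNIV. \<Sum>j\<in>UNIV. G $ i $ j * (axis a x $ i * cnj (axis b y $ j)))
      = (\<Sum>i\<in>UNIV. \<Sum>j\<in>UNIV. if j = b then (if i = a then x * cnj y * G $ a $ b else 0) else 0)"
      by (intro sum.cong refl) (auto simp: axis_def)
    then show ?thesis by simp
  qed
  note * = this
  have "(\<Sum>i\<in>UNIV. \<Sum>j\<in>UNIV. G $ i $ j * (axis a \<alpha> $ i * cnj (axis b \<beta> $ j) -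
      axis b \<beta> $ i * cnj (axis a \<alpha> $ j)))
     = \<alpha> * cnj \<beta> * G $ a $ b - \<beta> * cnj \<alpha> * G $ b $ a"
    unfolding right_diff_distrib sum_subtractf * by simp
  then show ?thesis by (simp add: fundamental_form_def)
qed

lemma frechet_derivative_axis:
  assumes "u differentiable (at z)"
  shows "frechet_derivative u (at z) (axis k \<alpha>) = \<alpha> * wirt (-1) k u z + cnj \<alpha> * wirt 1 k u z"
  unfolding frechet_derivative_wirt[OF assms]
  by (subst sum.mono_neutral_right[of UNIV "{k}"]) (auto simp: axis_def)

text \<open>
  Evaluate \<open>d\<omega>\<close> on \<open>\<alpha> e\<^sub>k\<close>, \<open>\<beta> e\<^sub>i\<close>, \<open>e\<^sub>j\<close>. The result is real multilinear in \<open>\<alpha>\<close> and \<open>\<beta>\<close>, and the coefficient of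
  \<open>\<alpha> \<beta>\<close> is, up to \<open>\<i>\<close>, the difference of the two sides. Letting \<open>\<alpha>\<close> and \<open>\<beta>\<close> run through \<open>1\<close> and \<open>\<i>\<close>
  isolates this coefficient.
\<close>

lemma kaehler_symmetric:
  fixes h :: "complex^'n::finite \<Rightarrow> complex^'n^'n"
  assumes cl: "closed_form_on h S" and z: "z \<in> S" and h: "mdiff h z"
  shows "wirt (-1) k (\<lambda>w. h w $ i $ j) z = wirt (-1) i (\<lambda>w. h w $ k $ j) z"
proof -
  let ?D = "\<lambda>a b k \<alpha>. \<alpha> * wirt (-1) k (\<lambda>w. h w $ a $ b) z + cnj \<alpha> * wirt 1 k (\<lambda>w. h w $ a $ b) z"
  have D: "frechet_derivative (\<lambda>x. fundamental_form (h x) (axis a \<alpha>) (axis b \<beta>)) (at z) (axis k \<gamma>)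
    = \<i> * (\<alpha> * cnj \<beta> * ?D a b k \<gamma> - \<beta> * cnj \<alpha> * ?D b a k \<gamma>)" for a b k \<alpha> \<beta> \<gamma>
  proof -
    have "((\<lambda>x. \<i> * (\<alpha> * cnj \<beta> * h x $ a $ b - \<beta> * cnj \<alpha> * h x $ b $ a)) has_derivative
      (\<lambda>v. \<i> * (\<alpha> * cnj \<beta> * frechet_derivative (\<lambda>w. h w $ a $ b) (at z) v -
          \<beta> * cnj \<alpha> * frechet_derivative (\<lambda>w. h w $ b $ a) (at z) v))) (at z)"
      using mdiffD[OF h] frechet_derivative_works by (intro has_derivative_mult_right
          has_derivative_diff) blast+
    from frechet_derivative_at[OF this, symmetric] show ?thesis
      by (simp add: fundamental_form_axis frechet_derivative_axis[OF mdiffD[OF h]])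
  qed
  define E where "E \<alpha> \<beta> = \<beta> * ?D i j k \<alpha> - cnj \<beta> * ?D j i k \<alpha> + (cnj \<alpha> * ?D j k i \<beta> - \<alpha> * ?D k j i \<beta>)
      + (\<alpha> * cnj \<beta> * ?D k i j 1 - \<beta> * cnj \<alpha> * ?D i k j 1)" for \<alpha> \<beta>
  have E: "E \<alpha> \<beta> = 0" for \<alpha> \<beta>
  proof -
    have "\<i> * E \<alpha> \<beta> = 0"
      using cl[unfolded closed_form_on_def, rule_format, OF z, of "axis i \<beta>" "axis j 1" "axis k \<alpha>"]
      unfolding D E_def by (simp add: algebra_simps)
    then show ?thesis by simp
  qed
  have "4 * (wirt (-1) k (\<lambda>w. h w $ i $ j) z - wirt (-1) i (\<lambda>w. h w $ k $ j) z) = E 1 1 - \<i> * E \<i> 1 -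
      \<i> * E 1 \<i> - E \<i> \<i>"
    by (simp add: E_def algebra_simps)
  then show ?thesis by (simp add: E)
qed

lemma kaehler_symmetric_bar:
  fixes h :: "complex^'n::finite \<Rightarrow> complex^'n^'n"
  assumes cl: "closed_form_on h S" and S: "open S" and z: "z \<in> S" and h: "mdiff h z"
      and her: "\<And>w. w \<in> S \<Longrightarrow> hadj (h w) = h w"
  shows "wirt 1 k (\<lambda>w. h w $ i $ j) z = wirt 1 j (\<lambda>w. h w $ i $ k) z"
proof -
  have "mwirt 1 a h z = hadj (mwirt (-1) a h z)" for a
  proof -
    have "mwirt 1 a (\<lambda>w. hadj (h w)) z = mwirt 1 a h z" by (rule mwirt_cong[OF S z her])
    then show ?thesis by (simp add: mwirt_hadj[OF h])
  qed
  then have "mwirt 1 a h z $ i $ b = cnj (mwirt (-1) a h z $ b $ i)" for a b by simp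
  then show ?thesis using kaehler_symmetric[OF cl z h, of k j i] by simp
qed

text \<open>
  The two Kaehler symmetries exchange \<open>a\<close> with \<open>i\<close> and, after the derivatives have been commuted, \<open>b\<close>
  with \<open>j\<close>.
\<close>

lemma chern_curv_kaehler_symmetric:
  fixes h :: "complex^'n::finite \<Rightarrow> complex^'n^'n"
  assumes cl: "closed_form_on h S" and S: "open S" and z: "z \<in> S" and h: "mdiff2 h S"
      and her: "\<And>w. w \<in> S \<Longrightarrow> hadj (h w) = h w"
  shows "chern_curv h a b z $ i $ j = chern_curv h i j z $ a $ b"
proof -
  note md = mdiff2D(1)[OF h]
  note k1 = kaehler_symmetric[OF cl _ md] and k2 = kaehler_symmetric_bar[OF cl S _ md her]
  have com: "wirt (-1) p (wirt 1 q (\<lambda>w. h w $ i $ j)) z = wirt 1 q (wirt (-1) p (\<lambda>w. h w $ i $ j)) z"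
      for p q i j
    using h z by (simp add: mdiff2_def wirt2_def)
  have "wirt (-1) a (wirt 1 b (\<lambda>w. h w $ i $ j)) z = wirt (-1) a (wirt 1 j (\<lambda>w. h w $ i $ b)) z"
    by (rule wirt_cong[OF S z]) (rule k2; assumption)
  also have "\<dots> = wirt 1 j (wirt (-1) a (\<lambda>w. h w $ i $ b)) z" by (rule com)
  also have "\<dots> = wirt 1 j (wirt (-1) i (\<lambda>w. h w $ a $ b)) z"
    by (rule wirt_cong[OF S z]) (rule k1; assumption)
  also have "\<dots> = wirt (-1) i (wirt 1 j (\<lambda>w. h w $ a $ b)) z" by (rule com[symmetric])
  finally have 1: "wirt (-1) a (wirt 1 b (\<lambda>w. h w $ i $ j)) z =
      wirt (-1) i (wirt 1 j (\<lambda>w. h w $ a $ b)) z" .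
  have 2: "wirt (-1) a (\<lambda>w. h w $ i $ s) z = wirt (-1) i (\<lambda>w. h w $ a $ s) z" for s
    by (rule k1) (use z in auto)
  have 3: "wirt 1 b (\<lambda>w. h w $ t $ j) z = wirt 1 j (\<lambda>w. h w $ t $ b) z" for t
    by (rule k2) (use z in auto)
  show ?thesis unfolding chern_curv_def by (simp add: matrix_matrix_mult_def 1 2 3)
qed

text \<open>
  \<open>wirt_wirt_Ln_det\<close> contracts the frame indices of the curvature, whereas the Laplacian contracts its
  form indices; for a Kaehler metric both contractions agree.
\<close>

lemma ricci_contraction:
  fixes h :: "complex^'n::finite \<Rightarrow> complex^'n^'n"
  assumes cl: "closed_form_on h S" and S: "open S" and z: "z \<in> S" and h: "mdiff2 h S"
      and pos: "\<And>w. w \<in> S \<Longrightarrow> hermitian_pos_def (h w)"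
  shows "(\<Sum>p\<in>UNIV. \<Sum>q\<in>UNIV. mscale (dual_metric (h z) $ p $ q) (chern_curv h p q z))
     = (\<chi> i j. - wirt (-1) i (wirt 1 j (\<lambda>w. Ln (det (h w)))) z)"
proof -
  have "- wirt (-1) i (wirt 1 j (\<lambda>w. Ln (det (h w)))) z =
      (\<Sum>p\<in>UNIV. \<Sum>q\<in>UNIV. dual_metric (h z) $ p $ q * chern_curv h p q z $ i $ j)" for i j
  proof -
    have "- wirt (-1) i (wirt 1 j (\<lambda>w. Ln (det (h w)))) z =
        trace (matrix_inv (h z) ** chern_curv h i j z)"
      by (subst wirt_wirt_Ln_det[OF S z mdiff2D(1)[OF h] pos mdiff2D(2)[OF h z]]) auto
    also have "\<dots> = (\<Sum>q\<in>UNIV. \<Sum>p\<in>UNIV. dual_metric (h z) $ p $ q * chern_curv h i j z $ p $ q)"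
      by (simp add: trace_def matrix_matrix_mult_def dual_metric_def transpose_def)
    also have "\<dots> = (\<Sum>q\<in>UNIV. \<Sum>p\<in>UNIV. dual_metric (h z) $ p $ q * chern_curv h p q z $ i $ j)"
      using chern_curv_kaehler_symmetric[OF cl S z h hermitian_pos_def_hadj[OF pos]] by simp
    also have "\<dots> = (\<Sum>p\<in>UNIV. \<Sum>q\<in>UNIV. dual_metric (h z) $ p $ q * chern_curv h p q z $ i $ j)"
        by (rule sum.swap)
    finally show ?thesis .
  qed
  then show ?thesis by (simp add: vec_eq_iff sum_component)
qed

section \<open>The Cauchy-Schwarz inequality for the error term\<close>

text \<open>
  Factor the three matrices as \<open>h = X X\<^sup>*\<close>, \<open>h\<^sup>-\<^sup>1 = Y\<^sup>* Y\<close> and \<open>g\<^sup>-\<^sup>1 = Z\<^sup>* Z\<close>. With \<open>V\<^sub>k\<close> the combination of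
  the \<open>U\<^sub>p\<close> by row \<open>k\<close> of \<open>Y\<close>, the contraction is the sum of the squared Hilbert-Schmidt norms of \<open>Z V\<^sub>k X\<close>.
\<close>

lemma contraction_nonneg:
  fixes U :: "'n::finite \<Rightarrow> complex^'n^'n"
  assumes h: "hermitian_pos_def h" and g: "hermitian_pos_def g"
  shows "0 \<le> (\<Sum>p\<in>UNIV. \<Sum>q\<in>UNIV. dual_metric h $ p $ q * trace (U p ** h ** hadj (U q) ** matrix_inv g))"
proof -
  obtain X :: "complex^'n^'n" where X: "h = X ** hadj X" by (rule Cholesky[OF h]) blast
  obtain Y :: "complex^'n^'n" where Y: "matrix_inv h = hadj Y ** Y"
      by (rule hermitian_pos_def_inv_factor[OF h]) blast
  obtain Z :: "complex^'n^'n" where Z: "matrix_inv g = hadj Z ** Z"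
      by (rule hermitian_pos_def_inv_factor[OF g]) blast
  define V where "V k = (\<Sum>p\<in>UNIV. mscale (Y $ k $ p) (U p))" for k
  have hV: "hadj (V k) = (\<Sum>q\<in>UNIV. mscale (cnj (Y $ k $ q)) (hadj (U q)))" for k
    by (simp add: V_def vec_eq_iff sum_component)
  have "dual_metric h $ p $ q = (\<Sum>k\<in>UNIV. Y $ k $ p * cnj (Y $ k $ q))" for p q
    by (simp add: dual_metric_def transpose_def Y matrix_matrix_mult_def mult.commute)
  then have "(\<Sum>p\<in>UNIV. \<Sum>q\<in>UNIV. dual_metric h $ p $ q * trace (U p ** h ** hadj (U q) ** matrix_inv g))
      =
     (\<Sum>p\<in>UNIV. \<Sum>q\<in>UNIV. \<Sum>k\<in>UNIV. Y $ k $ p * cnj (Y $ k $ q) * trace (U p ** h ** hadj (U q)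
         ** matrix_inv g))"
    by (simp add: sum_distrib_right)
  also have "\<dots> = (\<Sum>k\<in>UNIV. \<Sum>p\<in>UNIV. \<Sum>q\<in>UNIV. Y $ k $ p * cnj (Y $ k $ q) * trace (U p ** h ** hadj (U q)
      ** matrix_inv g))"
    by (subst sum.swap) (rule sum.cong[OF refl], subst sum.swap, rule refl)
  also have "\<dots> = (\<Sum>k\<in>UNIV. trace (V k ** h ** hadj (V k) ** matrix_inv g))"
    unfolding hV unfolding V_def
    by (simp add: matrix_sum_left matrix_sum_right mscale_algebra trace_sum trace_mscale
        sum_distrib_left mult_ac)
      (rule sum.cong[OF refl], rule sum.swap)
  also have "\<dots> = (\<Sum>k\<in>UNIV. trace ((Z ** V k ** X) ** hadj (Z ** V k ** X)))"
  proof (intro sum.cong refl)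
    fix k
    show "trace (V k ** h ** hadj (V k) ** matrix_inv g) =
        trace ((Z ** V k ** X) ** hadj (Z ** V k ** X))"
      using trace_mul_sym[of "V k ** h ** hadj (V k) ** hadj Z" Z]
      by (simp add: X Z hadj_mult matrix_mul_assoc)
  qed
  also have "\<dots> \<ge> 0" by (intro sum_nonneg trace_mult_hadj_nonneg)
  finally show ?thesis .
qed

text \<open>
  Apply \<open>contraction_nonneg\<close> to \<open>T\<^sub>p - (d\<^sub>p / E) L\<close>, the part of \<open>T\<^sub>p\<close> orthogonal to \<open>L\<close>.
\<close>

lemma contraction_Cauchy_Schwarz:
  fixes T :: "'n::finite \<Rightarrow> complex^'n^'n"
  assumes h: "hermitian_pos_def h" and g: "hermitian_pos_def g"
      and E: "E = trace (L ** h ** hadj L ** matrix_inv g)" "0 < E"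
   and d: "\<And>p. d p = trace (T p ** h ** hadj L ** matrix_inv g)"
  shows "(\<Sum>p\<in>UNIV. \<Sum>q\<in>UNIV. dual_metric h $ p $ q * (d p * cnj (d q) / E))
     \<le> (\<Sum>p\<in>UNIV. \<Sum>q\<in>UNIV. dual_metric h $ p $ q * trace (T p ** h ** hadj (T q) ** matrix_inv g))"
proof -
  define a where "a p = d p / E" for p
  have nz: "E \<noteq> 0" using E by auto
  have cE: "cnj E = E" using E(2) by (simp add: less_complex_def complex_eq_iff)
  have hi: "hadj (matrix_inv g) = matrix_inv g"
    using matrix_inv_hadj(1)[OF hermitian_pos_def_invertible[OF g]] hermitian_pos_def_hadj[OF g] by simp
  have dc: "trace (L ** h ** hadj (T q) ** matrix_inv g) = cnj (d q)" for q
    using trace_mul_sym[of "matrix_inv g" "L ** h ** hadj (T q)"]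
    by (simp add: d hadj_mult hi hermitian_pos_def_hadj[OF h] matrix_mul_assoc flip: trace_hadj)
  have hc: "hadj (mscale k A) = mscale (cnj k) (hadj A)" for k and A :: "complex^'n^'n" by
      (simp add: vec_eq_iff)
  have "trace ((T p - mscale (a p) L) ** h ** hadj (T q - mscale (a q) L) ** matrix_inv g) =
     trace (T p ** h ** hadj (T q) ** matrix_inv g) - d p * cnj (d q) / E" for p q
    using nz by (simp add: hadj_diff hc matrix_diff_ldistrib matrix_diff_rdistrib mscale_algebra
        trace_sub trace_mscale dc flip: d E)
      (simp add: a_def cE field_simps)
  with contraction_nonneg[OF h g, of "\<lambda>p. T p - mscale (a p) L"] show ?thesis
    by (simp add: right_diff_distrib sum_subtractf)
qed

section \<open>The identity in one coordinate chart\<close>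

lemma trace_pull_pos:
  assumes h: "hermitian_pos_def h" and g: "hermitian_pos_def g"
      and L: "invertible (L::complex^'n::finite^'n)"
  shows "0 < trace (matrix_inv g ** (L ** h ** hadj L))"
proof -
  obtain X :: "complex^'n^'n" where X: "h = X ** hadj X" "invertible X" by (rule Cholesky[OF h]) blast
  obtain Z :: "complex^'n^'n" where Z: "matrix_inv g = hadj Z ** Z" "invertible Z"
      by (rule hermitian_pos_def_inv_factor[OF g]) blast
  have "trace (matrix_inv g ** (L ** h ** hadj L)) = trace ((Z ** L ** X) ** hadj (Z ** L ** X))"
    using trace_mul_sym[of "hadj Z" "Z ** L ** h ** hadj L"]
    by (simp add: X(1) Z(1) hadj_mult matrix_mul_assoc)
  also have "0 < \<dots>" using L X(2) Z(2) by (intro trace_mult_hadj_pos matrix_inv_product(2))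
  finally show ?thesis .
qed

lemma matrix_inv_congruence:
  assumes "invertible (H::complex^'n::finite^'n)" "invertible (L::complex^'n^'n)"
  shows "matrix_inv (L ** H ** hadj L) = hadj (matrix_inv L) ** matrix_inv H
      ** matrix_inv L" "invertible (L ** H ** hadj L)"
  using assms by (simp_all add: matrix_inv_product matrix_inv_hadj matrix_mul_assoc)

lemma hadj_cancel:
  assumes "invertible (L::complex^'n::finite^'n)"
  shows "A ** hadj L ** hadj (matrix_inv L) = (A::complex^'n^'m)" "A ** hadj (matrix_inv L) ** hadj L =
      A"
  using matrix_inv_mult(3,4)[OF matrix_inv_hadj(2)[OF assms], of A] by
      (simp_all add: matrix_inv_hadj(1)[OF assms])

definition energy_of :: "(complex^'k \<Rightarrow> complex^'n^'n) \<Rightarrow> (complex^'k \<Rightarrow> complex^'n^'n) \<Rightarrow>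
    (complex^'k \<Rightarrow> complex^'n^'n) \<Rightarrow> complex^'k \<Rightarrow> complex" where
  "energy_of G h L w = trace (matrix_inv (G w) ** (L w ** h w ** hadj (L w)))"

text \<open>
  The matrix of \<open>\<nabla>\<partial>f\<close> in direction \<open>p\<close>, when \<open>L\<close> is the transposed Jacobian of \<open>f\<close>: the derivative
  of \<open>L\<close> corrected by the Chern connection \<open>\<partial>h h\<^sup>-\<^sup>1\<close> of the target and by \<open>\<partial>G G\<^sup>-\<^sup>1\<close> of the source.
\<close>

definition second_form :: "(complex^'k::finite \<Rightarrow> complex^'n^'n) \<Rightarrow> (complex^'k \<Rightarrow> complex^'n^'n) \<Rightarrow>
    (complex^'k \<Rightarrow> complex^'n^'n) \<Rightarrow> 'k \<Rightarrow> complex^'k \<Rightarrow> complex^'n^'n" where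
  "second_form G h L p w = mwirt (-1) p L w + L w ** mwirt (-1) p h w ** matrix_inv (h w) -
      mwirt (-1) p G w ** matrix_inv (G w) ** L w"

text \<open>
  For the rest of this section \<open>G\<close> and \<open>h\<close> are Hermitian metrics on a coordinate domain \<open>W\<close> and \<open>L\<close> is a
  holomorphic frame change; \<open>L h L\<^sup>*\<close> plays the part of the pulled-back metric.
\<close>

context
  fixes G h L :: "complex^'n::finite \<Rightarrow> complex^'n^'n" and W
  assumes W: "open W"
    and G: "\<And>w. w \<in> W \<Longrightarrow> mdiff G w" and G2: "\<And>w q. w \<in> W \<Longrightarrow> mdiff (mwirt 1 q G) w"
    and Gpos: "\<And>w. w \<in> W \<Longrightarrow> hermitian_pos_def (G w)"
    and h: "\<And>w. w \<in> W \<Longrightarrow> mdiff h w" and h2: "\<And>w q. w \<in> W \<Longrightarrow> mdiff (mwirt 1 q h) w"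
    and hpos: "\<And>w. w \<in> W \<Longrightarrow> hermitian_pos_def (h w)"
    and L: "mhol L W" and Li: "\<And>w. w \<in> W \<Longrightarrow> invertible (L w)"
begin

abbreviation "\<E> \<equiv> energy_of G h L"
abbreviation "\<B> \<equiv> second_form G h L"

lemma mwirt_bar_hermitian:
  assumes w: "w \<in> W" and F: "\<And>w. w \<in> W \<Longrightarrow> mdiff F w" "\<And>w. w \<in> W \<Longrightarrow> hadj (F w) = F w"
  shows "mwirt 1 p F w = hadj (mwirt (-1) p F w)"
proof -
  have "mwirt 1 p (\<lambda>w. hadj (F w)) w = mwirt 1 p F w" by (rule mwirt_cong[OF W w F(2)])
  then show ?thesis by (simp add: mwirt_hadj[OF F(1)[OF w]])
qed

lemma energy_of_pos: "w \<in> W \<Longrightarrow> 0 < \<E> w"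
  unfolding energy_of_def by (intro trace_pull_pos hpos Gpos Li)

lemma differentiable_energy_of:
  assumes w: "w \<in> W" shows "\<E> differentiable (at w)"
proof -
  note m = mdiff_inv[OF W w G[OF w] hermitian_pos_def_invertible[OF Gpos]]
  show ?thesis unfolding energy_of_def[abs_def]
    by (intro differentiable_trace mdiff_mult m mwirt_holomorphic_congruence(1)[OF L w h[OF w]])
qed

text \<open>
  The square found in \<open>wirt_wirt_trace_inv_mult\<close> is the one of \<open>\<nabla>\<partial>f\<close>. The second equation is the
  conjugate transpose of the first, as \<open>G\<close> and \<open>H\<close> are Hermitian.
\<close>

lemma pulled_difference:
  assumes w: "w \<in> W"
  defines "H \<equiv> \<lambda>w. L w ** h w ** hadj (L w)"
  shows "mwirt (-1) p H w - mwirt (-1) p G w ** matrix_inv (G w) ** H w = \<B> p w ** h w ** hadj (L w)"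
    "mwirt 1 p H w - H w ** matrix_inv (G w) ** mwirt 1 p G w = L w ** h w ** hadj (\<B> p w)"
proof -
  note iG = hermitian_pos_def_invertible[OF Gpos[OF w]] and ih =
      hermitian_pos_def_invertible[OF hpos[OF w]]
  show 1: "mwirt (-1) p H w - mwirt (-1) p G w ** matrix_inv (G w) ** H w = \<B> p w ** h w ** hadj (L w)"
    unfolding H_def second_form_def mwirt_holomorphic_congruence(2)[OF L w h[OF w]]
    by (simp add: matrix_algebra matrix_inv_mult[OF ih])
  have hH: "hadj (H w) = H w" if "w \<in> W" for w
    using hermitian_pos_def_hadj[OF hpos[OF that]] by (simp add: H_def hadj_mult matrix_mul_assoc)
  have hG: "hadj (G w) = G w" if "w \<in> W" for w using hermitian_pos_def_hadj[OF Gpos[OF that]] .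
  have hGi: "hadj (matrix_inv (G w)) = matrix_inv (G w)"
    using matrix_inv_hadj(1)[OF iG] hG[OF w] by simp
  have "mwirt 1 p H w = hadj (mwirt (-1) p H w)"
    by (rule mwirt_bar_hermitian[OF w _ hH])
        (auto simp: H_def intro: mwirt_holomorphic_congruence(1)[OF L _ h])
  moreover have "mwirt 1 p G w = hadj (mwirt (-1) p G w)"
    by (rule mwirt_bar_hermitian[OF w G hG])
  ultimately have "mwirt 1 p H w - H w ** matrix_inv (G w) ** mwirt 1 p G w =
      hadj (\<B> p w ** h w ** hadj (L w))"
    by (simp add: hadj_diff hadj_mult hH[OF w] hGi matrix_mul_assoc flip: 1)
  then show "mwirt 1 p H w - H w ** matrix_inv (G w) ** mwirt 1 p G w = L w ** h w ** hadj (\<B> p w)"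
    by (simp add: hadj_mult hermitian_pos_def_hadj[OF hpos[OF w]] matrix_mul_assoc)
qed

lemma wirt_energy_of:
  assumes w: "w \<in> W"
  shows "wirt (-1) p \<E> w = trace (\<B> p w ** h w ** hadj (L w) ** matrix_inv (G w))"
    "wirt 1 p \<E> w = cnj (trace (\<B> p w ** h w ** hadj (L w) ** matrix_inv (G w)))"
proof -
  have "wirt (-1) p \<E> w = trace (matrix_inv (G w) ** (\<B> p w ** h w ** hadj (L w)))"
    unfolding energy_of_def[abs_def] pulled_difference(1)[OF w, symmetric]
    by (rule wirt_trace_inv_mult[OF W w G[OF w] mwirt_holomorphic_congruence(1)[OF L w h[OF w]]
        hermitian_pos_def_invertible[OF Gpos]])
  then show 1: "wirt (-1) p \<E> w = trace (\<B> p w ** h w ** hadj (L w) ** matrix_inv (G w))"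
    using trace_mul_sym[of "matrix_inv (G w)" "\<B> p w ** h w ** hadj (L w)"] by simp
  have "wirt 1 p \<E> w = wirt 1 p (\<lambda>w. cnj (\<E> w)) w"
    by (rule wirt_cong[OF W w]) (use energy_of_pos in \<open>auto simp: less_complex_def complex_eq_iff\<close>)
  also have "\<dots> = cnj (wirt (-1) p \<E> w)" by (rule wirt_cnj[OF differentiable_energy_of[OF w]])
  finally show "wirt 1 p \<E> w = cnj (trace (\<B> p w ** h w ** hadj (L w) ** matrix_inv (G w)))"
    unfolding 1 .
qed

lemma differentiable_wirt_energy_of:
  assumes w: "w \<in> W"
  shows "wirt 1 q \<E> differentiable (at w)"
proof -
  let ?H = "\<lambda>w. L w ** h w ** hadj (L w)"
  have iG: "invertible (G w)" if "w \<in> W" for w using hermitian_pos_def_invertible[OF Gpos[OF that]] .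
  have ih: "invertible (h w)" if "w \<in> W" for w using hermitian_pos_def_invertible[OF hpos[OF that]] .
  note m = mdiff_inv[OF W w G[OF w] iG]
  note H = mwirt_holomorphic_congruence(1)[OF L _ h] and H2 =
      chern_curv_holomorphic_congruence(1)[OF W w L h h2[OF w] ih[OF w] Li[OF w]]
  have "(\<lambda>w. trace (matrix_inv (G w) ** (mwirt 1 q ?H w - mwirt 1 q G w ** matrix_inv (G w) ** ?H w)))
      differentiable (at w)"
    by (intro differentiable_trace mdiff_mult mdiff_diff m H2 G2[OF w] H w)
  then show ?thesis
    by (rule differentiable_cong_open[OF W w, rotated])
      (unfold energy_of_def[abs_def], rule wirt_trace_inv_mult[OF W _ G H iG, symmetric])
qed

lemma wirt_wirt_energy_of:
  assumes w: "w \<in> W"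
  shows "wirt (-1) p (wirt 1 q \<E>) w =
     - trace (matrix_inv (G w) ** (L w ** chern_curv h p q w ** hadj (L w)))
     + trace (matrix_inv (G w) ** chern_curv G p q w ** matrix_inv (G w) ** (L w ** h w ** hadj (L w)))
     + trace (\<B> p w ** h w ** hadj (\<B> q w) ** matrix_inv (G w))"
proof -
  let ?H = "\<lambda>w. L w ** h w ** hadj (L w)"
  have iG: "invertible (G w)" if "w \<in> W" for w using hermitian_pos_def_invertible[OF Gpos[OF that]] .
  have ih: "invertible (h w)" if "w \<in> W" for w using hermitian_pos_def_invertible[OF hpos[OF that]] .
  note H = mwirt_holomorphic_congruence(1)[OF L _ h] and H2 =
      chern_curv_holomorphic_congruence[OF W w L h h2[OF w] ih[OF w] Li[OF w]]
  have "wirt (-1) p (wirt 1 q \<E>) w =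
     - trace (matrix_inv (G w) ** chern_curv ?H p q w) + trace (matrix_inv (G w) ** chern_curv G p q w
         ** matrix_inv (G w) ** ?H w)
     + trace (matrix_inv (G w) ** (\<B> p w ** h w ** hadj (L w)) ** matrix_inv (?H w)
               ** (L w ** h w ** hadj (\<B> q w)))"
    unfolding energy_of_def[abs_def] pulled_difference[OF w, symmetric]
    by (rule wirt_wirt_trace_inv_mult[OF W w G H iG _ G2[OF w] H2(1)])
        (use matrix_inv_congruence(2)[OF ih[OF w] Li[OF w]] in auto)
  also have "chern_curv ?H p q w = L w ** chern_curv h p q w ** hadj (L w)" by (rule H2(2))
  also have "matrix_inv (G w) ** (\<B> p w ** h w ** hadj (L w)) ** matrix_inv (?H w)
               ** (L w ** h w ** hadj (\<B> q w)) = matrix_inv (G w) ** (\<B> p w ** h w ** hadj (\<B> q w))"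
    unfolding matrix_inv_congruence(1)[OF ih[OF w] Li[OF w]]
    by (simp add: matrix_mul_assoc hadj_cancel[OF Li[OF w]] matrix_inv_mult[OF ih[OF w]]
        matrix_inv_mult[OF Li[OF w]])
  also have "trace \<dots> = trace (\<B> p w ** h w ** hadj (\<B> q w) ** matrix_inv (G w))"
    by (rule trace_mul_sym)
  finally show ?thesis .
qed

text \<open>
  Here \<open>h\<close> is moreover Kaehler and the derivatives are contracted with its inverse. The summand \<open>e\<close> is
  the local form of the error term.
\<close>

lemma local_bochner:
  assumes w: "w \<in> W" and cl: "closed_form_on h W" and hh: "mdiff2 h W"
  defines "D \<equiv> dual_metric (h w)"
  defines "e \<equiv> (\<Sum>p\<in>UNIV. \<Sum>q\<in>UNIV. D $ p $ q * trace (\<B> p w ** h w ** hadj (\<B> q w) ** matrix_inv (G w)))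
     - \<E> w * (\<Sum>p\<in>UNIV. \<Sum>q\<in>UNIV. D $ p $ q * wirt (-1) p (\<lambda>w. Ln (\<E> w)) w * wirt 1 q (\<lambda>w. Ln (\<E> w)) w)"
  shows "\<E> w * (\<Sum>p\<in>UNIV. \<Sum>q\<in>UNIV. D $ p $ q * wirt (-1) p (wirt 1 q (\<lambda>w. Ln (\<E> w))) w) =
     - trace (matrix_inv (G w) ** (L w ** (\<chi> i j. - wirt (-1) i (wirt 1 j (\<lambda>w. Ln (det (h w)))) w)
         ** hadj (L w)))
     + (\<Sum>p\<in>UNIV. \<Sum>q\<in>UNIV. D $ p $ q * trace (matrix_inv (G w) ** chern_curv G p q w ** matrix_inv (G w)
         ** (L w ** h w ** hadj (L w))))
     + e" "0 \<le> e"
proof -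
  let ?E = "\<E> w"
  let ?d = "\<lambda>p. trace (\<B> p w ** h w ** hadj (L w) ** matrix_inv (G w))"
  have Epos: "0 < ?E" by (rule energy_of_pos[OF w])
  then have nz: "?E \<noteq> 0" by auto
  note nn = pos_not_nonpos_Reals[OF energy_of_pos]
  have L1: "wirt (-1) p (\<lambda>w. Ln (\<E> w)) w = ?d p / ?E" "wirt 1 p (\<lambda>w. Ln (\<E> w)) w = cnj (?d p) / ?E"
      for p
    by (simp_all add: wirt_Ln(2)[OF differentiable_energy_of[OF w] nn[OF w]] wirt_energy_of[OF w])
  have L2: "wirt (-1) p (wirt 1 q (\<lambda>w. Ln (\<E> w))) w = wirt (-1) p (wirt 1 q \<E>) w / ?E -
      ?d p * cnj (?d q) / ?E\<^sup>2" for p q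
    by (subst wirt_wirt_Ln[OF W w differentiable_energy_of nn differentiable_wirt_energy_of[OF w]])
        (auto simp: wirt_energy_of[OF w])
  have grad: "?E * (\<Sum>p\<in>UNIV. \<Sum>q\<in>UNIV. D $ p $ q * wirt (-1) p (\<lambda>w. Ln (\<E> w)) w * wirt 1 q (\<lambda>w. Ln (\<E> w))
      w)
     = (\<Sum>p\<in>UNIV. \<Sum>q\<in>UNIV. D $ p $ q * (?d p * cnj (?d q) / ?E))"
    unfolding L1 sum_distrib_left by (intro sum.cong refl) (use nz in \<open>simp add: field_simps\<close>)
  have lap: "?E * (\<Sum>p\<in>UNIV. \<Sum>q\<in>UNIV. D $ p $ q * wirt (-1) p (wirt 1 q (\<lambda>w. Ln (\<E> w))) w)
     = (\<Sum>p\<in>UNIV. \<Sum>q\<in>UNIV. D $ p $ q * wirt (-1) p (wirt 1 q \<E>) w) -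
         (\<Sum>p\<in>UNIV. \<Sum>q\<in>UNIV. D $ p $ q * (?d p * cnj (?d q) / ?E))"
    unfolding L2 sum_distrib_left sum_subtractf[symmetric]
    by (intro sum.cong refl) (use nz in \<open>simp add: field_simps power2_eq_square\<close>)
  have ric: "(\<Sum>p\<in>UNIV. \<Sum>q\<in>UNIV. D $ p $ q * trace (matrix_inv (G w)
      ** (L w ** chern_curv h p q w ** hadj (L w)))) =
    trace (matrix_inv (G w) ** (L w ** (\<chi> i j. - wirt (-1) i (wirt 1 j (\<lambda>w. Ln (det (h w)))) w)
        ** hadj (L w)))"
  proof -
    have "(\<chi> i j. - wirt (-1) i (wirt 1 j (\<lambda>w. Ln (det (h w)))) w) =
        (\<Sum>p\<in>UNIV. \<Sum>q\<in>UNIV. mscale (D $ p $ q) (chern_curv h p q w))"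
      unfolding D_def by (rule ricci_contraction[OF cl W w hh, symmetric]) (rule hpos)
    then show ?thesis
      by (simp only: matrix_sum_left matrix_sum_right mscale_algebra trace_sum trace_mscale)
  qed
  show "\<E> w * (\<Sum>p\<in>UNIV. \<Sum>q\<in>UNIV. D $ p $ q * wirt (-1) p (wirt 1 q (\<lambda>w. Ln (\<E> w))) w) =
     - trace (matrix_inv (G w) ** (L w ** (\<chi> i j. - wirt (-1) i (wirt 1 j (\<lambda>w. Ln (det (h w)))) w)
         ** hadj (L w)))
     + (\<Sum>p\<in>UNIV. \<Sum>q\<in>UNIV. D $ p $ q * trace (matrix_inv (G w) ** chern_curv G p q w ** matrix_inv (G w)
         ** (L w ** h w ** hadj (L w))))
     + e"
    unfolding e_def grad lap ric[symmetric] wirt_wirt_energy_of[OF w]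
    by (simp add: distrib_left right_diff_distrib sum.distrib sum_negf sum_subtractf)
  have "?E = trace (L w ** h w ** hadj (L w) ** matrix_inv (G w))"
    unfolding energy_of_def by (rule trace_mul_sym)
  from contraction_Cauchy_Schwarz[OF hpos[OF w] Gpos[OF w] this Epos refl]
  show "0 \<le> e" unfolding e_def grad unfolding D_def by simp
qed

end

section \<open>Charts, Jacobians and independence of charts\<close>

lemma chart_inv_left:
  assumes "is_chart X c" "x \<in> fst c" shows "chart_inv c (snd c x) = x"
proof -
  have "inj_on (snd c) (topspace (subtopology X (fst c)))"
    using assms(1) homeomorphic_imp_injective_map unfolding is_chart_def by blast
  moreover have "fst c \<subseteq> topspace X" using assms(1) openin_subset unfolding is_chart_def by blast
  ultimately have "inj_on (snd c) (fst c)" by (simp add: Int_absorb1)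
  then show ?thesis unfolding chart_inv_def using assms(2) by simp
qed

lemma has_derivative_matrix_unique:
  fixes A B :: "complex^'n::finite^'m::finite"
  assumes "(F has_derivative (\<lambda>v. A *v v)) (at z)" "(F has_derivative (\<lambda>v. B *v v)) (at z)"
  shows "A = B"
  using has_derivative_unique[OF assms] by (simp add: matrix_eq fun_eq_iff)

text \<open>
  The form of the chain rule needed for commuting squares of coordinate changes: two factorisations of
  the same local map have the same product of Jacobians.
\<close>

lemma jacobian_chain:
  fixes A :: "complex^'n::finite^'m::finite" and A' :: "complex^'n^'k::finite"
      and B :: "complex^'m^'l::finite" and B' :: "complex^'k^'l"
  assumes U: "open U" "z \<in> U"
    and F: "(F has_derivative (\<lambda>v. A *v v)) (at z)" and G: "(G has_derivative (\<lambda>v. B *v v)) (at (F z))"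
    and F': "(F' has_derivative (\<lambda>v. A' *v v)) (at z)"
        and G': "(G' has_derivative (\<lambda>v. B' *v v)) (at (F' z))"
    and eq: "\<And>x. x \<in> U \<Longrightarrow> G (F x) = G' (F' x)"
  shows "B ** A = B' ** A'"
proof -
  have 1: "((\<lambda>x. G (F x)) has_derivative (\<lambda>v. (B ** A) *v v)) (at z)"
    using has_derivative_compose[OF F G] by (simp add: matrix_vector_mul_assoc)
  have 2: "((\<lambda>x. G' (F' x)) has_derivative (\<lambda>v. (B' ** A') *v v)) (at z)"
    using has_derivative_compose[OF F' G'] by (simp add: matrix_vector_mul_assoc)
  have "((\<lambda>x. G' (F' x)) has_derivative (\<lambda>v. (B ** A) *v v)) (at z)"
    by (rule has_derivative_transform_within_open[OF 1 U eq])
  from has_derivative_matrix_unique[OF this 2] show ?thesis .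
qed

lemma jacobian_inverse:
  fixes A :: "complex^'n::finite^'n" and B :: "complex^'n^'n"
  assumes U: "open U" "z \<in> U"
    and F: "(F has_derivative (\<lambda>v. A *v v)) (at z)" and G: "(G has_derivative (\<lambda>v. B *v v)) (at (F z))"
    and eq: "\<And>x. x \<in> U \<Longrightarrow> G (F x) = x"
  shows "B ** A = mat 1" "invertible A" "invertible B"
proof -
  have i: "((\<lambda>x. x) has_derivative (\<lambda>v. (mat 1 :: complex^'n^'n) *v v)) (at z')" for z' by simp
  show 1: "B ** A = mat 1"
    using jacobian_chain[OF U F G i i] eq by simp
  then show "invertible B" by (rule matrix_inv_unique_right)
  from 1 have "A ** B = mat 1" using matrix_left_right_inverse by blast
  then show "invertible A" by (rule matrix_inv_unique_right)
qed

lemma pull_form_eq: "pull_form J H = transpose J ** H ** hadj (transpose J)"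
  by (simp add: pull_form_def vec_eq_iff matrix_matrix_mult_def transpose_def sum_distrib_left
      sum_distrib_right mult_ac)
    (intro allI sum.swap)

lemma pull_form_compose: "pull_form J (pull_form Q H) = pull_form (Q ** J) H"
  by (simp add: pull_form_eq matrix_transpose_mul hadj_mult matrix_mul_assoc)

lemma invertible_transpose: "invertible (A::complex^'n::finite^'n) \<Longrightarrow> invertible (transpose A)"
  by (simp add: invertible_det_nz det_transpose)

lemma trace_dual: "(\<Sum>i\<in>UNIV. \<Sum>l\<in>UNIV. dual_metric G $ i $ l * X $ i $ l) = trace (matrix_inv G ** X)"
  unfolding trace_def matrix_matrix_mult_def dual_metric_def transpose_def
  by simp (rule sum.swap)

lemma trace_pull_form_invariant:
  fixes P :: "complex^'n::finite^'n"
  assumes P: "invertible P" and G: "invertible G"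
  shows "trace (matrix_inv (pull_form P G) ** pull_form P X) = trace (matrix_inv G ** X)"
proof -
  let ?L = "transpose P"
  note L = invertible_transpose[OF P]
  have "invertible (?L ** G)" and "invertible (hadj ?L)"
    using L G by (simp_all add: matrix_inv_product matrix_inv_hadj)
  then have inv: "matrix_inv (?L ** G ** hadj ?L) = matrix_inv (hadj ?L) ** matrix_inv G
      ** matrix_inv ?L"
    using L G by (simp add: matrix_inv_product matrix_mul_assoc)
  have "trace (matrix_inv (pull_form P G) ** pull_form P X) =
      trace (matrix_inv (hadj ?L) ** (matrix_inv G ** X ** hadj ?L))"
    unfolding pull_form_eq inv by (simp add: matrix_mul_assoc matrix_inv_mult[OF L])
  also have "\<dots> = trace (matrix_inv G ** X ** hadj ?L ** matrix_inv (hadj ?L))" by (rule trace_mul_sym)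
  also have "\<dots> = trace (matrix_inv G ** X)" using \<open>invertible (hadj ?L)\<close> by (simp add: matrix_inv_mult)
  finally show ?thesis .
qed

lemma trace_pull_eq: "trace_pull M c d f H x = trace (matrix_inv (metric M c (snd c x))
    ** pull_form (del_f c d f (snd c x)) H)"
  unfolding trace_pull_def by (rule trace_dual)

lemma kaehler_manifoldD:
  assumes "kaehler_manifold M"
  shows "complex_manifold (mfd_top M) (atlas M)"
    "c \<in> atlas M \<Longrightarrow> Cinf_on (\<lambda>z. metric M c z $ i $ j) (snd c ` fst c)"
    "c \<in> atlas M \<Longrightarrow> z \<in> snd c ` fst c \<Longrightarrow> hermitian_pos_def (metric M c z)"
    "c \<in> atlas M \<Longrightarrow> closed_form_on (metric M c) (snd c ` fst c)"
    "c \<in> atlas M \<Longrightarrow> d \<in> atlas M \<Longrightarrow> x \<in> fst c \<Longrightarrow> x \<in> fst d \<Longrightarrow>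
      metric M c (snd c x) = pull_form (cjac (snd d \<circ> chart_inv c) (snd c x)) (metric M d (snd d x))"
  using assms unfolding kaehler_manifold_def by blast+

lemma kaehler_chart:
  assumes "kaehler_manifold M" "c \<in> atlas M"
  shows "is_chart (mfd_top M) c" "fst c \<subseteq> topspace (mfd_top M)" "open (snd c ` fst c)"
proof -
  show c: "is_chart (mfd_top M) c"
    using kaehler_manifoldD(1)[OF assms(1)] assms(2) unfolding complex_manifold_def by blast
  then show "fst c \<subseteq> topspace (mfd_top M)" "open (snd c ` fst c)"
    using openin_subset unfolding is_chart_def by blast+
qed

lemma kaehler_transition:
  assumes "kaehler_manifold M" "c \<in> atlas M" "d \<in> atlas M"
  shows "holomorphic_map_on (snd d \<circ> chart_inv c) (snd c ` (fst c \<inter> fst d))"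
  using kaehler_manifoldD(1)[OF assms(1)] assms(2,3) unfolding complex_manifold_def by blast

lemma transition_invertible:
  assumes M: "kaehler_manifold M" "c \<in> atlas M" "d \<in> atlas M" and x: "x \<in> fst c" "x \<in> fst d"
  shows "invertible (cjac (snd d \<circ> chart_inv c) (snd c x))"
proof -
  note t1 = kaehler_transition[OF M] and t2 = kaehler_transition[OF M(1,3,2)]
  note l = chart_inv_left[OF kaehler_chart(1)[OF M(1,2)]] chart_inv_left[OF kaehler_chart(1)[OF M(1,3)]]
  have 1: "((snd d \<circ> chart_inv c) has_derivative (\<lambda>v. cjac (snd d \<circ> chart_inv c) (snd c x) *v v))
      (at (snd c x))"
    using holomorphic_map_on_component(3)[OF t1] x by blast
  have "(snd d \<circ> chart_inv c) (snd c x) = snd d x" using l x by simp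
  then have 2: "((snd c \<circ> chart_inv d) has_derivative (\<lambda>v. cjac (snd c \<circ> chart_inv d) (snd d x) *v v))
      (at ((snd d \<circ> chart_inv c) (snd c x)))"
    using holomorphic_map_on_component(3)[OF t2] x by auto
  show ?thesis
  proof (rule jacobian_inverse(2)[OF holomorphic_map_on_component(1)[OF t1] _ 1 2])
    show "snd c x \<in> snd c ` (fst c \<inter> fst d)" using x by blast
  next
    fix z assume "z \<in> snd c ` (fst c \<inter> fst d)"
    then obtain y where "y \<in> fst c" "y \<in> fst d" "z = snd c y" by blast
    then show "(snd c \<circ> chart_inv d) ((snd d \<circ> chart_inv c) z) = z" using l by simp
  qed
qed

text \<open>
  Near the point, first changing the chart of \<open>M\<close> and then applying \<open>f\<close> is the same as applying \<open>f\<close> and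
  then changing the chart of \<open>N\<close>. Hence \<open>J' P = Q J\<close> for the Jacobians, both the metric of \<open>M\<close> and the
  pulled-back metric of \<open>N\<close> transform by \<open>P\<close>, and the trace is unchanged.
\<close>

lemma trace_pull_chart_independent:
  fixes M :: "('a, 'n::finite) kaehler_data" and N :: "('b, 'n) kaehler_data"
  assumes M: "kaehler_manifold M" and N: "kaehler_manifold N"
    and f: "holomorphic_mfd_map (mfd_top M) (atlas M) (mfd_top N) (atlas N) f"
    and c: "c \<in> atlas M" "x \<in> fst c" and c': "c' \<in> atlas M" "x \<in> fst c'"
    and d: "d \<in> atlas N" "f x \<in> fst d" and d': "d' \<in> atlas N" "f x \<in> fst d'"
  shows "trace_pull M c d f (metric N d (snd d (f x))) x =
      trace_pull M c' d' f (metric N d' (snd d' (f x))) x"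
proof -
  let ?P = "cjac (snd c' \<circ> chart_inv c) (snd c x)" and ?Q = "cjac (snd d' \<circ> chart_inv d) (snd d (f x))"
  let ?J = "del_f c d f (snd c x)" and ?J' = "del_f c' d' f (snd c' x)"
  note lc = chart_inv_left[OF kaehler_chart(1)[OF M c(1)]] and lc' =
      chart_inv_left[OF kaehler_chart(1)[OF M c'(1)]]
  note ld = chart_inv_left[OF kaehler_chart(1)[OF N d(1)]]
  have gP: "metric M c (snd c x) = pull_form ?P (metric M c' (snd c' x))"
    by (rule kaehler_manifoldD(5)[OF M c(1) c'(1) c(2) c'(2)])
  have hQ: "metric N d (snd d (f x)) = pull_form ?Q (metric N d' (snd d' (f x)))"
    by (rule kaehler_manifoldD(5)[OF N d(1) d'(1) d(2) d'(2)])
  let ?V = "snd c ` {x \<in> fst c. f x \<in> fst d}"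
  have hol: "holomorphic_map_on (snd d \<circ> f \<circ> chart_inv c) ?V" using f c d
      unfolding holomorphic_mfd_map_def by blast
  have hol': "holomorphic_map_on (snd d' \<circ> f \<circ> chart_inv c') (snd c' ` {x \<in> fst c'. f x \<in> fst d'})"
    using f c' d' unfolding holomorphic_mfd_map_def by blast
  note tM = kaehler_transition[OF M c(1) c'(1)] and tN = kaehler_transition[OF N d(1) d'(1)]
  have "?J' ** ?P = ?Q ** ?J"
  proof (rule jacobian_chain[where U = "?V \<inter> snd c ` (fst c \<inter> fst c')" and z = "snd c x"
        and F = "snd c' \<circ> chart_inv c" and G = "snd d' \<circ> f \<circ> chart_inv c'" and F' =
            "snd d \<circ> f \<circ> chart_inv c" and G' = "snd d' \<circ> chart_inv d"])
    show "open (?V \<inter> snd c ` (fst c \<inter> fst c'))"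
      using holomorphic_map_on_component(1)[OF hol] holomorphic_map_on_component(1)[OF tM] by blast
    show "snd c x \<in> ?V \<inter> snd c ` (fst c \<inter> fst c')" using c c' d by blast
    show "((snd c' \<circ> chart_inv c) has_derivative (\<lambda>v. ?P *v v)) (at (snd c x))"
      using holomorphic_map_on_component(3)[OF tM] c c' by blast
    show "((snd d \<circ> f \<circ> chart_inv c) has_derivative (\<lambda>v. ?J *v v)) (at (snd c x))"
      unfolding del_f_def using holomorphic_map_on_component(3)[OF hol] c d by blast
    have "(snd c' \<circ> chart_inv c) (snd c x) = snd c' x" using lc c by simp
    then show "((snd d' \<circ> f \<circ> chart_inv c')
        has_derivative (\<lambda>v. ?J' *v v)) (at ((snd c' \<circ> chart_inv c) (snd c x)))"
      unfolding del_f_def using holomorphic_map_on_component(3)[OF hol'] c' d' by auto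
    have "(snd d \<circ> f \<circ> chart_inv c) (snd c x) = snd d (f x)" using lc c by simp
    then show "((snd d' \<circ> chart_inv d)
        has_derivative (\<lambda>v. ?Q *v v)) (at ((snd d \<circ> f \<circ> chart_inv c) (snd c x)))"
      using holomorphic_map_on_component(3)[OF tN] d d' by auto
  next
    fix z assume "z \<in> ?V \<inter> snd c ` (fst c \<inter> fst c')"
    then obtain y y' where y: "y \<in> fst c" "f y \<in> fst d" "z = snd c y" "y' \<in> fst c" "y' \<in> fst c'" "z =
        snd c y'" by blast
    then have "y' = y" using lc by metis
    then show "(snd d' \<circ> f \<circ> chart_inv c') ((snd c' \<circ> chart_inv c) z) =
        (snd d' \<circ> chart_inv d) ((snd d \<circ> f \<circ> chart_inv c) z)"
      using y lc lc' ld by simp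
  qed
  then have "pull_form ?J (metric N d (snd d (f x))) =
      pull_form ?P (pull_form ?J' (metric N d' (snd d' (f x))))"
    unfolding hQ pull_form_compose by simp
  then show ?thesis unfolding trace_pull_eq gP
    by (simp add: trace_pull_form_invariant transition_invertible[OF M c(1) c'(1) c(2) c'(2)]
        hermitian_pos_def_invertible[OF kaehler_manifoldD(3)[OF M c'(1) imageI[OF c'(2)]]])
qed

text \<open>
  The definition of \<open>energy\<close> picks charts point by point, so differentiating it requires an expression
  in a fixed pair of charts.
\<close>

lemma energy_eq:
  fixes M :: "('a, 'n::finite) kaehler_data" and N :: "('b, 'n) kaehler_data"
  assumes M: "kaehler_manifold M" and N: "kaehler_manifold N"
    and f: "holomorphic_mfd_map (mfd_top M) (atlas M) (mfd_top N) (atlas N) f"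
    and c: "c \<in> atlas M" "x \<in> fst c" and d: "d \<in> atlas N" "f x \<in> fst d"
  shows "energy M N f x = Re (trace_pull M c d f (metric N d (snd d (f x))) x)"
proof -
  have 1: "chart_at M x \<in> atlas M \<and> x \<in> fst (chart_at M x)"
    unfolding chart_at_def by (rule someI[of _ c]) (use c in simp)
  have 2: "chart_at N (f x) \<in> atlas N \<and> f x \<in> fst (chart_at N (f x))"
    unfolding chart_at_def by (rule someI[of _ d]) (use d in simp)
  show ?thesis unfolding energy_def Let_def
    using trace_pull_chart_independent[OF M N f _ _ c _ _ d] 1 2 by metis
qed

text \<open>
  The summation order is the one in which \<open>curvature_term\<close> lists its frame indices.
\<close>

lemma trace4: "trace ((A::complex^'n::finite^'n) ** B ** C ** D) =
    (\<Sum>i\<in>UNIV. \<Sum>t\<in>UNIV. \<Sum>s\<in>UNIV. \<Sum>l\<in>UNIV. A$i$l * B$l$s * C$s$t * D$t$i)"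
  by (simp add: trace_def matrix_matrix_mult_def sum_distrib_right)

text \<open>
  Derivatives with respect to \<open>w\<close> carry factors from the Jacobian \<open>K\<close> of \<open>\<phi>\<close>; contracting them with the
  dual metric \<open>D\<close> of \<open>N\<close> gives contractions with its push-forward, which is how the tensors on \<open>M\<close> are
  contracted.
\<close>

lemma sum_pushforward:
  fixes D :: "complex^'m::finite^'m" and K :: "complex^'m^'n::finite"
  shows "(\<Sum>p\<in>UNIV. \<Sum>q\<in>UNIV. D $ p $ q * (\<Sum>a\<in>UNIV. \<Sum>b\<in>UNIV. K $ a $ p * cnj (K $ b $ q) * F a b))
     = (\<Sum>a\<in>UNIV. \<Sum>b\<in>UNIV. push_dual K D $ a $ b * F a b)"
proof -
  have "(\<Sum>p\<in>UNIV. \<Sum>q\<in>UNIV. D $ p $ q * (\<Sum>a\<in>UNIV. \<Sum>b\<in>UNIV. K $ a $ p * cnj (K $ b $ q) * F a b)) =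
     (\<Sum>p\<in>UNIV. \<Sum>q\<in>UNIV. \<Sum>a\<in>UNIV. \<Sum>b\<in>UNIV. K $ a $ p * cnj (K $ b $ q) * D $ p $ q * F a b)"
    by (simp add: sum_distrib_left mult_ac)
  also have "\<dots> = (\<Sum>a\<in>UNIV. \<Sum>p\<in>UNIV. \<Sum>q\<in>UNIV. \<Sum>b\<in>UNIV. K $ a $ p * cnj (K $ b $ q) * D $ p $ q * F a b)"
    by (subst (2) sum.swap, subst sum.swap) (rule refl)
  also have "\<dots> = (\<Sum>a\<in>UNIV. \<Sum>b\<in>UNIV. \<Sum>p\<in>UNIV. \<Sum>q\<in>UNIV. K $ a $ p * cnj (K $ b $ q) * D $ p $ q * F a b)"
    by (rule sum.cong[OF refl], subst (2) sum.swap, subst sum.swap, rule refl)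
  finally show ?thesis by (simp add: push_dual_def sum_distrib_right)
qed

section \<open>Tensors of the manifolds in matrix form, and the theorem\<close>

lemma holomorphic_map_on_cong:
  assumes "holomorphic_map_on F S" "\<And>z. z \<in> S \<Longrightarrow> F z = F' z"
  shows "holomorphic_map_on F' S"
  unfolding holomorphic_map_on_def
proof (intro conjI ballI)
  show S: "open S" using assms(1) by (simp add: holomorphic_map_on_def)
  fix z assume z: "z \<in> S"
  then obtain A where "(F has_derivative (\<lambda>v. A *v v)) (at z)" using assms(1)
      unfolding holomorphic_map_on_def by blast
  then have "(F' has_derivative (\<lambda>v. A *v v)) (at z)"
      by (rule has_derivative_transform_within_open[OF _ S z assms(2)])
  then show "\<exists>A. (F' has_derivative (\<lambda>v. A *v v)) (at z)" by blast
qed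

text \<open>
  The derivatives in \<open>second_form\<close> are along the coordinates of \<open>N\<close>, those in \<open>nabla_del_f\<close> along the
  coordinates of \<open>M\<close>; \<open>S\<close> is the latter in matrix form. The target connection term already carries a
  derivative along \<open>N\<close>, which \<open>J K = 1\<close> restores.
\<close>

lemma second_form_pushforward:
  fixes g h :: "complex^'n::finite \<Rightarrow> complex^'n^'n" and \<phi> \<psi> :: "complex^'n \<Rightarrow> complex^'n"
  assumes \<phi>: "holomorphic_map_on \<phi> W" and w: "w \<in> W" and \<psi>: "holomorphic_map_on \<psi> V" and sub: "\<phi> w \<in> V"
    and g: "mdiff g (\<phi> w)" and JK: "cjac \<psi> (\<phi> w) ** cjac \<phi> w = mat 1"
  defines "L \<equiv> \<lambda>w. transpose (cjac \<psi> (\<phi> w))"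
  defines "S \<equiv> \<lambda>a. mwirt (-1) a (\<lambda>z. transpose (cjac \<psi> z)) (\<phi> w) - mwirt (-1) a g (\<phi> w)
      ** matrix_inv (g (\<phi> w)) ** L w
     + (\<Sum>b\<in>UNIV. mscale (cjac \<psi> (\<phi> w) $ b $ a) (L w ** mwirt (-1) b h w ** matrix_inv (h w)))"
  shows "second_form (\<lambda>w. g (\<phi> w)) h L p w = (\<Sum>a\<in>UNIV. mscale (cjac \<phi> w $ a $ p) (S a))"
proof -
  let ?K = "cjac \<phi> w" and ?J = "cjac \<psi> (\<phi> w)"
  have mJ: "mdiff (\<lambda>z. transpose (cjac \<psi> z)) (\<phi> w)"
    using hol_onD(1)[OF hol_on_cjac[OF \<psi>] sub] by (simp add: mdiff_def transpose_def)
  have "(\<Sum>a\<in>UNIV. mscale (?K $ a $ p) (\<Sum>b\<in>UNIV. mscale (?J $ b $ a) (X b))) = X p"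
      for X :: "'n \<Rightarrow> complex^'n^'n"
  proof -
    have "(\<Sum>a\<in>UNIV. mscale (?K $ a $ p) (\<Sum>b\<in>UNIV. mscale (?J $ b $ a) (X b))) =
        (\<Sum>a\<in>UNIV. \<Sum>b\<in>UNIV. mscale (?J $ b $ a * ?K $ a $ p) (X b))"
      by (simp add: mscale_algebra mult.commute)
    also have "\<dots> = (\<Sum>b\<in>UNIV. \<Sum>a\<in>UNIV. mscale (?J $ b $ a * ?K $ a $ p) (X b))" by (rule sum.swap)
    also have "\<dots> = (\<Sum>b\<in>UNIV. mscale ((?J ** ?K) $ b $ p) (X b))"
      by (intro sum.cong refl)
          (simp add: vec_eq_iff sum_component matrix_matrix_mult_def sum_distrib_right)
    also have "\<dots> = (\<Sum>b\<in>UNIV. if b = p then X b else 0)"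
      unfolding JK by (intro sum.cong refl) (simp add: mat_def vec_eq_iff)
    finally show ?thesis by simp
  qed
  note * = this
  have "(\<Sum>a\<in>UNIV. mscale (?K $ a $ p) (S a)) =
      (\<Sum>a\<in>UNIV. mscale (?K $ a $ p) (mwirt (-1) a (\<lambda>z. transpose (cjac \<psi> z)) (\<phi> w)))
     - (\<Sum>a\<in>UNIV. mscale (?K $ a $ p) (mwirt (-1) a g (\<phi> w) ** matrix_inv (g (\<phi> w)) ** L w)) + L w
         ** mwirt (-1) p h w ** matrix_inv (h w)"
    unfolding S_def mscale_algebra(4,5) sum.distrib sum_subtractf * ..
  moreover have "mwirt (-1) p L w =
      (\<Sum>a\<in>UNIV. mscale (?K $ a $ p) (mwirt (-1) a (\<lambda>z. transpose (cjac \<psi> z)) (\<phi> w)))"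
    unfolding L_def by (rule mwirt_compose(2)[OF \<phi> w mJ])
  ultimately show ?thesis
    unfolding second_form_def mwirt_compose(2)[OF \<phi> w g]
    by (simp add: matrix_sum_left mscale_algebra(1))
qed

lemma nabla_del_f_eq:
  fixes M :: "('a, 'n::finite) kaehler_data" and N :: "('b, 'n) kaehler_data" and f :: "'a \<Rightarrow> 'b"
    and c :: "('a, 'n) chart" and d :: "('b, 'n) chart"
  defines "J \<equiv> del_f c d f"
  shows "nabla_del_f M N c d f x a p i = (mwirt (-1) p (\<lambda>z. transpose (J z)) (snd c x)
     - mwirt (-1) p (metric M c) (snd c x) ** matrix_inv (metric M c (snd c x))
         ** transpose (J (snd c x))
     + (\<Sum>b\<in>UNIV. mscale (J (snd c x) $ b $ p) (transpose (J (snd c x))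
         ** mwirt (-1) b (metric N d) (snd d (f x)) ** matrix_inv (metric N d (snd d (f x)))))) $ i $ a"
proof -
  have C: "christoffel M c z k p i = (mwirt (-1) p (metric M c) z ** matrix_inv (metric M c z)) $ i $ k"
    for M :: "('e, 'n) kaehler_data" and c z k p i
    by (simp add: christoffel_def matrix_matrix_mult_def dual_metric_def transpose_def dz_eq_wirt
        mult.commute)
  have tm: "(transpose A ** B) $ i $ a = (\<Sum>e\<in>UNIV. A $ e $ i * B $ e $ a)" for A B :: "complex^'n^'n"
      and i a
    by (simp add: matrix_matrix_mult_def transpose_def)
  have 1: "(\<Sum>k\<in>UNIV. christoffel M c (snd c x) k p i * J (snd c x) $ a $ k) =
    (mwirt (-1) p (metric M c) (snd c x) ** matrix_inv (metric M c (snd c x))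
        ** transpose (J (snd c x))) $ i $ a"
    unfolding C by (simp add: matrix_matrix_mult_def[of "_ ** _"] transpose_def)
  have 2: "(\<Sum>b\<in>UNIV. \<Sum>e\<in>UNIV. christoffel N d (snd d (f x)) a b e * J (snd c x) $ b $ p * J
      (snd c x) $ e $ i) =
    (\<Sum>b\<in>UNIV. mscale (J (snd c x) $ b $ p) (transpose (J (snd c x))
        ** mwirt (-1) b (metric N d) (snd d (f x)) ** matrix_inv (metric N d (snd d (f x))))) $ i $ a"
    unfolding C sum_component mscale_nth matrix_mul_assoc[symmetric]
    by (simp add: tm sum_distrib_left mult_ac)
  show ?thesis unfolding nabla_del_f_def Let_def J_def[symmetric] 1 2
    by (simp add: dz_eq_wirt transpose_def)
qed

lemma nabla_del_f_norm_sq_eq: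
  assumes S: "\<And>a p i. nabla_del_f M N c d f x a p i = S p $ i $ a"
  shows "nabla_del_f_norm_sq M N c d f x = (\<Sum>p\<in>UNIV. \<Sum>q\<in>UNIV. dmetric_on_M M N c d f x $ p $ q *
     trace (S p ** metric N d (snd d (f x)) ** hadj (S q) ** matrix_inv (metric M c (snd c x))))"
proof -
  let ?h = "metric N d (snd d (f x))" and ?gi = "matrix_inv (metric M c (snd c x))"
  have "trace (S p ** ?h ** hadj (S q) ** ?gi) = (\<Sum>i\<in>UNIV. \<Sum>l\<in>UNIV. \<Sum>a\<in>UNIV. \<Sum>b\<in>UNIV.
      ?gi $ l $ i * ?h $ a $ b * S p $ i $ a * cnj (S q $ l $ b))" for p q
    unfolding trace4
    by (rule sum.cong[OF refl], rule sum.cong[OF refl], subst sum.swap) (simp add: mult_ac)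
  then show ?thesis unfolding nabla_del_f_norm_sq_def S dual_metric_def transpose_def
    by (simp add: sum_distrib_left mult_ac)
qed

lemma curvature_term_eq:
  assumes C: "\<And>i j k l. curvature M c (snd c x) i j k l = R k l $ i $ j"
  shows "curvature_term M N c d f x = (\<Sum>p\<in>UNIV. \<Sum>q\<in>UNIV. dmetric_on_M M N c d f x $ p $ q *
     trace (matrix_inv (metric M c (snd c x)) ** R p q ** matrix_inv (metric M c (snd c x))
         ** pull_form (del_f c d f (snd c x)) (metric N d (snd d (f x)))))"
proof -
  let ?gi = "matrix_inv (metric M c (snd c x))" and ?H =
      "pull_form (del_f c d f (snd c x)) (metric N d (snd d (f x)))"
  let ?P = "dmetric_on_M M N c d f x"
  have "trace (?gi ** R p q ** ?gi ** ?H) = trace (?H ** ?gi ** R p q ** ?gi)" for p q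
    using trace_mul_sym[of "?gi ** R p q ** ?gi" ?H] by (simp add: matrix_mul_assoc)
  then have T: "trace (?gi ** R p q ** ?gi ** ?H) =
      (\<Sum>i\<in>UNIV. \<Sum>t\<in>UNIV. \<Sum>s\<in>UNIV. \<Sum>l\<in>UNIV. ?H$i$l * ?gi$l$s * R p q$s$t * ?gi$t$i)" for p q
    by (simp add: trace4)
  have sw: "(\<Sum>i\<in>UNIV. \<Sum>t\<in>UNIV. \<Sum>s\<in>UNIV. \<Sum>l\<in>UNIV. \<Sum>p\<in>UNIV. \<Sum>q\<in>UNIV. F i t s l p q) =
    (\<Sum>p\<in>UNIV. \<Sum>q\<in>UNIV. \<Sum>i\<in>UNIV. \<Sum>t\<in>UNIV. \<Sum>s\<in>UNIV. \<Sum>l\<in>UNIV. F i t s l p q)"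
        for F :: "'d::finite \<Rightarrow> 'd \<Rightarrow> 'd \<Rightarrow> 'd \<Rightarrow> 'd \<Rightarrow> 'd \<Rightarrow> complex"
  proof -
    have r: "(\<Sum>l\<in>UNIV. \<Sum>p\<in>UNIV. \<Sum>q\<in>UNIV. H l p q) = (\<Sum>p\<in>UNIV. \<Sum>q\<in>UNIV. \<Sum>l\<in>UNIV. H l p q)"
        for H :: "'d \<Rightarrow> 'd \<Rightarrow> 'd \<Rightarrow> complex"
      by (subst sum.swap) (rule sum.cong[OF refl], rule sum.swap)
    have "(\<Sum>i\<in>UNIV. \<Sum>t\<in>UNIV. \<Sum>s\<in>UNIV. \<Sum>l\<in>UNIV. \<Sum>p\<in>UNIV. \<Sum>q\<in>UNIV. F i t s l p q) =
        (\<Sum>i\<in>UNIV. \<Sum>t\<in>UNIV. \<Sum>s\<in>UNIV. \<Sum>p\<in>UNIV. \<Sum>q\<in>UNIV. \<Sum>l\<in>UNIV. F i t s l p q)"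
      by (rule sum.cong[OF refl], rule sum.cong[OF refl], rule sum.cong[OF refl], rule r)
    also have "\<dots> = (\<Sum>i\<in>UNIV. \<Sum>t\<in>UNIV. \<Sum>p\<in>UNIV. \<Sum>q\<in>UNIV. \<Sum>s\<in>UNIV. \<Sum>l\<in>UNIV. F i t s l p q)"
      by (rule sum.cong[OF refl], rule sum.cong[OF refl], rule r)
    also have "\<dots> = (\<Sum>i\<in>UNIV. \<Sum>p\<in>UNIV. \<Sum>q\<in>UNIV. \<Sum>t\<in>UNIV. \<Sum>s\<in>UNIV. \<Sum>l\<in>UNIV. F i t s l p q)"
      by (rule sum.cong[OF refl], rule r)
    also have "\<dots> = (\<Sum>p\<in>UNIV. \<Sum>q\<in>UNIV. \<Sum>i\<in>UNIV. \<Sum>t\<in>UNIV. \<Sum>s\<in>UNIV. \<Sum>l\<in>UNIV. F i t s l p q)" by (rule r)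
    finally show ?thesis .
  qed
  show ?thesis unfolding curvature_term_def C
    by (subst sw) (unfold T sum_distrib_left, intro sum.cong refl, simp add: dual_metric_def
        transpose_def mult_ac)
qed

theorem proposition7p3:
  fixes M :: "('a, 'n::finite) kaehler_data"
    and N :: "('b, 'n) kaehler_data"
    and f :: "'a \<Rightarrow> 'b"
    and c :: "('a, 'n) chart" and d :: "('b, 'n) chart"
    and x :: 'a
  assumes "kaehler_manifold M" and "kaehler_manifold N"
    and "biholomorphic_onto_image (mfd_top M) (atlas M) (mfd_top N) (atlas N) f"
    and "c \<in> atlas M" and "x \<in> fst c"
    and "d \<in> atlas N" and "f x \<in> fst d"
  shows "complex_of_real (energy M N f x) * laplacian N d (log_energy M N f) (f x)
           = - ricci_term M N c d f x + curvature_term M N c d f x + e_term M N c d f x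
         \<and> complex_of_real (energy M N f x) * laplacian N d (log_energy M N f) (f x)
           \<ge> - ricci_term M N c d f x + curvature_term M N c d f x"
proof -
  note M = assms(1) and N = assms(2) and bih = assms(3) and c = assms(4,5) and d = assms(6,7)
  let ?X = "topspace (mfd_top M)"
  define finv where "finv = fwd_inv M f"
  define \<psi> where "\<psi> = snd d \<circ> f \<circ> chart_inv c"
  define \<phi> where "\<phi> = snd c \<circ> finv \<circ> chart_inv d"
  define V where "V = snd c ` {x \<in> fst c. f x \<in> fst d}"
  \<comment> \<open>the coordinate domain of \<open>\<phi>\<close>: the part of the chart \<open>d\<close> that \<open>f\<close> covers from the chart \<open>c\<close>\<close>
  define W where "W = snd d ` {y \<in> fst d. y \<in> f ` ?X \<and> finv y \<in> fst c}"
  define z where "z = snd c x"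
  define w where "w = snd d (f x)"
  define g where "g = metric M c"
  define h where "h = metric N d"
  define L where "L v = transpose (cjac \<psi> (\<phi> v))" for v
  define G where "G v = g (\<phi> v)" for v
  define E where "E = energy_of G h L"
  have f: "holomorphic_mfd_map (mfd_top M) (atlas M) (mfd_top N) (atlas N) f" and inj: "inj_on f ?X"
    using bih unfolding biholomorphic_onto_image_def by blast+
  have finv: "finv (f y) = y" if "y \<in> fst c" for y
    using that kaehler_chart(2)[OF M c(1)] inj unfolding finv_def fwd_inv_def by
        (simp add: inv_into_f_f subset_iff)
  note lc = chart_inv_left[OF kaehler_chart(1)[OF M c(1)]] and ld =
      chart_inv_left[OF kaehler_chart(1)[OF N d(1)]]
  have hol\<psi>: "holomorphic_map_on \<psi> V" using f c d unfolding holomorphic_mfd_map_def \<psi>_def V_def by blast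
  have W_ex: "\<exists>y. y \<in> fst c \<and> f y \<in> fst d \<and> v = snd d (f y)" if v: "v \<in> W" for v
  proof -
    obtain y where "y \<in> fst d" "y \<in> f ` ?X" "finv y \<in> fst c" "v = snd d y" using v unfolding W_def
        by blast
    moreover then have "f (finv y) = y" unfolding finv_def fwd_inv_def by (simp add: f_inv_into_f)
    ultimately show ?thesis by metis
  qed
  have hol\<phi>: "holomorphic_map_on \<phi> W"
  proof -
    \<comment> \<open>The inverse of \<open>f\<close> is holomorphic in the restricted chart, whose coordinate inverse is chosen on a
       smaller domain than that of \<open>d\<close>; both agree on \<open>W\<close>.\<close>
    define d' where "d' = (fst d \<inter> f ` ?X, snd d)"
    have "d' \<in> restrict_atlas (atlas N) (f ` ?X)" unfolding d'_def restrict_atlas_def using d(1)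
        by blast
    then have "holomorphic_map_on (snd c \<circ> finv \<circ> chart_inv d') (snd d' ` {y \<in> fst d'. finv y \<in> fst c})"
      using bih c(1) unfolding biholomorphic_onto_image_def holomorphic_mfd_map_def finv_def fwd_inv_def
          by blast
    also have "snd d' ` {y \<in> fst d'. finv y \<in> fst c} = W" unfolding W_def d'_def by auto
    finally have *: "holomorphic_map_on (snd c \<circ> finv \<circ> chart_inv d') W" .
    show ?thesis
    proof (rule holomorphic_map_on_cong[OF *])
      fix v assume "v \<in> W"
      then obtain y where y: "y \<in> fst d" "y \<in> f ` ?X" "v = snd d y" unfolding W_def by blast
      have "inj_on (snd d) (fst d)" by (rule inj_on_inverseI[where g = "chart_inv d"]) (rule ld)
      then have "inj_on (snd d') (fst d')" unfolding d'_def by (auto intro: inj_on_subset)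
      then have "chart_inv d' v = y" using y unfolding chart_inv_def d'_def by simp
      then show "(snd c \<circ> finv \<circ> chart_inv d') v = \<phi> v" using y ld by (simp add: \<phi>_def)
    qed
  qed
  have W: "open W" using hol\<phi> by (simp add: holomorphic_map_on_def)
  have \<phi>_at: "\<phi> (snd d (f y)) = snd c y" if "y \<in> fst c" "f y \<in> fst d" for y using that ld finv by
      (simp add: \<phi>_def)
  have \<psi>_at: "\<psi> (snd c y) = snd d (f y)" if "y \<in> fst c" for y using that lc by (simp add: \<psi>_def)
  have wW: "w \<in> W" unfolding W_def w_def using c d finv kaehler_chart(2)[OF M c(1)]
      by (intro imageI) auto
  have \<phi>w: "\<phi> w = z" unfolding w_def z_def using \<phi>_at c d by blast
  have \<phi>V: "\<phi> v \<in> V" if "v \<in> W" for v using W_ex[OF that] \<phi>_at unfolding V_def by auto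
  have VZ: "V \<subseteq> snd c ` fst c" and WZ: "W \<subseteq> snd d ` fst d" unfolding V_def W_def by auto
  have JK: "cjac \<psi> (\<phi> v) ** cjac \<phi> v = mat 1" "invertible (cjac \<psi> (\<phi> v))" if v: "v \<in> W" for v
  proof -
    note 1 = holomorphic_map_on_component(3)[OF hol\<phi> v] and 2 =
        holomorphic_map_on_component(3)[OF hol\<psi> \<phi>V[OF v]]
    have "\<psi> (\<phi> u) = u" if "u \<in> W" for u using W_ex[OF that] \<phi>_at \<psi>_at by auto
    from jacobian_inverse[OF W v 1 2 this] show "cjac \<psi> (\<phi> v) ** cjac \<phi> v =
        mat 1" "invertible (cjac \<psi> (\<phi> v))" by auto
  qed
  have g2: "mdiff2 g (snd c ` fst c)"
    unfolding mdiff2_def g_def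
        using wirt2_of_Cinf_on[OF kaehler_chart(3)[OF M c(1)] kaehler_manifoldD(2)[OF M c(1)]] by blast
  have h2': "mdiff2 h (snd d ` fst d)"
    unfolding mdiff2_def h_def
        using wirt2_of_Cinf_on[OF kaehler_chart(3)[OF N d(1)] kaehler_manifoldD(2)[OF N d(1)]] by blast
  have h2: "mdiff2 h W" using h2' WZ unfolding mdiff2_def wirt2_def by blast
  have cl: "closed_form_on h W" using kaehler_manifoldD(4)[OF N d(1)] WZ
      unfolding closed_form_on_def h_def by blast
  have \<phi>Z: "\<phi> v \<in> snd c ` fst c" if "v \<in> W" for v using \<phi>V[OF that] VZ by blast
  have G1: "mdiff G v" if "v \<in> W" for v
    unfolding G_def[abs_def] by (rule mwirt_compose(1)[OF hol\<phi> that mdiff2D(1)[OF g2 \<phi>Z[OF that]]])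
  have G2: "mdiff (mwirt 1 q G) v" if "v \<in> W" for v q
    unfolding G_def[abs_def] by (rule chern_curv_compose(1)[OF hol\<phi> that \<phi>Z g2])
  have Gpos: "hermitian_pos_def (G v)" if "v \<in> W" for v
    unfolding G_def g_def by (rule kaehler_manifoldD(3)[OF M c(1) \<phi>Z[OF that]])
  have hpos: "hermitian_pos_def (h v)" if "v \<in> W" for v
    unfolding h_def by (rule kaehler_manifoldD(3)[OF N d(1)]) (use that WZ in blast)
  have mL: "mhol L W" unfolding mhol_def
  proof (intro allI)
    fix i j
    have "hol_on (\<lambda>v. cjac \<psi> (\<phi> v) $ j $ i) W" by (rule hol_on_compose[OF hol_on_cjac[OF hol\<psi>] \<phi>V hol\<phi>])
    then show "hol_on (\<lambda>v. L v $ i $ j) W" by (simp add: L_def transpose_def)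
  qed
  have Li: "invertible (L v)" if "v \<in> W" for v unfolding L_def
      by (rule invertible_transpose[OF JK(2)[OF that]])
  have L_pull: "pull_form (cjac \<psi> (\<phi> v)) H = L v ** H ** hadj (L v)" for v H by
      (simp add: pull_form_eq L_def)
  have tr: "trace_pull M c d f H x = trace (matrix_inv (G w) ** (L w ** H ** hadj (L w)))" for H
    unfolding trace_pull_eq G_def g_def \<phi>w z_def del_f_def \<psi>_def[symmetric] L_pull[symmetric] by
        (simp add: \<phi>w z_def)
  note ctx = W G1 G2 Gpos h2[THEN mdiff2D(1)] h2[THEN mdiff2D(2)] hpos mL Li
  have Epos: "0 < E v" if "v \<in> W" for v unfolding E_def by (rule energy_of_pos[OF ctx that])
  have E_energy: "energy M N f y = Re (E (snd d (f y)))" if y: "y \<in> fst c" "f y \<in> fst d" for y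
    unfolding energy_eq[OF M N f c(1) y(1) d(1) y(2)] trace_pull_eq E_def energy_of_def G_def
        L_pull[symmetric] \<phi>_at[OF y]
    by (simp add: g_def h_def del_f_def \<psi>_def)
  have E_real: "complex_of_real (Re (E v)) = E v" "0 < Re (E v)" if "v \<in> W" for v
    using Epos[OF that] by (auto simp: less_complex_def complex_eq_iff)
  \<comment> \<open>The complex logarithm is used because the rules for \<open>wirt\<close> are about complex functions.\<close>
  have log: "complex_of_real (log_energy M N f (chart_inv d v)) = Ln (E v)" if v: "v \<in> W" for v
  proof -
    obtain y where y: "y \<in> fst c" "f y \<in> fst d" "v = snd d (f y)" using W_ex[OF v] by blast
    then have "log_energy M N f (chart_inv d v) = ln (Re (E v))"
      using finv ld E_energy by (simp add: log_energy_def finv_def)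
    then show ?thesis using Ln_of_real[OF E_real(2)[OF v]] E_real(1)[OF v] by simp
  qed
  have Ew: "complex_of_real (energy M N f x) = E w" using E_energy[OF c(2) d(2)] E_real(1)[OF wW] by
      (simp add: w_def)
  let ?D = "dual_metric (h w)"
  have lap: "laplacian N d (log_energy M N f) (f x) =
      (\<Sum>p\<in>UNIV. \<Sum>q\<in>UNIV. ?D $ p $ q * wirt (-1) p (wirt 1 q (\<lambda>v. Ln (E v))) w)"
    unfolding laplacian_def dz_eq_wirt dzbar_eq_wirt h_def[symmetric] w_def[symmetric]
    by (intro sum.cong arg_cong2[where f = "(*)"] refl wirt_cong[OF W wW] wirt_cong[OF W] log)
  have grad: "grad_norm_sq N d (log_energy M N f) (f x) =
      (\<Sum>p\<in>UNIV. \<Sum>q\<in>UNIV. ?D $ p $ q * wirt (-1) p (\<lambda>v. Ln (E v)) w * wirt 1 q (\<lambda>v. Ln (E v)) w)"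
    unfolding grad_norm_sq_def dz_eq_wirt dzbar_eq_wirt h_def[symmetric] w_def[symmetric]
    by (intro sum.cong arg_cong2[where f = "(*)"] refl wirt_cong[OF W wW] log)
  have ric: "ricci_term M N c d f x =
      trace (matrix_inv (G w) ** (L w ** (\<chi> i j. - wirt (-1) i (wirt 1 j (\<lambda>w. Ln (det (h w)))) w)
      ** hadj (L w)))"
    unfolding ricci_term_def tr by (simp add: ricci_def dz_eq_wirt dzbar_eq_wirt h_def w_def)
  let ?K = "cjac \<phi> w"
  have P: "dmetric_on_M M N c d f x = push_dual ?K ?D"
    unfolding dmetric_on_M_def del_f_inv_def by (simp add: h_def w_def \<phi>_def finv_def)
  have Gw: "G w = g z" by (simp add: G_def \<phi>w)
  have z: "z \<in> snd c ` fst c" using c(2) by (simp add: z_def)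
  have "curvature M c (snd c x) i j k l = chern_curv g k l z $ i $ j" for i j k l
  proof -
    have "wirt 1 l (wirt (-1) k (\<lambda>w. g w $ i $ j)) z = wirt (-1) k (wirt 1 l (\<lambda>w. g w $ i $ j)) z"
      using g2 z unfolding mdiff2_def wirt2_def by blast
    moreover have "(mwirt (-1) k g z ** matrix_inv (g z) ** mwirt 1 l g z) $ i $ j = (\<Sum>s\<in>UNIV. \<Sum>t\<in>UNIV.
        matrix_inv (g z) $ t $ s * wirt (-1) k (\<lambda>w. g w $ i $ t) z * wirt 1 l (\<lambda>w. g w $ s $ j) z)"
      by (simp add: matrix_matrix_mult_def sum_distrib_left sum_distrib_right mult_ac)
    ultimately show ?thesis
      by (simp add: curvature_def chern_curv_def dz_eq_wirt dzbar_eq_wirt dual_metric_def transpose_def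
          flip: g_def z_def)
  qed
  note cu = curvature_term_eq[OF this]
  have curvt: "curvature_term M N c d f x =
    (\<Sum>p\<in>UNIV. \<Sum>q\<in>UNIV. ?D $ p $ q * trace (matrix_inv (G w) ** chern_curv G p q w ** matrix_inv (G w)
        ** (L w ** h w ** hadj (L w))))"
  proof -
    have cG: "chern_curv (\<lambda>v. g (\<phi> v)) p q w =
        (\<Sum>a\<in>UNIV. \<Sum>b\<in>UNIV. mscale (?K $ a $ p * cnj (?K $ b $ q)) (chern_curv g a b (\<phi> w)))" for p q
      by (rule chern_curv_compose(2)[OF hol\<phi> wW _ g2]) (rule \<phi>Z)
    have "trace (matrix_inv (G w) ** chern_curv G p q w ** matrix_inv (G w)
        ** (L w ** h w ** hadj (L w))) =
      (\<Sum>a\<in>UNIV. \<Sum>b\<in>UNIV. ?K $ a $ p * cnj (?K $ b $ q) * trace (matrix_inv (g z) ** chern_curv g a b z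
          ** matrix_inv (g z) ** (L w ** h w ** hadj (L w))))" for p q
      unfolding G_def[abs_def] cG \<phi>w
      by (simp add: matrix_sum_left matrix_sum_right mscale_algebra trace_sum trace_mscale)
    moreover have "pull_form (del_f c d f (snd c x)) (metric N d (snd d (f x))) = L w ** h w
        ** hadj (L w)"
      unfolding L_pull[symmetric] \<phi>w by (simp add: del_f_def \<psi>_def z_def h_def w_def)
    ultimately show ?thesis unfolding cu P by (simp add: sum_pushforward flip: g_def z_def)
  qed
  define S where "S a = mwirt (-1) a (\<lambda>z. transpose (cjac \<psi> z)) (\<phi> w) - mwirt (-1) a g (\<phi> w)
      ** matrix_inv (g (\<phi> w)) ** L w
     + (\<Sum>b\<in>UNIV. mscale (cjac \<psi> (\<phi> w) $ b $ a) (L w ** mwirt (-1) b h w ** matrix_inv (h w)))" for a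
  have sf: "second_form G h L p w = (\<Sum>a\<in>UNIV. mscale (?K $ a $ p) (S a))" for p
    unfolding S_def G_def[abs_def] L_def[abs_def]
    by (rule second_form_pushforward[OF hol\<phi> wW hol\<psi> \<phi>V[OF wW] mdiff2D(1)[OF g2 \<phi>Z[OF wW]]
        JK(1)[OF wW]])
  have "nabla_del_f M N c d f x a p i = S p $ i $ a" for a p i
    unfolding nabla_del_f_eq S_def L_def \<phi>w by (simp add: del_f_def \<psi>_def z_def w_def g_def h_def)
  note na = nabla_del_f_norm_sq_eq[OF this]
  have nabla: "nabla_del_f_norm_sq M N c d f x =
     (\<Sum>p\<in>UNIV. \<Sum>q\<in>UNIV. ?D $ p $ q * trace (second_form G h L p w ** h w ** hadj (second_form G h L q w)
         ** matrix_inv (G w)))"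
  proof -
    have hs: "hadj (second_form G h L q w) = (\<Sum>b\<in>UNIV. mscale (cnj (?K $ b $ q)) (hadj (S b)))" for q
      unfolding sf by (simp add: vec_eq_iff sum_component)
    have "trace (second_form G h L p w ** h w ** hadj (second_form G h L q w) ** matrix_inv (G w)) =
      (\<Sum>a\<in>UNIV. \<Sum>b\<in>UNIV. ?K $ a $ p * cnj (?K $ b $ q) * trace (S a ** h w ** hadj (S b)
          ** matrix_inv (g z)))" for p q
      unfolding hs Gw unfolding sf
      by (subst sum.swap) (simp add: matrix_sum_left matrix_sum_right mscale_algebra trace_sum
          trace_mscale sum_distrib_left mult_ac)
    then show ?thesis unfolding na P by (simp add: sum_pushforward flip: g_def z_def h_def w_def)
  qed
  have e: "e_term M N c d f x =
    (\<Sum>p\<in>UNIV. \<Sum>q\<in>UNIV. ?D $ p $ q * trace (second_form G h L p w ** h w ** hadj (second_form G h L q w)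
        ** matrix_inv (G w)))
    - E w * (\<Sum>p\<in>UNIV. \<Sum>q\<in>UNIV. ?D $ p $ q * wirt (-1) p (\<lambda>v. Ln (E v)) w * wirt 1 q (\<lambda>v. Ln (E v)) w)"
    unfolding e_term_def Ew nabla grad ..
  note main = local_bochner[OF ctx wW cl h2, folded E_def, folded e]
  have "complex_of_real (energy M N f x) * laplacian N d (log_energy M N f) (f x)
           = - ricci_term M N c d f x + curvature_term M N c d f x + e_term M N c d f x"
    unfolding Ew lap ric curvt by (rule main(1))
  moreover have "0 \<le> e_term M N c d f x" by (rule main(2))
  ultimately show ?thesis by simp
qed

end
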